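(* If CH holds and $\kappa\ge\omega_2$ is a cardinal, then there is a $\sigma$-complete, $\omega_2$-c.c. poset $P$ such that in $V^P$ there is a function $g:[\kappa]^2\to\omega_1$ such that (1) $g$ establishes $\kappa\not\rightarrow[(\omega_1,\omega_2)]^2_{\omega_1}$, and (2) there is no uncountable $g$-rainbow subset of $\kappa$.
   Context: $[X]^2$ is the set of two-element subsets of $X$. For sets $A,B$ of ordinals, $[A,B]=\{\{\alpha,\beta\}:\alpha\in A,\ \beta\in B,\ \alpha\ne\beta\}$, and $g''[A,B]$ is the image of this set under $g$. A function $g:[\kappa]^2\to\omega_1$ establishes $\kappa\not\rightarrow[(\omega_1,\omega_2)]^2_{\omega_1}$ if $g''[A,B]=\omega_1$ for all $A,B\subseteq\kappa$ with $|A|=\omega_1$ and $|B|=\omega_2$ (no order relation between $A$ and $B$ is required). A set $R\subseteq\kappa$ is $g$-rainbow if $g\restriction[R]^2$ is one-to-one. A poset is $\sigma$-complete if every decreasing $\omega$-sequence of conditions has a lower bound; it is $\omega_2$-c.c. if every antichain has size at most $\omega_1$. $V^P$ denotes a generic extension of the ground model $V$ by $P$. *)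

theory Defs
  imports Main
begin

unbundle cardinal_syntax

section \<open>Posets\<close>

text \<open>
  A poset is given by a carrier \<open>P\<close> and a relation \<open>le\<close> with \<open>partial_order_on P le\<close>;
  \<open>(q, p) \<in> le\<close> means \<open>q \<le> p\<close>, i.e. \<open>q\<close> is the stronger condition.
\<close>

definition compatible_in :: "'p set \<Rightarrow> 'p rel \<Rightarrow> 'p \<Rightarrow> 'p \<Rightarrow> bool" where
  "compatible_in P le p q \<longleftrightarrow> (\<exists>s\<in>P. (s, p) \<in> le \<and> (s, q) \<in> le)"

definition antichain_in :: "'p set \<Rightarrow> 'p rel \<Rightarrow> 'p set \<Rightarrow> bool" where
  "antichain_in P le A \<longleftrightarrow> A \<subseteq> P \<and> pairwise (\<lambda>p q. \<not> compatible_in P le p q) A"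

definition sigma_complete :: "'p set \<Rightarrow> 'p rel \<Rightarrow> bool" where
  "sigma_complete P le \<longleftrightarrow>
     (\<forall>f :: nat \<Rightarrow> 'p. range f \<subseteq> P \<and> (\<forall>n. (f (Suc n), f n) \<in> le) \<longrightarrow>
        (\<exists>q\<in>P. \<forall>n. (q, f n) \<in> le))"

abbreviation card_omega1 :: "nat set rel" where
  "card_omega1 \<equiv> cardSuc natLeq"

abbreviation card_omega2 :: "nat set set rel" where
  "card_omega2 \<equiv> cardSuc card_omega1"

definition omega2_cc :: "'p set \<Rightarrow> 'p rel \<Rightarrow> bool" where
  "omega2_cc P le \<longleftrightarrow> (\<forall>A. antichain_in P le A \<longrightarrow> |A| \<le>o card_omega1)"

definition CH :: bool where
  "CH \<longleftrightarrow> |UNIV :: nat set set| =o card_omega1"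


section \<open>Names\<close>

text \<open>
  A name is a set of pairs (name, condition). HOL has no type closed under forming sets of its own
  elements, so a name is presented as a partial family of such pairs indexed by \<open>'i\<close>, and
  \<open>elts\<close> is the set of pairs it stands for. The names over \<open>'i\<close> are thus the names of
  hereditary size at most \<open>|UNIV :: 'i set|\<close>.
\<close>

datatype ('i, 'p) name = Name "'i \<rightharpoonup> ('i, 'p) name \<times> 'p"

primrec elts :: "('i, 'p) name \<Rightarrow> (('i, 'p) name \<times> 'p) set" where
  "elts (Name f) = ran f"

text \<open>The names all of whose conditions, hereditarily, belong to \<open>P\<close>.\<close>

inductive_set names :: "'p set \<Rightarrow> ('i, 'p) name set" for P where
  "(\<And>y s. (y, s) \<in> elts x \<Longrightarrow> s \<in> P \<and> y \<in> names P) \<Longrightarrow> x \<in> names P"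

definition subname :: "('i, 'p) name rel" where
  "subname = {(y, x). \<exists>s. (y, s) \<in> elts x}"

lemma wf_subname: "wf (subname :: ('i, 'p) name rel)"
proof (rule wfUNIVI)
  fix Q :: "('i, 'p) name \<Rightarrow> bool" and x
  assume *: "\<forall>x. (\<forall>y. (y, x) \<in> subname \<longrightarrow> Q y) \<longrightarrow> Q x"
  show "Q x"
  proof (induction x)
    case (Name f)
    have "Q y" if "(y, Name f) \<in> subname" for y
    proof -
      from that obtain s i where "f i = Some (y, s)"
        by (auto simp: subname_def ran_def)
      then show ?thesis
        by (intro Name[of "Some (y, s)" "(y, s)"]) (auto intro: rev_image_eqI simp: eq_commute)
    qed
    with * show ?case by blast
  qed
qed

text \<open>
  The canonical name of the von Neumann ordinal represented by \<open>x\<close> in the well-order \<open>r\<close>,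
  namely \<open>{(check y, p) | y < x, p \<in> P}\<close>; no greatest condition is assumed, so all conditions
  are attached.
\<close>

definition check_elem :: "'p set \<Rightarrow> 'a rel \<Rightarrow> 'a \<Rightarrow> ('a \<times> 'p, 'p) name" where
  "check_elem P r = wfrec (r - Id)
     (\<lambda>c x. Name (\<lambda>(y, p). if (y, x) \<in> r - Id \<and> p \<in> P then Some (c y, p) else None))"

lemma check_elem_unfold:
  assumes "Well_order r"
  shows "check_elem P r x =
    Name (\<lambda>(y, p). if (y, x) \<in> r - Id \<and> p \<in> P then Some (check_elem P r y, p) else None)"
proof -
  have "wf (r - Id)"
    using assms by (simp add: well_order_on_def)
  from wfrec[OF this, of "\<lambda>c x. Name (\<lambda>(y, p). if (y, x) \<in> r - Id \<and> p \<in> P then Some (c y, p) else None)" x]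
  show ?thesis
    unfolding check_elem_def by (simp add: cut_def cong: if_cong conj_cong)
qed

text \<open>The canonical name of the order type of \<open>r\<close>.\<close>

definition check_ordinal :: "'p set \<Rightarrow> 'a rel \<Rightarrow> ('a \<times> 'p, 'p) name" where
  "check_ordinal P r =
     Name (\<lambda>(x, p). if x \<in> Field r \<and> p \<in> P then Some (check_elem P r x, p) else None)"


section \<open>The forcing relation\<close>

text \<open>
  Formulas of the language of set theory with parameters of type \<open>'n\<close>; binding is represented by
  functions.
\<close>

datatype 'n fm =
    Mem 'n 'n (infix "\<^bold>\<in>" 50)
  | Eql 'n 'n (infix "\<^bold>=" 50)
  | Neg "'n fm" ("\<^bold>\<not> _" [40] 40)
  | Conj "'n fm" "'n fm" (infixr "\<^bold>\<and>" 35)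
  | Forall "'n \<Rightarrow> 'n fm" (binder "\<^bold>\<forall>" 10)

abbreviation Implies (infixr "\<^bold>\<longrightarrow>" 25) where
  "\<phi> \<^bold>\<longrightarrow> \<psi> \<equiv> \<^bold>\<not> (\<phi> \<^bold>\<and> \<^bold>\<not> \<psi>)"

abbreviation Disj (infixr "\<^bold>\<or>" 30) where
  "\<phi> \<^bold>\<or> \<psi> \<equiv> \<^bold>\<not> (\<^bold>\<not> \<phi> \<^bold>\<and> \<^bold>\<not> \<psi>)"

abbreviation Equiv (infixr "\<^bold>\<longleftrightarrow>" 25) where
  "\<phi> \<^bold>\<longleftrightarrow> \<psi> \<equiv> (\<phi> \<^bold>\<longrightarrow> \<psi>) \<^bold>\<and> (\<psi> \<^bold>\<longrightarrow> \<phi>)"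

abbreviation Exists (binder "\<^bold>\<exists>" 10) where
  "\<^bold>\<exists>x. \<phi> x \<equiv> \<^bold>\<not> (\<^bold>\<forall>x. \<^bold>\<not> \<phi> x)"

definition dense_below :: "'p rel \<Rightarrow> 'p \<Rightarrow> ('p \<Rightarrow> bool) \<Rightarrow> bool" where
  "dense_below le p D \<longleftrightarrow> (\<forall>q. (q, p) \<in> le \<longrightarrow> (\<exists>t. (t, q) \<in> le \<and> D t))"

text \<open>
  \<open>p\<close> forces \<open>x = y\<close> iff whenever \<open>(z, s) \<in> x\<close> and \<open>q \<le> p, s\<close>, then \<open>q\<close> forces \<open>z \<in> y\<close>,
  and symmetrically; \<open>p\<close> forces \<open>z \<in> y\<close> iff it is dense below \<open>p\<close> to lie below some \<open>u\<close> with
  \<open>(w, u) \<in> y\<close> while forcing \<open>z = w\<close>. The second clause is inlined in the first to obtain a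
  recursion on \<open>x\<close>.
\<close>

function forces_eq ::
  "'p rel \<Rightarrow> ('i, 'p) name \<Rightarrow> ('i, 'p) name \<Rightarrow> 'p \<Rightarrow> bool" where
  "forces_eq le x y p \<longleftrightarrow>
     (\<forall>(z, s)\<in>elts x. \<forall>q. (q, p) \<in> le \<and> (q, s) \<in> le \<longrightarrow>
        dense_below le q (\<lambda>t. \<exists>(w, u)\<in>elts y. (t, u) \<in> le \<and> forces_eq le z w t)) \<and>
     (\<forall>(w, u)\<in>elts y. \<forall>q. (q, p) \<in> le \<and> (q, u) \<in> le \<longrightarrow>
        dense_below le q (\<lambda>t. \<exists>(z, s)\<in>elts x. (t, s) \<in> le \<and> forces_eq le z w t))"
  by pat_completeness auto
termination
  by (relation "inv_image subname (\<lambda>(le, x, y, p). x)")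
     (auto intro!: wf_inv_image wf_subname, auto simp: subname_def)

declare forces_eq.simps [simp del]

definition forces_mem ::
  "'p rel \<Rightarrow> ('i, 'p) name \<Rightarrow> ('i, 'p) name \<Rightarrow> 'p \<Rightarrow> bool" where
  "forces_mem le x y p \<longleftrightarrow>
     dense_below le p (\<lambda>t. \<exists>(w, u)\<in>elts y. (t, u) \<in> le \<and> forces_eq le x w t)"

primrec forces :: "'p set \<Rightarrow> 'p rel \<Rightarrow> 'p \<Rightarrow> ('i, 'p) name fm \<Rightarrow> bool" where
  "forces P le p (x \<^bold>\<in> y) \<longleftrightarrow> forces_mem le x y p"
| "forces P le p (x \<^bold>= y) \<longleftrightarrow> forces_eq le x y p"
| "forces P le p (\<^bold>\<not> \<phi>) \<longleftrightarrow> (\<forall>q. (q, p) \<in> le \<longrightarrow> \<not> forces P le q \<phi>)"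
| "forces P le p (\<phi> \<^bold>\<and> \<psi>) \<longleftrightarrow> forces P le p \<phi> \<and> forces P le p \<psi>"
| "forces P le p (Forall \<phi>) \<longleftrightarrow> (\<forall>x\<in>names P. forces P le p (\<phi> x))"

text \<open>
  Truth in \<open>V\<^sup>P\<close>, i.e. in every generic extension by \<open>P\<close>. The quantifiers range over the sets in
  the extension of hereditary size at most \<open>|UNIV :: 'i set|\<close>, so \<open>'i\<close> has to be large enough for
  the formula at hand. With \<open>'i = 'a \<times> 'p\<close>, as for the canonical names above, this covers all
  subsets of an ordinal represented on \<open>'a\<close>, and all relations and functions on it.
\<close>

definition holds_in_extension :: "'p set \<Rightarrow> 'p rel \<Rightarrow> ('i, 'p) name fm \<Rightarrow> bool" where
  "holds_in_extension P le \<phi> \<longleftrightarrow> (\<forall>p\<in>P. forces P le p \<phi>)"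


section \<open>Set-theoretic notions as formulas\<close>

definition ball_fm :: "'n \<Rightarrow> ('n \<Rightarrow> 'n fm) \<Rightarrow> 'n fm" where
  "ball_fm A \<phi> = (\<^bold>\<forall>x. x \<^bold>\<in> A \<^bold>\<longrightarrow> \<phi> x)"

definition bex_fm :: "'n \<Rightarrow> ('n \<Rightarrow> 'n fm) \<Rightarrow> 'n fm" where
  "bex_fm A \<phi> = (\<^bold>\<exists>x. x \<^bold>\<in> A \<^bold>\<and> \<phi> x)"

syntax
  "_ball_fm" :: "pttrn \<Rightarrow> 'n \<Rightarrow> 'n fm \<Rightarrow> 'n fm" ("(3\<^bold>\<forall>_\<^bold>\<in>_./ _)" [0, 51, 10] 10)
  "_bex_fm" :: "pttrn \<Rightarrow> 'n \<Rightarrow> 'n fm \<Rightarrow> 'n fm" ("(3\<^bold>\<exists>_\<^bold>\<in>_./ _)" [0, 51, 10] 10)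
translations
  "\<^bold>\<forall>x\<^bold>\<in>A. \<phi>" \<rightleftharpoons> "CONST ball_fm A (\<lambda>x. \<phi>)"
  "\<^bold>\<exists>x\<^bold>\<in>A. \<phi>" \<rightleftharpoons> "CONST bex_fm A (\<lambda>x. \<phi>)"

definition subset_fm :: "'n \<Rightarrow> 'n \<Rightarrow> 'n fm" where
  "subset_fm A B = (\<^bold>\<forall>x\<^bold>\<in>A. x \<^bold>\<in> B)"

text \<open>\<open>e = {x, y}\<close>\<close>

definition upair_fm :: "'n \<Rightarrow> 'n \<Rightarrow> 'n \<Rightarrow> 'n fm" where
  "upair_fm e x y = (\<^bold>\<forall>z. z \<^bold>\<in> e \<^bold>\<longleftrightarrow> z \<^bold>= x \<^bold>\<or> z \<^bold>= y)"

text \<open>\<open>e = (x, y)\<close>, the Kuratowski pair \<open>{{x}, {x, y}}\<close>\<close>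

definition opair_fm :: "'n \<Rightarrow> 'n \<Rightarrow> 'n \<Rightarrow> 'n fm" where
  "opair_fm e x y = (\<^bold>\<exists>a b. upair_fm a x x \<^bold>\<and> upair_fm b x y \<^bold>\<and> upair_fm e a b)"

text \<open>\<open>(x, y) \<in> f\<close>, which for functions reads \<open>f(x) = y\<close>\<close>

definition app_fm :: "'n \<Rightarrow> 'n \<Rightarrow> 'n \<Rightarrow> 'n fm" where
  "app_fm f x y = (\<^bold>\<exists>e\<^bold>\<in>f. opair_fm e x y)"

text \<open>\<open>f : A \<rightarrow> B\<close>\<close>

definition function_fm :: "'n \<Rightarrow> 'n \<Rightarrow> 'n \<Rightarrow> 'n fm" where
  "function_fm f A B =
     ((\<^bold>\<forall>e\<^bold>\<in>f. \<^bold>\<exists>x\<^bold>\<in>A. \<^bold>\<exists>y\<^bold>\<in>B. opair_fm e x y) \<^bold>\<and>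
      (\<^bold>\<forall>x\<^bold>\<in>A. \<^bold>\<exists>y. app_fm f x y \<^bold>\<and> (\<^bold>\<forall>y'. app_fm f x y' \<^bold>\<longrightarrow> y' \<^bold>= y)))"

definition injection_fm :: "'n \<Rightarrow> 'n \<Rightarrow> 'n \<Rightarrow> 'n fm" where
  "injection_fm f A B =
     (function_fm f A B \<^bold>\<and>
      (\<^bold>\<forall>x x' y. app_fm f x y \<^bold>\<and> app_fm f x' y \<^bold>\<longrightarrow> x \<^bold>= x'))"

definition bijection_fm :: "'n \<Rightarrow> 'n \<Rightarrow> 'n \<Rightarrow> 'n fm" where
  "bijection_fm f A B = (injection_fm f A B \<^bold>\<and> (\<^bold>\<forall>y\<^bold>\<in>B. \<^bold>\<exists>x\<^bold>\<in>A. app_fm f x y))"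

definition card_le_fm :: "'n \<Rightarrow> 'n \<Rightarrow> 'n fm" where
  "card_le_fm A B = (\<^bold>\<exists>f. injection_fm f A B)"

definition card_eq_fm :: "'n \<Rightarrow> 'n \<Rightarrow> 'n fm" where
  "card_eq_fm A B = (\<^bold>\<exists>f. bijection_fm f A B)"

definition transitive_fm :: "'n \<Rightarrow> 'n fm" where
  "transitive_fm x = (\<^bold>\<forall>y\<^bold>\<in>x. subset_fm y x)"

definition ordinal_fm :: "'n \<Rightarrow> 'n fm" where
  "ordinal_fm x = (transitive_fm x \<^bold>\<and> (\<^bold>\<forall>y\<^bold>\<in>x. transitive_fm y))"

definition limit_fm :: "'n \<Rightarrow> 'n fm" where
  "limit_fm x = (ordinal_fm x \<^bold>\<and> (\<^bold>\<exists>y. y \<^bold>\<in> x) \<^bold>\<and> (\<^bold>\<forall>y\<^bold>\<in>x. \<^bold>\<exists>z\<^bold>\<in>x. y \<^bold>\<in> z))"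

text \<open>\<open>x\<close> is the least nonzero limit ordinal \<open>\<omega>\<close>.\<close>

definition omega_fm :: "'n \<Rightarrow> 'n fm" where
  "omega_fm x = (limit_fm x \<^bold>\<and> (\<^bold>\<forall>y\<^bold>\<in>x. \<^bold>\<not> limit_fm y))"

text \<open>\<open>x\<close> is the least ordinal that does not inject into the infinite cardinal \<open>v\<close>, i.e. \<open>v\<^sup>+\<close>.\<close>

definition card_suc_fm :: "'n \<Rightarrow> 'n \<Rightarrow> 'n fm" where
  "card_suc_fm x v =
     (ordinal_fm x \<^bold>\<and> \<^bold>\<not> card_le_fm x v \<^bold>\<and> (\<^bold>\<forall>y\<^bold>\<in>x. card_le_fm y v))"


section \<open>Colourings\<close>

text \<open>\<open>e \<in> [A, B] = {{\<alpha>, \<beta>} | \<alpha> \<in> A, \<beta> \<in> B, \<alpha> \<noteq> \<beta>}\<close>; in particular \<open>[A, A]\<close> is \<open>[A]\<^sup>2\<close>.\<close>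

definition in_pairs_fm :: "'n \<Rightarrow> 'n \<Rightarrow> 'n \<Rightarrow> 'n fm" where
  "in_pairs_fm e A B = (\<^bold>\<exists>\<alpha>\<^bold>\<in>A. \<^bold>\<exists>\<beta>\<^bold>\<in>B. \<^bold>\<not> \<alpha> \<^bold>= \<beta> \<^bold>\<and> upair_fm e \<alpha> \<beta>)"

text \<open>\<open>g : [K]\<^sup>2 \<rightarrow> w\<close>\<close>

definition pair_colouring_fm :: "'n \<Rightarrow> 'n \<Rightarrow> 'n \<Rightarrow> 'n fm" where
  "pair_colouring_fm g K w =
     (\<^bold>\<exists>D. (\<^bold>\<forall>e. e \<^bold>\<in> D \<^bold>\<longleftrightarrow> in_pairs_fm e K K) \<^bold>\<and> function_fm g D w)"

text \<open>\<open>w = g''[A, B]\<close>\<close>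

definition image_pairs_fm :: "'n \<Rightarrow> 'n \<Rightarrow> 'n \<Rightarrow> 'n \<Rightarrow> 'n fm" where
  "image_pairs_fm w g A B =
     (\<^bold>\<forall>\<xi>. \<xi> \<^bold>\<in> w \<^bold>\<longleftrightarrow> (\<^bold>\<exists>e. in_pairs_fm e A B \<^bold>\<and> app_fm g e \<xi>))"

text \<open>\<open>g\<close> establishes \<open>K \<not>\<rightarrow> [(w\<^sub>1, w\<^sub>2)]\<^sup>2\<close> with \<open>w\<^sub>1\<close> colours.\<close>

definition establishes_fm :: "'n \<Rightarrow> 'n \<Rightarrow> 'n \<Rightarrow> 'n \<Rightarrow> 'n fm" where
  "establishes_fm g K w1 w2 =
     (\<^bold>\<forall>A B. subset_fm A K \<^bold>\<and> subset_fm B K \<^bold>\<and> card_eq_fm A w1 \<^bold>\<and> card_eq_fm B w2 \<^bold>\<longrightarrow>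
        image_pairs_fm w1 g A B)"

text \<open>\<open>R\<close> is \<open>g\<close>-rainbow: \<open>g\<close> is one-to-one on \<open>[R]\<^sup>2\<close>.\<close>

definition rainbow_fm :: "'n \<Rightarrow> 'n \<Rightarrow> 'n fm" where
  "rainbow_fm g R =
     (\<^bold>\<forall>e e' \<xi>. in_pairs_fm e R R \<^bold>\<and> in_pairs_fm e' R R \<^bold>\<and> app_fm g e \<xi> \<^bold>\<and> app_fm g e' \<xi> \<^bold>\<longrightarrow>
        e \<^bold>= e')"

text \<open>
  The cardinals \<open>\<omega>\<close>, \<open>\<omega>\<^sub>1\<close>, \<open>\<omega>\<^sub>2\<close> are those of the universe in which the formula is evaluated.
\<close>

definition no_rainbow_colouring_fm :: "'n \<Rightarrow> 'n fm" where
  "no_rainbow_colouring_fm K =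
     (\<^bold>\<exists>w0 w1 w2. omega_fm w0 \<^bold>\<and> card_suc_fm w1 w0 \<^bold>\<and> card_suc_fm w2 w1 \<^bold>\<and>
        (\<^bold>\<exists>g. pair_colouring_fm g K w1 \<^bold>\<and>
           establishes_fm g K w1 w2 \<^bold>\<and>
           \<^bold>\<not> (\<^bold>\<exists>R. subset_fm R K \<^bold>\<and> \<^bold>\<not> card_le_fm R w0 \<^bold>\<and> rainbow_fm g R)))"

end

theory Submission
  imports Defs "HOL-Library.Countable_Set_Type"
begin

text \<open>
  A condition is a countable partial colouring. It may only be extended by points whose type over
  the old domain agrees, modulo a finite set, with the type of an old point. Closure under countable
  unions is immediate. Two conditions that are isomorphic over a common root can be amalgamated by
  copying types, and finitely many of the new pairs may be coloured at will; with a \<open>\<Delta>\<close>-system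
  argument under CH this gives both the \<open>\<omega>\<^sub>2\<close>-chain condition and the negative partition
  relation. There is no uncountable rainbow set because a condition admits only countably many types
  modulo finite: two points of the same type over an infinite part of the set see some point of that
  part in the same colour.
\<close>

section \<open>The forcing relation\<close>

text \<open>Two demands on the order pull against each other. Excluding rainbow sets means leaving
  few types to new points, whereas the partition relation needs a freely chosen colour between a
  point of \<open>A\<close> and a point of \<open>B\<close>. Agreement modulo finite serves both:
  changing one colour is a finite error, while two points that agree modulo finite with the same old
  point still agree somewhere on every infinite subset of the old domain. The finite errors also
  absorb the pair of a point and its copy, where copying would yield the diagonal value. CH enters
  through \<omega>1^\<omega> = \<omega>1: a set of size \<omega>1 can be closed under operations on
  its countable sequences, and a condition is coded by such a sequence. The formula speaks of
  \<omega>, \<omega>1 and \<omega>2 of the extension. Initial segments of \<kappa> name them;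
  \<sigma>-completeness and the chain condition keep these segments the right cardinals. No generic
  filter appears: parameters are decided by strengthening a condition, and what holds densely is
  forced.\<close>

locale forcing =
  fixes P :: "'p set" and le :: "'p rel"
  assumes po: "partial_order_on P le"
begin

abbreviation frc :: "'p \<Rightarrow> ('i, 'p) name fm \<Rightarrow> bool" ("(_ \<tturnstile> _)" [51, 10] 10) where
  "p \<tturnstile> \<phi> \<equiv> forces P le p \<phi>"

lemma le_refl: "p \<in> P \<Longrightarrow> (p, p) \<in> le"
  using po by (auto simp: partial_order_on_def preorder_on_def refl_on_def)

lemma le_trans: "(r, q) \<in> le \<Longrightarrow> (q, p) \<in> le \<Longrightarrow> (r, p) \<in> le"
  using po by (auto simp: partial_order_on_def preorder_on_def trans_def)

lemma le_P: "(q, p) \<in> le \<Longrightarrow> q \<in> P" "(q, p) \<in> le \<Longrightarrow> p \<in> P"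
  using po by (auto simp: partial_order_on_def preorder_on_def refl_on_def)

lemma dense_below_mono: "dense_below le p D \<Longrightarrow> (q, p) \<in> le \<Longrightarrow> dense_below le q D"
  unfolding dense_below_def using le_trans by blast

lemma dense_below_dense:
  "(\<And>q. (q, p) \<in> le \<Longrightarrow> \<exists>t. (t, q) \<in> le \<and> dense_below le t D) \<Longrightarrow> dense_below le p D"
  unfolding dense_below_def using le_trans le_P le_refl by meson

section \<open>Forced equality as an equivalence relation\<close>

lemma forces_eq_mono: "forces_eq le x y p \<Longrightarrow> (q, p) \<in> le \<Longrightarrow> forces_eq le x y q"
  unfolding forces_eq.simps[of le x y] using le_trans by blast

lemma forces_eq_left:
  "forces_eq le x y p \<Longrightarrow> (z, s) \<in> elts x \<Longrightarrow> (q, p) \<in> le \<Longrightarrow> (q, s) \<in> le \<Longrightarrow>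
     \<exists>t w u. (t, q) \<in> le \<and> (w, u) \<in> elts y \<and> (t, u) \<in> le \<and> forces_eq le z w t"
  unfolding forces_eq.simps[of le x y] dense_below_def using le_refl le_P(1) by (fastforce split: prod.splits)

lemma forces_eq_right:
  "forces_eq le x y p \<Longrightarrow> (w, u) \<in> elts y \<Longrightarrow> (q, p) \<in> le \<Longrightarrow> (q, u) \<in> le \<Longrightarrow>
     \<exists>t z s. (t, q) \<in> le \<and> (z, s) \<in> elts x \<and> (t, s) \<in> le \<and> forces_eq le z w t"
  unfolding forces_eq.simps[of le x y] dense_below_def using le_refl le_P(1) by (fastforce split: prod.splits)

text \<open>Density below q comes for free: the assumptions also apply to every q' below q, so one
  good extension per condition is enough.\<close>

lemma forces_eqI:
  assumes "\<And>z s q. (z, s) \<in> elts x \<Longrightarrow> (q, p) \<in> le \<Longrightarrow> (q, s) \<in> le \<Longrightarrow>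
      \<exists>t w u. (t, q) \<in> le \<and> (w, u) \<in> elts y \<and> (t, u) \<in> le \<and> forces_eq le z w t"
    and "\<And>w u q. (w, u) \<in> elts y \<Longrightarrow> (q, p) \<in> le \<Longrightarrow> (q, u) \<in> le \<Longrightarrow>
      \<exists>t z s. (t, q) \<in> le \<and> (z, s) \<in> elts x \<and> (t, s) \<in> le \<and> forces_eq le z w t"
  shows "forces_eq le x y p"
  unfolding forces_eq.simps[of le x y] dense_below_def
proof (intro conjI ballI allI impI; clarify)
  fix z s q q' assume "(z, s) \<in> elts x" "(q, p) \<in> le" "(q, s) \<in> le" "(q', q) \<in> le"
  then show "\<exists>t. (t, q') \<in> le \<and> (\<exists>(w, u)\<in>elts y. (t, u) \<in> le \<and> forces_eq le z w t)"
    using assms(1)[of z s q'] le_trans by fast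
next
  fix w u q q' assume "(w, u) \<in> elts y" "(q, p) \<in> le" "(q, u) \<in> le" "(q', q) \<in> le"
  then show "\<exists>t. (t, q') \<in> le \<and> (\<exists>(z, s)\<in>elts x. (t, s) \<in> le \<and> forces_eq le z w t)"
    using assms(2)[of w u q'] le_trans by fast
qed

lemma forces_eq_dense:
  assumes "\<And>q. (q, p) \<in> le \<Longrightarrow> \<exists>t. (t, q) \<in> le \<and> forces_eq le x y t"
  shows "forces_eq le x y p"
proof (rule forces_eqI)
  fix z s q assume 1: "(z, s) \<in> elts x" "(q, p) \<in> le" "(q, s) \<in> le"
  then obtain t where t: "(t, q) \<in> le" "forces_eq le x y t" using assms by blast
  with 1 show "\<exists>t w u. (t, q) \<in> le \<and> (w, u) \<in> elts y \<and> (t, u) \<in> le \<and> forces_eq le z w t"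
    using forces_eq_left[OF t(2) 1(1), of t] le_refl le_P(1) le_trans by meson
next
  fix z s q assume 1: "(z, s) \<in> elts y" "(q, p) \<in> le" "(q, s) \<in> le"
  then obtain t where t: "(t, q) \<in> le" "forces_eq le x y t" using assms by blast
  with 1 show "\<exists>t w u. (t, q) \<in> le \<and> (w, u) \<in> elts x \<and> (t, u) \<in> le \<and> forces_eq le w z t"
    using forces_eq_right[OF t(2) 1(1), of t] le_refl le_P(1) le_trans by meson
qed

lemma subname_induct [case_names subname]:
  fixes x :: "('i, 'p) name"
  assumes "\<And>x. (\<And>y s. (y, s) \<in> elts x \<Longrightarrow> Q y) \<Longrightarrow> Q x"
  shows "Q x"
  using wf_subname
proof (induction x rule: wf_induct_rule)
  case (less x)
  then show ?case by (rule assms) (auto simp: subname_def)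
qed

lemma forces_eq_refl: "forces_eq le x x p"
proof (induction x arbitrary: p rule: subname_induct)
  case (subname x)
  then show ?case
    by (intro forces_eqI) (metis le_P(1) le_refl)+
qed

lemma forces_eq_sym: "forces_eq le x y p \<Longrightarrow> forces_eq le y x p"
proof (induction x arbitrary: y p rule: subname_induct)
  case (subname x)
  show ?case
  proof (rule forces_eqI)
    fix z s q assume "(z, s) \<in> elts y" "(q, p) \<in> le" "(q, s) \<in> le"
    then show "\<exists>t w u. (t, q) \<in> le \<and> (w, u) \<in> elts x \<and> (t, u) \<in> le \<and> forces_eq le z w t"
      using forces_eq_right[OF subname.prems] subname.IH by meson
  next
    fix z s q assume "(z, s) \<in> elts x" "(q, p) \<in> le" "(q, s) \<in> le"
    then show "\<exists>t w u. (t, q) \<in> le \<and> (w, u) \<in> elts y \<and> (t, u) \<in> le \<and> forces_eq le w z t"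
      using forces_eq_left[OF subname.prems] subname.IH by meson
  qed
qed

lemma forces_eq_trans: "forces_eq le x y p \<Longrightarrow> forces_eq le y z p \<Longrightarrow> forces_eq le x z p"
proof (induction x arbitrary: y z p rule: subname_induct)
  case (subname x)
  show ?case
  proof (rule forces_eqI)
    fix a s q assume a: "(a, s) \<in> elts x" "(q, p) \<in> le" "(q, s) \<in> le"
    obtain t b u where b: "(t, q) \<in> le" "(b, u) \<in> elts y" "(t, u) \<in> le" "forces_eq le a b t"
      using forces_eq_left[OF subname.prems(1) a] by blast
    have "(t, p) \<in> le" using a b le_trans by blast
    from forces_eq_left[OF subname.prems(2) b(2) this b(3)]
    obtain t' c v where c: "(t', t) \<in> le" "(c, v) \<in> elts z" "(t', v) \<in> le" "forces_eq le b c t'"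
      by blast
    have "forces_eq le a c t'"
      using subname.IH[OF a(1) forces_eq_mono[OF b(4) c(1)] c(4)] .
    then show "\<exists>t w u. (t, q) \<in> le \<and> (w, u) \<in> elts z \<and> (t, u) \<in> le \<and> forces_eq le a w t"
      using b c le_trans by blast
  next
    fix c s q assume c: "(c, s) \<in> elts z" "(q, p) \<in> le" "(q, s) \<in> le"
    obtain t b u where b: "(t, q) \<in> le" "(b, u) \<in> elts y" "(t, u) \<in> le" "forces_eq le b c t"
      using forces_eq_right[OF subname.prems(2) c] by blast
    have "(t, p) \<in> le" using c b le_trans by blast
    from forces_eq_right[OF subname.prems(1) b(2) this b(3)]
    obtain t' a v where a: "(t', t) \<in> le" "(a, v) \<in> elts x" "(t', v) \<in> le" "forces_eq le a b t'"
      by blast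
    have "forces_eq le a c t'"
      using subname.IH[OF a(2) a(4) forces_eq_mono[OF b(4) a(1)]] .
    then show "\<exists>t z s. (t, q) \<in> le \<and> (z, s) \<in> elts x \<and> (t, s) \<in> le \<and> forces_eq le z c t"
      using a b le_trans by blast
  qed
qed

section \<open>Monotonicity, density, and the logical connectives\<close>

lemma forces_mono: "p \<tturnstile> \<phi> \<Longrightarrow> (q, p) \<in> le \<Longrightarrow> q \<tturnstile> \<phi>"
proof (induction \<phi> arbitrary: p q)
  case (Mem x y)
  then show ?case by (auto simp: forces_mem_def intro: dense_below_mono)
next
  case (Eql x y)
  then show ?case by (auto intro: forces_eq_mono)
next
  case (Neg \<phi>)
  then show ?case unfolding forces.simps using le_trans by blast
next
  case (Conj \<phi> \<psi>)
  then show ?case by auto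
next
  case (Forall \<phi>)
  then show ?case by auto
qed

text \<open>Truth values are regular open, which is the source of classical logic. Later proofs use
  this to pass to an extension that decides the parameters as elements of the ground model.\<close>

lemma forces_dense: "(\<And>q. (q, p) \<in> le \<Longrightarrow> \<exists>t. (t, q) \<in> le \<and> (t \<tturnstile> \<phi>)) \<Longrightarrow> p \<tturnstile> \<phi>"
proof (induction \<phi> arbitrary: p)
  case (Mem x y)
  then show ?case unfolding forces.simps forces_mem_def by (rule dense_below_dense)
next
  case (Eql x y)
  then show ?case unfolding forces.simps by (rule forces_eq_dense)
next
  case (Neg \<phi>)
  show ?case
  proof (simp, intro allI impI notI)
    fix q assume "(q, p) \<in> le" "q \<tturnstile> \<phi>"
    with Neg.prems[of q] obtain t where "(t, q) \<in> le" "t \<tturnstile> \<^bold>\<not> \<phi>" by blast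
    then have "t \<in> P" "t \<tturnstile> \<phi>" using forces_mono[OF \<open>q \<tturnstile> \<phi>\<close>] le_P(1) by blast+
    with \<open>t \<tturnstile> \<^bold>\<not> \<phi>\<close> le_refl show False by simp
  qed
next
  case (Conj \<phi> \<psi>)
  have "p \<tturnstile> \<phi>" by (rule Conj.IH(1)) (use Conj.prems in fastforce)
  moreover have "p \<tturnstile> \<psi>" by (rule Conj.IH(2)) (use Conj.prems in fastforce)
  ultimately show ?case by simp
next
  case (Forall \<phi>)
  have "p \<tturnstile> \<phi> x" if "x \<in> names P" for x
    by (rule Forall.IH) (use that Forall.prems in fastforce)+
  then show ?case by simp
qed

lemma forces_imp: "(p \<tturnstile> \<phi> \<^bold>\<longrightarrow> \<psi>) \<longleftrightarrow> (\<forall>q. (q, p) \<in> le \<longrightarrow> (q \<tturnstile> \<phi>) \<longrightarrow> (q \<tturnstile> \<psi>))"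
proof
  assume *: "p \<tturnstile> \<phi> \<^bold>\<longrightarrow> \<psi>"
  show "\<forall>q. (q, p) \<in> le \<longrightarrow> (q \<tturnstile> \<phi>) \<longrightarrow> (q \<tturnstile> \<psi>)"
  proof (intro allI impI)
    fix q assume q: "(q, p) \<in> le" "q \<tturnstile> \<phi>"
    show "q \<tturnstile> \<psi>"
    proof (rule forces_dense)
      fix t assume t: "(t, q) \<in> le"
      then have "(t, p) \<in> le" "t \<tturnstile> \<phi>" using q le_trans forces_mono by blast+
      with * show "\<exists>s. (s, t) \<in> le \<and> (s \<tturnstile> \<psi>)" by auto
    qed
  qed
next
  assume *: "\<forall>q. (q, p) \<in> le \<longrightarrow> (q \<tturnstile> \<phi>) \<longrightarrow> (q \<tturnstile> \<psi>)"
  show "p \<tturnstile> \<phi> \<^bold>\<longrightarrow> \<psi>"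
    unfolding forces.simps
  proof (intro allI impI notI, elim conjE)
    fix q assume "(q, p) \<in> le" "q \<tturnstile> \<phi>" "\<forall>t. (t, q) \<in> le \<longrightarrow> \<not> (t \<tturnstile> \<psi>)"
    with * show False using le_refl le_P(1) by blast
  qed
qed

lemma forces_ex:
  "(p \<tturnstile> Exists \<phi>) \<longleftrightarrow> (\<forall>q. (q, p) \<in> le \<longrightarrow> (\<exists>t. (t, q) \<in> le \<and> (\<exists>x\<in>names P. t \<tturnstile> \<phi> x)))"
proof -
  have "(p \<tturnstile> Exists \<phi>) \<longleftrightarrow>
      (\<forall>q. (q, p) \<in> le \<longrightarrow> \<not> (\<forall>x\<in>names P. \<forall>t. (t, q) \<in> le \<longrightarrow> \<not> (t \<tturnstile> \<phi> x)))"
    by simp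
  then show ?thesis by blast
qed

lemma forces_exI:
  assumes "x \<in> names P" "\<And>q. (q, p) \<in> le \<Longrightarrow> q \<tturnstile> \<phi> x"
  shows "p \<tturnstile> Exists \<phi>"
  unfolding forces_ex using assms le_refl le_P(1) by blast

lemma forces_or:
  "(p \<tturnstile> \<phi> \<^bold>\<or> \<psi>) \<longleftrightarrow> (\<forall>q. (q, p) \<in> le \<longrightarrow> (\<exists>t. (t, q) \<in> le \<and> ((t \<tturnstile> \<phi>) \<or> (t \<tturnstile> \<psi>))))"
proof -
  have "(p \<tturnstile> \<phi> \<^bold>\<or> \<psi>) \<longleftrightarrow> (\<forall>q. (q, p) \<in> le \<longrightarrow>
      \<not> ((\<forall>t. (t, q) \<in> le \<longrightarrow> \<not> (t \<tturnstile> \<phi>)) \<and> (\<forall>t. (t, q) \<in> le \<longrightarrow> \<not> (t \<tturnstile> \<psi>))))"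
    by simp
  then show ?thesis by blast
qed

lemma forces_iff:
  "(p \<tturnstile> \<phi> \<^bold>\<longleftrightarrow> \<psi>) \<longleftrightarrow> (\<forall>q. (q, p) \<in> le \<longrightarrow> (q \<tturnstile> \<phi>) = (q \<tturnstile> \<psi>))"
  unfolding forces.simps(4) forces_imp by blast

lemma forces_not: "(p \<tturnstile> \<^bold>\<not> \<phi>) \<longleftrightarrow> (\<forall>q. (q, p) \<in> le \<longrightarrow> \<not> (q \<tturnstile> \<phi>))"
  by simp

lemma forces_ball:
  "(p \<tturnstile> ball_fm A \<phi>) \<longleftrightarrow>
     (\<forall>x\<in>names P. \<forall>q. (q, p) \<in> le \<longrightarrow> (q \<tturnstile> x \<^bold>\<in> A) \<longrightarrow> (q \<tturnstile> \<phi> x))"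
  unfolding ball_fm_def forces.simps(5) forces_imp by blast

lemma forces_bex:
  "(p \<tturnstile> bex_fm A \<phi>) \<longleftrightarrow>
     (\<forall>q. (q, p) \<in> le \<longrightarrow> (\<exists>t. (t, q) \<in> le \<and> (\<exists>x\<in>names P. (t \<tturnstile> x \<^bold>\<in> A) \<and> (t \<tturnstile> \<phi> x))))"
  unfolding bex_fm_def forces_ex by simp

lemma forces_all: "(p \<tturnstile> Forall \<phi>) \<longleftrightarrow> (\<forall>x\<in>names P. p \<tturnstile> \<phi> x)"
  by simp

lemma forces_conj: "(p \<tturnstile> \<phi> \<^bold>\<and> \<psi>) \<longleftrightarrow> (p \<tturnstile> \<phi>) \<and> (p \<tturnstile> \<psi>)"
  by simp

section \<open>Substitution of equals and extensionality\<close>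

lemma eq_refl: "p \<tturnstile> x \<^bold>= x"
  by (simp add: forces_eq_refl)

lemma eq_sym: "p \<tturnstile> x \<^bold>= y \<Longrightarrow> p \<tturnstile> y \<^bold>= x"
  by (simp add: forces_eq_sym)

lemma eq_trans: "p \<tturnstile> x \<^bold>= y \<Longrightarrow> p \<tturnstile> y \<^bold>= z \<Longrightarrow> p \<tturnstile> x \<^bold>= z"
  using forces_eq_trans by auto

lemma mem_iff:
  "(p \<tturnstile> x \<^bold>\<in> y) \<longleftrightarrow>
     (\<forall>q. (q, p) \<in> le \<longrightarrow> (\<exists>t w u. (t, q) \<in> le \<and> (w, u) \<in> elts y \<and> (t, u) \<in> le \<and> (t \<tturnstile> x \<^bold>= w)))"
  unfolding forces.simps forces_mem_def dense_below_def by fast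

lemma mem_cong_left: "p \<tturnstile> x \<^bold>\<in> y \<Longrightarrow> p \<tturnstile> x \<^bold>= x' \<Longrightarrow> p \<tturnstile> x' \<^bold>\<in> y"
  unfolding mem_iff using eq_sym eq_trans forces_mono le_trans by meson

lemma elts_mem: "(w, u) \<in> elts y \<Longrightarrow> (p, u) \<in> le \<Longrightarrow> p \<tturnstile> w \<^bold>\<in> y"
  unfolding mem_iff using eq_refl le_refl le_P(1) le_trans by meson

lemma mem_cong_right:
  assumes "p \<tturnstile> x \<^bold>\<in> y" "p \<tturnstile> y \<^bold>= y'"
  shows "p \<tturnstile> x \<^bold>\<in> y'"
  unfolding mem_iff
proof (intro allI impI)
  fix q assume q: "(q, p) \<in> le"
  then obtain t w u where t: "(t, q) \<in> le" "(w, u) \<in> elts y" "(t, u) \<in> le" "t \<tturnstile> x \<^bold>= w"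
    using assms(1) unfolding mem_iff by blast
  have "(t, p) \<in> le" using t q le_trans by blast
  then obtain s w' v where "(s, t) \<in> le" "(w', v) \<in> elts y'" "(s, v) \<in> le" "s \<tturnstile> w \<^bold>= w'"
    using forces_eq_left[OF _ t(2) _ t(3)] assms(2) by force
  then show "\<exists>t w u. (t, q) \<in> le \<and> (w, u) \<in> elts y' \<and> (t, u) \<in> le \<and> (t \<tturnstile> x \<^bold>= w)"
    using t forces_mono[OF t(4)] eq_trans le_trans by meson
qed

lemma names_elts: "x \<in> names P \<Longrightarrow> (y, s) \<in> elts x \<Longrightarrow> y \<in> names P"
  "x \<in> names P \<Longrightarrow> (y, s) \<in> elts x \<Longrightarrow> s \<in> P"
  by (auto elim: names.cases)

text \<open>\<open>forces_eq\<close> inspects only the elements listed in the two names, and these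
  are again in \<open>names P\<close>; so testing membership of names suffices.\<close>

lemma extensionality:
  assumes "x \<in> names P" "y \<in> names P"
    and "\<And>z q. z \<in> names P \<Longrightarrow> (q, p) \<in> le \<Longrightarrow> (q \<tturnstile> z \<^bold>\<in> x) = (q \<tturnstile> z \<^bold>\<in> y)"
  shows "p \<tturnstile> x \<^bold>= y"
  unfolding forces.simps
proof (rule forces_eqI)
  fix z s q assume z: "(z, s) \<in> elts x" "(q, p) \<in> le" "(q, s) \<in> le"
  then have "q \<tturnstile> z \<^bold>\<in> y" using assms(3)[of z q] elts_mem names_elts[OF assms(1)] by blast
  then show "\<exists>t w u. (t, q) \<in> le \<and> (w, u) \<in> elts y \<and> (t, u) \<in> le \<and> forces_eq le z w t"
    unfolding mem_iff using le_refl z le_P(1) by force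
next
  fix z s q assume z: "(z, s) \<in> elts y" "(q, p) \<in> le" "(q, s) \<in> le"
  then have "q \<tturnstile> z \<^bold>\<in> x" using assms(3)[of z q] elts_mem names_elts[OF assms(2)] by blast
  then show "\<exists>t w u. (t, q) \<in> le \<and> (w, u) \<in> elts x \<and> (t, u) \<in> le \<and> forces_eq le w z t"
    unfolding mem_iff using le_refl z le_P(1) forces_eq_sym by force
qed

end

declare forces.simps [simp del]

section \<open>Names for pairs and ordinals\<close>

locale forcing_ordinal = forcing P le
  for P :: "'p set" and le :: "'p rel" +
  fixes \<kappa> :: "'a rel"
  assumes wo: "Well_order \<kappa>"
    and infinite_Field: "infinite (Field \<kappa>)"
begin

text \<open>One set of pairs can be presented by many indexed families, so a representative is
  chosen. It exists as soon as the set injects into the index type; this size bound has to be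
  checked for every name built below.\<close>

definition mkname :: "(('a \<times> 'p, 'p) name \<times> 'p) set \<Rightarrow> ('a \<times> 'p, 'p) name" where
  "mkname Z = (SOME x. elts x = Z)"

lemma elts_mkname:
  assumes "|Z| \<le>o |UNIV :: ('a \<times> 'p) set|"
  shows "elts (mkname Z) = Z"
proof -
  obtain h :: "_ \<Rightarrow> 'a \<times> 'p" where h: "inj_on h Z"
    using assms card_of_ordLeq[of Z "UNIV :: ('a \<times> 'p) set"] by auto
  have "elts (Name (\<lambda>i. if i \<in> h ` Z then Some (inv_into Z h i) else None)) = Z" (is "elts (Name ?f) = Z")
  proof -
    have "z \<in> ran ?f" if "z \<in> Z" for z
      using that h by (intro ranI[of _ "h z"]) simp
    moreover have "z \<in> Z" if z: "z \<in> ran ?f" for z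
    proof -
      from z obtain i where "i \<in> h ` Z" "z = inv_into Z h i"
        unfolding ran_def by (auto split: if_splits)
      then show ?thesis by (simp only: inv_into_into)
    qed
    ultimately show ?thesis unfolding elts.simps by blast
  qed
  then show ?thesis unfolding mkname_def by (rule someI)
qed

lemma mkname_names:
  assumes "|Z| \<le>o |UNIV :: ('a \<times> 'p) set|"
    and "\<And>y s. (y, s) \<in> Z \<Longrightarrow> y \<in> names P \<and> s \<in> P"
  shows "mkname Z \<in> names P"
  using assms by (intro names.intros) (auto simp: elts_mkname)

text \<open>The unordered pair. All of \<open>P\<close> is attached because no greatest condition is
  assumed.\<close>

definition up :: "('a \<times> 'p, 'p) name \<Rightarrow> ('a \<times> 'p, 'p) name \<Rightarrow> ('a \<times> 'p, 'p) name" where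
  "up x y = mkname ({x, y} \<times> P)"

definition op :: "('a \<times> 'p, 'p) name \<Rightarrow> ('a \<times> 'p, 'p) name \<Rightarrow> ('a \<times> 'p, 'p) name" where
  "op x y = up (up x x) (up x y)"

text \<open>Two distinct elements of the infinite type 'a tag the two components, and the condition
  serves as its own second index.\<close>

lemma card_up: "|{x, y} \<times> P| \<le>o |UNIV :: ('a \<times> 'p) set|" for x y :: "('a \<times> 'p, 'p) name"
proof -
  have "infinite (UNIV :: 'a set)"
    using infinite_super[OF subset_UNIV infinite_Field] .
  then obtain a b :: 'a where "a \<noteq> b"
    using ex_new_if_finite[of "{undefined :: 'a}"] by auto
  then have "inj_on (map_prod (\<lambda>z. if z = x then a else b) id) ({x, y} \<times> P)"
    by (intro map_prod_inj_on) (auto simp: inj_on_def)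
  then show ?thesis
    by (rule card_of_ordLeqI) simp
qed

lemma elts_up: "elts (up x y) = {x, y} \<times> P"
  unfolding up_def by (rule elts_mkname[OF card_up])

lemma up_names [simp, intro]: "x \<in> names P \<Longrightarrow> y \<in> names P \<Longrightarrow> up x y \<in> names P"
  unfolding up_def by (intro mkname_names card_up) auto

lemma op_names [simp, intro]: "x \<in> names P \<Longrightarrow> y \<in> names P \<Longrightarrow> op x y \<in> names P"
  by (simp add: op_def)

lemma mem_up: "(p \<tturnstile> z \<^bold>\<in> up x y) \<longleftrightarrow> (p \<tturnstile> z \<^bold>= x \<^bold>\<or> z \<^bold>= y)"
proof -
  have "(\<exists>w u. (w, u) \<in> elts (up x y) \<and> (t, u) \<in> le \<and> (t \<tturnstile> z \<^bold>= w)) \<longleftrightarrow>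
      (t \<tturnstile> z \<^bold>= x) \<or> (t \<tturnstile> z \<^bold>= y)" if "t \<in> P" for t
    using le_refl[OF that] that unfolding elts_up by auto
  then show ?thesis
    unfolding mem_iff forces_or using le_P(1) by metis
qed

lemma mem_upD:
  "p \<tturnstile> z \<^bold>\<in> up x y \<Longrightarrow> p \<in> P \<Longrightarrow> \<exists>t. (t, p) \<in> le \<and> ((t \<tturnstile> z \<^bold>= x) \<or> (t \<tturnstile> z \<^bold>= y))"
  unfolding mem_up forces_or using le_refl by blast

lemma mem_up1: "p \<in> P \<Longrightarrow> p \<tturnstile> x \<^bold>\<in> up x y" and mem_up2: "p \<in> P \<Longrightarrow> p \<tturnstile> y \<^bold>\<in> up x y"
  by (rule elts_mem[of _ p]; simp add: elts_up le_refl)+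

lemma up_cong:
  assumes "p \<tturnstile> x \<^bold>= x'" "p \<tturnstile> y \<^bold>= y'" "x \<in> names P" "y \<in> names P" "x' \<in> names P" "y' \<in> names P"
  shows "p \<tturnstile> up x y \<^bold>= up x' y'"
proof (rule extensionality)
  fix z q assume q: "(q, p) \<in> le"
  have "(t \<tturnstile> z \<^bold>= x) = (t \<tturnstile> z \<^bold>= x')" "(t \<tturnstile> z \<^bold>= y) = (t \<tturnstile> z \<^bold>= y')" if "(t, q) \<in> le" for t
    using assms forces_mono that q eq_sym eq_trans by meson+
  then show "(q \<tturnstile> z \<^bold>\<in> up x y) = (q \<tturnstile> z \<^bold>\<in> up x' y')"
    unfolding mem_up forces_or using le_trans by meson
qed (use assms in auto)

lemma op_cong:
  assumes "p \<tturnstile> x \<^bold>= x'" "p \<tturnstile> y \<^bold>= y'" "x \<in> names P" "y \<in> names P" "x' \<in> names P" "y' \<in> names P"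
  shows "p \<tturnstile> op x y \<^bold>= op x' y'"
  unfolding op_def using assms by (intro up_cong) auto

text \<open>A membership in a pair decides an equation only after strengthening. The conditions
  \<open>t1\<close> to \<open>t4\<close> settle the four memberships in turn, and which alternative
  results may depend on the choices made on the way.\<close>

lemma up_inject:
  assumes eq: "p \<tturnstile> up x y \<^bold>= up x' y'" and "p \<in> P"
  shows "\<exists>t. (t, p) \<in> le \<and>
    ((t \<tturnstile> x \<^bold>= x') \<and> (t \<tturnstile> y \<^bold>= y') \<or> (t \<tturnstile> x \<^bold>= y') \<and> (t \<tturnstile> y \<^bold>= x'))"
proof -
  have m: "q \<tturnstile> x \<^bold>\<in> up x' y'" "q \<tturnstile> y \<^bold>\<in> up x' y'" "q \<tturnstile> x' \<^bold>\<in> up x y" "q \<tturnstile> y' \<^bold>\<in> up x y"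
    if "(q, p) \<in> le" for q
    using mem_cong_right[OF mem_up1 eq] mem_cong_right[OF mem_up2 eq]
      mem_cong_right[OF mem_up1 eq_sym[OF eq]] mem_cong_right[OF mem_up2 eq_sym[OF eq]] that
      forces_mono \<open>p \<in> P\<close> by blast+
  have ex: "\<exists>t. (t, p) \<in> le \<and> (t, q) \<in> le \<and> ((t \<tturnstile> a \<^bold>= b) \<or> (t \<tturnstile> a \<^bold>= c))"
    if "(q, p) \<in> le" "q \<tturnstile> a \<^bold>\<in> up b c" for q a b c
    using mem_upD[OF that(2)] that(1) le_P le_trans by meson
  obtain t1 where t1: "(t1, p) \<in> le" "(t1 \<tturnstile> x \<^bold>= x') \<or> (t1 \<tturnstile> x \<^bold>= y')"
    using ex m(1) le_refl[OF \<open>p \<in> P\<close>] by blast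
  obtain t2 where t2: "(t2, p) \<in> le" "(t2, t1) \<in> le" "(t2 \<tturnstile> y \<^bold>= x') \<or> (t2 \<tturnstile> y \<^bold>= y')"
    using ex m(2) t1 by blast
  obtain t3 where t3: "(t3, p) \<in> le" "(t3, t2) \<in> le" "(t3 \<tturnstile> x' \<^bold>= x) \<or> (t3 \<tturnstile> x' \<^bold>= y)"
    using ex m(3) t2 by blast
  obtain t4 where t4: "(t4, p) \<in> le" "(t4, t3) \<in> le" "(t4 \<tturnstile> y' \<^bold>= x) \<or> (t4 \<tturnstile> y' \<^bold>= y)"
    using ex m(4) t3 by blast
  have "(t4, t2) \<in> le" "(t4, t1) \<in> le" using t2 t3 t4 le_trans by blast+
  then have "(t4 \<tturnstile> x \<^bold>= x') \<or> (t4 \<tturnstile> x \<^bold>= y')" "(t4 \<tturnstile> y \<^bold>= x') \<or> (t4 \<tturnstile> y \<^bold>= y')"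
      "(t4 \<tturnstile> x' \<^bold>= x) \<or> (t4 \<tturnstile> x' \<^bold>= y)"
    using t1 t2 t3 t4 forces_mono by blast+
  then have "(t4 \<tturnstile> x \<^bold>= x') \<and> (t4 \<tturnstile> y \<^bold>= y') \<or> (t4 \<tturnstile> x \<^bold>= y') \<and> (t4 \<tturnstile> y \<^bold>= x')"
    using t4(3) eq_sym eq_trans by meson
  then show ?thesis using t4 by blast
qed

text \<open>For a singleton both alternatives of \<open>up_inject\<close> give the same two
  equations, so these hold densely and are therefore forced by p itself.\<close>

lemma up_inject_same:
  assumes "p \<tturnstile> up x x \<^bold>= up y z"
  shows "p \<tturnstile> x \<^bold>= y" "p \<tturnstile> x \<^bold>= z"
proof -
  have "\<exists>t. (t, q) \<in> le \<and> (t \<tturnstile> x \<^bold>= y) \<and> (t \<tturnstile> x \<^bold>= z)" if "(q, p) \<in> le" for q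
    using up_inject[of q x x y z] forces_mono[OF assms that] le_P[OF that] by blast
  then show "p \<tturnstile> x \<^bold>= y" "p \<tturnstile> x \<^bold>= z"
    using forces_dense by blast+
qed

text \<open>Besides the regular case there is the degenerate one of Kuratowski pairs, where a
  singleton is matched with a two-element set; there all four components coincide.\<close>

lemma op_inject:
  assumes "p \<tturnstile> op x y \<^bold>= op x' y'"
  shows "p \<tturnstile> x \<^bold>= x'" "p \<tturnstile> y \<^bold>= y'"
proof -
  have "\<exists>t. (t, q) \<in> le \<and> (t \<tturnstile> x \<^bold>= x') \<and> (t \<tturnstile> y \<^bold>= y')" if "(q, p) \<in> le" for q
  proof -
    have "q \<in> P" "q \<tturnstile> op x y \<^bold>= op x' y'" using that le_P assms forces_mono by blast+
    from up_inject[OF this(2)[unfolded op_def] this(1)] obtain t where t: "(t, q) \<in> le"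
      and c: "(t \<tturnstile> up x x \<^bold>= up x' x') \<and> (t \<tturnstile> up x y \<^bold>= up x' y') \<or>
          (t \<tturnstile> up x x \<^bold>= up x' y') \<and> (t \<tturnstile> up x y \<^bold>= up x' x')" by blast
    from c show ?thesis
    proof (elim disjE conjE)
      assume 1: "t \<tturnstile> up x x \<^bold>= up x' x'" and 2: "t \<tturnstile> up x y \<^bold>= up x' y'"
      have x: "t \<tturnstile> x \<^bold>= x'" using up_inject_same[OF 1] by blast
      obtain s where s: "(s, t) \<in> le" "(s \<tturnstile> x \<^bold>= x') \<and> (s \<tturnstile> y \<^bold>= y') \<or> (s \<tturnstile> x \<^bold>= y') \<and> (s \<tturnstile> y \<^bold>= x')"
        using up_inject[OF 2 le_P(1)[OF t]] by blast
      moreover have "s \<tturnstile> x \<^bold>= x'" using x s forces_mono by blast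
      ultimately have "(s \<tturnstile> x \<^bold>= x') \<and> (s \<tturnstile> y \<^bold>= y')"
        using eq_sym eq_trans by meson
      then show ?thesis using s t le_trans by blast
    next
      assume 1: "t \<tturnstile> up x x \<^bold>= up x' y'" and 2: "t \<tturnstile> up x y \<^bold>= up x' x'"
      have "(t \<tturnstile> x \<^bold>= x') \<and> (t \<tturnstile> y \<^bold>= y')"
        using up_inject_same[OF 1] up_inject_same[OF eq_sym[OF 2]] eq_sym eq_trans by meson
      then show ?thesis using t by blast
    qed
  qed
  then show "p \<tturnstile> x \<^bold>= x'" "p \<tturnstile> y \<^bold>= y'"
    using forces_dense by blast+
qed

text \<open>Together with \<open>forces_opair\<close> and \<open>forces_app\<close> this replaces
  the pairing formulas by equations and memberships of explicit names, the form in which later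
  arguments handle them.\<close>

lemma forces_upair:
  assumes "e \<in> names P" "x \<in> names P" "y \<in> names P"
  shows "(p \<tturnstile> upair_fm e x y) \<longleftrightarrow> (p \<tturnstile> e \<^bold>= up x y)"
proof
  assume *: "p \<tturnstile> upair_fm e x y"
  show "p \<tturnstile> e \<^bold>= up x y"
    using assms * unfolding upair_fm_def forces_all forces_iff
    by (intro extensionality) (auto simp: mem_up)
next
  assume "p \<tturnstile> e \<^bold>= up x y"
  then have "(q \<tturnstile> z \<^bold>\<in> e) = (q \<tturnstile> z \<^bold>\<in> up x y)" if "(q, p) \<in> le" for q z
    using that forces_mono mem_cong_right eq_sym by meson
  then show "p \<tturnstile> upair_fm e x y"
    unfolding upair_fm_def forces_all forces_iff by (simp add: mem_up)
qed

lemma forces_opair: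
  assumes "e \<in> names P" "x \<in> names P" "y \<in> names P"
  shows "(p \<tturnstile> opair_fm e x y) \<longleftrightarrow> (p \<tturnstile> e \<^bold>= op x y)"
proof
  assume *: "p \<tturnstile> opair_fm e x y"
  show "p \<tturnstile> e \<^bold>= op x y"
  proof (rule forces_dense)
    fix q assume "(q, p) \<in> le"
    then obtain t a where t: "(t, q) \<in> le" and a: "a \<in> names P"
      and "t \<tturnstile> \<^bold>\<exists>b. upair_fm a x x \<^bold>\<and> upair_fm b x y \<^bold>\<and> upair_fm e a b"
      using * unfolding opair_fm_def forces_ex[of _ "\<lambda>a. \<^bold>\<exists>b. _ a b"] by blast
    then obtain s b where s: "(s, t) \<in> le" and b: "b \<in> names P"
      and "s \<tturnstile> upair_fm a x x \<^bold>\<and> upair_fm b x y \<^bold>\<and> upair_fm e a b"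
      unfolding forces_ex using le_refl le_P by meson
    then have "s \<tturnstile> a \<^bold>= up x x" "s \<tturnstile> b \<^bold>= up x y" "s \<tturnstile> e \<^bold>= up a b"
      using assms a b forces_upair unfolding forces_conj by blast+
    then have "s \<tturnstile> e \<^bold>= op x y"
      unfolding op_def using up_cong assms a b eq_trans by (meson up_names)
    then show "\<exists>t. (t, q) \<in> le \<and> (t \<tturnstile> e \<^bold>= op x y)" using s t le_trans by blast
  qed
next
  assume *: "p \<tturnstile> e \<^bold>= op x y"
  have body: "q \<tturnstile> upair_fm (up x x) x x \<^bold>\<and> upair_fm (up x y) x y \<^bold>\<and> upair_fm e (up x x) (up x y)"
    if "(q, p) \<in> le" for q
    using assms forces_mono[OF * that] forces_upair eq_refl
    unfolding forces_conj op_def[symmetric] by (metis op_def up_names)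
  show "p \<tturnstile> opair_fm e x y"
    unfolding opair_fm_def
  proof (rule forces_exI[OF up_names[OF assms(2,2)]], rule forces_exI[OF up_names[OF assms(2,3)]])
    fix q r assume "(q, p) \<in> le" "(r, q) \<in> le"
    then show "r \<tturnstile> upair_fm (up x x) x x \<^bold>\<and> upair_fm (up x y) x y \<^bold>\<and> upair_fm e (up x x) (up x y)"
      using body[OF le_trans] by blast
  qed
qed

lemma forces_app:
  assumes "f \<in> names P" "x \<in> names P" "y \<in> names P"
  shows "(p \<tturnstile> app_fm f x y) \<longleftrightarrow> (p \<tturnstile> op x y \<^bold>\<in> f)"
proof
  assume *: "p \<tturnstile> app_fm f x y"
  show "p \<tturnstile> op x y \<^bold>\<in> f"
  proof (rule forces_dense)
    fix q assume "(q, p) \<in> le"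
    then obtain t e where "(t, q) \<in> le" "e \<in> names P" "t \<tturnstile> e \<^bold>\<in> f" "t \<tturnstile> opair_fm e x y"
      using * unfolding app_fm_def forces_bex by blast
    moreover from this have "t \<tturnstile> e \<^bold>= op x y"
      using forces_opair assms by simp
    ultimately show "\<exists>t. (t, q) \<in> le \<and> (t \<tturnstile> op x y \<^bold>\<in> f)"
      using mem_cong_left[of t e f "op x y"] by blast
  qed
next
  assume *: "p \<tturnstile> op x y \<^bold>\<in> f"
  then show "p \<tturnstile> app_fm f x y"
    unfolding app_fm_def forces_bex
    using forces_mono[OF *] forces_opair[OF op_names[OF assms(2,3)] assms(2,3)] eq_refl
      op_names[OF assms(2,3)] le_refl le_P by blast
qed

section \<open>Canonical names for sets of ground-model ordinals\<close>

abbreviation chk :: "'a \<Rightarrow> ('a \<times> 'p, 'p) name" where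
  "chk \<equiv> check_elem P \<kappa>"

text \<open>The canonical name of a ground-model set of ordinals. Each \<open>chk x\<close>, the
  ordinal \<kappa> itself, and the names for \<omega>, \<omega>1 and \<omega>2 are all instances, so
  they share one set of membership rules.\<close>

definition ON :: "'a set \<Rightarrow> ('a \<times> 'p, 'p) name" where
  "ON W = Name (\<lambda>(x, p). if x \<in> W \<and> p \<in> P then Some (chk x, p) else None)"

lemma elts_ON: "elts (ON W) = chk ` W \<times> P"
  by (auto simp: ON_def ran_def split: if_splits)

lemma chk_ON: "chk x = ON (underS \<kappa> x)"
  by (subst check_elem_unfold[OF wo]) (auto simp: ON_def underS_def intro!: arg_cong[of _ _ Name])

lemma check_ordinal_ON: "check_ordinal P \<kappa> = ON (Field \<kappa>)"
  by (simp add: check_ordinal_def ON_def)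

lemma wf_less: "wf (\<kappa> - Id)"
  using wo by (simp add: well_order_on_def)

lemma underS_induct: "(\<And>x. (\<And>y. y \<in> underS \<kappa> x \<Longrightarrow> Q y) \<Longrightarrow> Q x) \<Longrightarrow> Q x"
  using wf_induct_rule[OF wf_less, of Q x] by (auto simp: underS_def)

lemma underS_cases: "x \<in> Field \<kappa> \<Longrightarrow> y \<in> Field \<kappa> \<Longrightarrow> x \<in> underS \<kappa> y \<or> x = y \<or> y \<in> underS \<kappa> x"
  using wo by (auto simp: well_order_on_def linear_order_on_def total_on_def underS_def)

lemma underS_trans: "x \<in> underS \<kappa> y \<Longrightarrow> y \<in> underS \<kappa> z \<Longrightarrow> x \<in> underS \<kappa> z"
  using wo by (auto simp: underS_def well_order_on_def linear_order_on_def partial_order_on_def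
      preorder_on_def trans_def antisym_def)

lemma underS_sub: "underS \<kappa> x \<subseteq> Field \<kappa>"
  by (auto simp: underS_def Field_def)

lemma chk_names [simp, intro]: "chk x \<in> names P"
proof (induction x rule: underS_induct)
  case (1 x)
  then show ?case by (intro names.intros) (auto simp: chk_ON[of x] elts_ON)
qed

lemma ON_names [simp, intro]: "ON W \<in> names P"
  by (intro names.intros) (auto simp: elts_ON)

lemma mem_ON:
  "(p \<tturnstile> z \<^bold>\<in> ON W) \<longleftrightarrow> (\<forall>q. (q, p) \<in> le \<longrightarrow> (\<exists>t. (t, q) \<in> le \<and> (\<exists>x\<in>W. t \<tturnstile> z \<^bold>= chk x)))"
proof -
  have "(\<exists>w u. (w, u) \<in> elts (ON W) \<and> (t, u) \<in> le \<and> (t \<tturnstile> z \<^bold>= w)) \<longleftrightarrow>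
      (\<exists>x\<in>W. t \<tturnstile> z \<^bold>= chk x)" if "t \<in> P" for t
    using le_refl[OF that] that unfolding elts_ON by auto
  then show ?thesis
    unfolding mem_iff using le_P(1) by metis
qed

lemma mem_ON_D:
  "p \<tturnstile> z \<^bold>\<in> ON W \<Longrightarrow> p \<in> P \<Longrightarrow> \<exists>t. (t, p) \<in> le \<and> (\<exists>x\<in>W. t \<tturnstile> z \<^bold>= chk x)"
  unfolding mem_ON using le_refl by blast

lemma mem_ON_I: "x \<in> W \<Longrightarrow> p \<tturnstile> z \<^bold>= chk x \<Longrightarrow> p \<tturnstile> z \<^bold>\<in> ON W"
  unfolding mem_ON using le_refl le_P(1) forces_mono by blast

lemma mem_chk_I: "x \<in> W \<Longrightarrow> p \<tturnstile> chk x \<^bold>\<in> ON W"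
  by (rule mem_ON_I[OF _ eq_refl])

text \<open>Equality would make x a member of itself, hence below some extension equal to a smaller
  w, contrary to the induction hypothesis for w.\<close>

lemma chk_neq: "x \<in> underS \<kappa> y \<Longrightarrow> p \<in> P \<Longrightarrow> \<not> (p \<tturnstile> chk x \<^bold>= chk y)"
proof (induction x arbitrary: y p rule: underS_induct)
  case (1 x)
  show ?case
  proof
    assume eq: "p \<tturnstile> chk x \<^bold>= chk y"
    have "p \<tturnstile> chk x \<^bold>\<in> chk y"
      unfolding chk_ON[of y] by (rule mem_chk_I) fact
    with eq have "p \<tturnstile> chk x \<^bold>\<in> ON (underS \<kappa> x)"
      unfolding chk_ON[of x, symmetric] using mem_cong_right eq_sym by blast
    from mem_ON_D[OF this \<open>p \<in> P\<close>] obtain t w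
      where "(t, p) \<in> le" "w \<in> underS \<kappa> x" "t \<tturnstile> chk x \<^bold>= chk w" by blast
    then show False using 1(1)[of w x t] eq_sym le_P by blast
  qed
qed

lemma chk_eqD: "p \<tturnstile> chk x \<^bold>= chk y \<Longrightarrow> p \<in> P \<Longrightarrow> x \<in> Field \<kappa> \<Longrightarrow> y \<in> Field \<kappa> \<Longrightarrow> x = y"
  using underS_cases[of x y] chk_neq eq_sym by blast

lemma chk_memD: "p \<tturnstile> chk x \<^bold>\<in> ON W \<Longrightarrow> p \<in> P \<Longrightarrow> x \<in> Field \<kappa> \<Longrightarrow> W \<subseteq> Field \<kappa> \<Longrightarrow> x \<in> W"
  using mem_ON_D[of p "chk x" W] chk_eqD le_P by blast

lemma up_chk_inject:
  assumes "p \<tturnstile> up (chk a) (chk b) \<^bold>= up (chk c) (chk d)" "p \<in> P"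
    and "a \<in> Field \<kappa>" "b \<in> Field \<kappa>" "c \<in> Field \<kappa>" "d \<in> Field \<kappa>"
  shows "a = c \<and> b = d \<or> a = d \<and> b = c"
  using up_inject[OF assms(1,2)] chk_eqD assms le_P by meson

definition initial :: "'a set \<Rightarrow> bool" where
  "initial W \<longleftrightarrow> W \<subseteq> Field \<kappa> \<and> (\<forall>x\<in>W. underS \<kappa> x \<subseteq> W)"

lemma initial_underS: "initial (underS \<kappa> x)"
  unfolding initial_def using underS_sub underS_trans by blast

lemma mem_mem_ON:
  assumes "initial W" "p \<tturnstile> y \<^bold>\<in> ON W" "p \<tturnstile> z \<^bold>\<in> y"
  shows "p \<tturnstile> z \<^bold>\<in> ON W"
proof (rule forces_dense)
  fix q assume q: "(q, p) \<in> le"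
  then obtain t x where t: "(t, q) \<in> le" "x \<in> W" "t \<tturnstile> y \<^bold>= chk x"
    using assms unfolding mem_ON by blast
  then have "t \<tturnstile> z \<^bold>\<in> y" using assms q le_trans forces_mono by blast
  then have "t \<tturnstile> z \<^bold>\<in> ON (underS \<kappa> x)"
    using t mem_cong_right chk_ON by metis
  then have "t \<tturnstile> z \<^bold>\<in> ON W"
    unfolding mem_ON using assms(1) t(2) unfolding initial_def by blast
  then show "\<exists>t. (t, q) \<in> le \<and> (t \<tturnstile> z \<^bold>\<in> ON W)" using t by blast
qed

lemma ordinal_ON: "initial W \<Longrightarrow> p \<tturnstile> ordinal_fm (ON W)"
  unfolding ordinal_fm_def transitive_fm_def subset_fm_def forces_conj forces_ball
proof (intro conjI ballI allI impI)
  fix y q z r assume "initial W" "(q, p) \<in> le" "q \<tturnstile> y \<^bold>\<in> ON W" "(r, q) \<in> le" "r \<tturnstile> z \<^bold>\<in> y"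
  then show "r \<tturnstile> z \<^bold>\<in> ON W" using mem_mem_ON forces_mono by blast
next
  fix y q z r u s
  assume W: "initial W" and q: "(q, p) \<in> le" "q \<tturnstile> y \<^bold>\<in> ON W" and r: "(r, q) \<in> le" "r \<tturnstile> z \<^bold>\<in> y"
    and s: "(s, r) \<in> le" "s \<tturnstile> u \<^bold>\<in> z"
  show "s \<tturnstile> u \<^bold>\<in> y"
  proof (rule forces_dense)
    fix t assume t: "(t, s) \<in> le"
    then have "(t, q) \<in> le" "(t, r) \<in> le" using r s le_trans by blast+
    then obtain v x where v: "(v, t) \<in> le" "x \<in> W" "v \<tturnstile> y \<^bold>= chk x"
      using q forces_mono unfolding mem_ON by blast
    have "v \<tturnstile> z \<^bold>\<in> y" "v \<tturnstile> u \<^bold>\<in> z" using r s \<open>(t, r) \<in> le\<close> t v(1) forces_mono by blast+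
    then have "v \<tturnstile> u \<^bold>\<in> ON (underS \<kappa> x)"
      using mem_mem_ON[OF initial_underS] mem_cong_right v(3) chk_ON by metis
    then have "v \<tturnstile> u \<^bold>\<in> y" using mem_cong_right v(3) chk_ON eq_sym by metis
    then show "\<exists>v. (v, t) \<in> le \<and> (v \<tturnstile> u \<^bold>\<in> y)" using v by blast
  qed
qed

end

context forcing begin

lemma forces_bexI: "x \<in> names P \<Longrightarrow> p \<tturnstile> x \<^bold>\<in> A \<Longrightarrow> p \<tturnstile> \<phi> x \<Longrightarrow> p \<tturnstile> bex_fm A \<phi>"
  unfolding bex_fm_def by (rule forces_exI[of x]) (auto simp: forces_conj intro: forces_mono)

end

context forcing_ordinal begin

section \<open>Functions in the extension and injections from the ground model\<close>

lemma function_total: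
  assumes "p \<tturnstile> function_fm f A B" "p \<tturnstile> x \<^bold>\<in> A" "p \<in> P"
    and "f \<in> names P" "x \<in> names P"
  shows "\<exists>t y. (t, p) \<in> le \<and> y \<in> names P \<and> (t \<tturnstile> op x y \<^bold>\<in> f)"
proof -
  have "p \<tturnstile> \<^bold>\<exists>y. app_fm f x y \<^bold>\<and> (\<^bold>\<forall>y'. app_fm f x y' \<^bold>\<longrightarrow> y' \<^bold>= y)"
    using assms le_refl unfolding function_fm_def forces_conj forces_ball by blast
  then obtain t y where "(t, p) \<in> le" "y \<in> names P" "t \<tturnstile> app_fm f x y"
    unfolding forces_ex forces_conj using le_refl[OF \<open>p \<in> P\<close>] by blast
  then show ?thesis using assms(4,5) by (auto simp: forces_app)
qed

lemma function_range:
  assumes "p \<tturnstile> function_fm f A B" "p \<tturnstile> op x y \<^bold>\<in> f"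
    and "f \<in> names P" "x \<in> names P" "y \<in> names P"
  shows "p \<tturnstile> x \<^bold>\<in> A" "p \<tturnstile> y \<^bold>\<in> B"
proof -
  have "\<exists>t. (t, q) \<in> le \<and> (t \<tturnstile> x \<^bold>\<in> A) \<and> (t \<tturnstile> y \<^bold>\<in> B)" if q: "(q, p) \<in> le" for q
  proof -
    have "q \<tturnstile> \<^bold>\<exists>x'\<^bold>\<in>A. \<^bold>\<exists>y'\<^bold>\<in>B. opair_fm (op x y) x' y'"
      using assms q forces_mono unfolding function_fm_def forces_conj forces_ball by (meson op_names)
    then obtain t x' where t: "(t, q) \<in> le" and x': "x' \<in> names P" "t \<tturnstile> x' \<^bold>\<in> A"
      and "t \<tturnstile> \<^bold>\<exists>y'\<^bold>\<in>B. opair_fm (op x y) x' y'"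
      unfolding forces_bex[of _ A] using le_refl[OF le_P(1)[OF q]] by blast
    then obtain s y' where s: "(s, t) \<in> le" and y': "y' \<in> names P" "s \<tturnstile> y' \<^bold>\<in> B"
      and "s \<tturnstile> opair_fm (op x y) x' y'"
      unfolding forces_bex using le_refl[OF le_P(1)[OF t]] by blast
    then have "s \<tturnstile> op x y \<^bold>= op x' y'" using x' y' assms by (simp add: forces_opair)
    from op_inject[OF this] have "s \<tturnstile> x \<^bold>\<in> A" "s \<tturnstile> y \<^bold>\<in> B"
      using x'(2) y'(2) s forces_mono mem_cong_left eq_sym by blast+
    then show ?thesis using s t le_trans by blast
  qed
  then show "p \<tturnstile> x \<^bold>\<in> A" "p \<tturnstile> y \<^bold>\<in> B" using forces_dense by blast+
qed

lemma function_unique: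
  assumes "p \<tturnstile> function_fm f A B" "p \<tturnstile> op x y \<^bold>\<in> f" "p \<tturnstile> op x y' \<^bold>\<in> f"
    and n: "f \<in> names P" "x \<in> names P" "y \<in> names P" "y' \<in> names P"
  shows "p \<tturnstile> y \<^bold>= y'"
proof (rule forces_dense)
  fix q assume q: "(q, p) \<in> le"
  have "q \<tturnstile> \<^bold>\<exists>y. app_fm f x y \<^bold>\<and> (\<^bold>\<forall>y'. app_fm f x y' \<^bold>\<longrightarrow> y' \<^bold>= y)"
    using assms(1) function_range(1)[OF assms(1,2) n(1,2,3)] n(2) q forces_mono
    unfolding function_fm_def forces_conj forces_ball by blast
  then obtain t z where t: "(t, q) \<in> le" and z: "z \<in> names P"
    and "t \<tturnstile> \<^bold>\<forall>y'. app_fm f x y' \<^bold>\<longrightarrow> y' \<^bold>= z"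
    unfolding forces_ex[of q] forces_conj using le_refl[OF le_P(1)[OF q]] by blast
  then have *: "t \<tturnstile> y' \<^bold>= z" if "y' \<in> names P" "t \<tturnstile> op x y' \<^bold>\<in> f" for y'
    using that n le_refl[OF le_P(1)[OF t]] unfolding forces_all forces_imp by (simp add: forces_app)
  have "(t, p) \<in> le" using t q le_trans by blast
  then have "t \<tturnstile> y \<^bold>= z" "t \<tturnstile> y' \<^bold>= z"
    using * n forces_mono assms(2,3) by blast+
  then show "\<exists>t. (t, q) \<in> le \<and> (t \<tturnstile> y \<^bold>= y')" using t eq_sym eq_trans by blast
qed

lemma injection_inject:
  assumes "p \<tturnstile> injection_fm f A B" "p \<tturnstile> op x y \<^bold>\<in> f" "p \<tturnstile> op x' y \<^bold>\<in> f"
    and "f \<in> names P" "x \<in> names P" "x' \<in> names P" "y \<in> names P" "p \<in> P"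
  shows "p \<tturnstile> x \<^bold>= x'"
  using assms le_refl[OF \<open>p \<in> P\<close>] unfolding injection_fm_def forces_conj forces_all forces_imp
  by (auto simp: forces_app)

lemma bijection_onto:
  assumes "p \<tturnstile> bijection_fm f A B" "p \<tturnstile> y \<^bold>\<in> B" "p \<in> P"
    and "f \<in> names P" "y \<in> names P"
  shows "\<exists>t x. (t, p) \<in> le \<and> x \<in> names P \<and> (t \<tturnstile> x \<^bold>\<in> A) \<and> (t \<tturnstile> op x y \<^bold>\<in> f)"
proof -
  have "p \<tturnstile> \<^bold>\<exists>x\<^bold>\<in>A. app_fm f x y"
    using assms le_refl unfolding bijection_fm_def forces_conj forces_ball by blast
  then obtain t x where "(t, p) \<in> le" "x \<in> names P" "t \<tturnstile> x \<^bold>\<in> A" "t \<tturnstile> app_fm f x y"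
    unfolding forces_bex using le_refl[OF \<open>p \<in> P\<close>] by blast
  then show ?thesis using assms(4,5) by (auto simp: forces_app)
qed

text \<open>The names \<open>F\<close> in \<open>card_le_ON\<close>, \<open>generic\<close> and
  \<open>pairs\<close> all have this shape: values \<open>G i\<close> attached to conditions
  according to a set of indices.\<close>

lemma mem_range_name:
  assumes "elts F = (\<lambda>(i, r). (G i, r)) ` Z"
  shows "(p \<tturnstile> e \<^bold>\<in> F) \<longleftrightarrow> (\<forall>q. (q, p) \<in> le \<longrightarrow> (\<exists>t i r. (t, q) \<in> le \<and> (i, r) \<in> Z \<and> (t, r) \<in> le \<and> (t \<tturnstile> e \<^bold>= G i)))"
  unfolding mem_iff assms by (simp add: image_iff Bex_def) metis

text \<open>An injection \<iota> of the ground model persists in the extension. The name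
  \<open>A\<close> need not be canonical; it is enough that its elements are densely decided to lie
  in a. This serves both to bound ordinals below a cardinal and to show that a set caught inside a
  countable ground-model set is countable.\<close>

lemma card_le_ON:
  assumes A: "A \<in> names P" and a: "a \<subseteq> Field \<kappa>" and W: "W \<subseteq> Field \<kappa>"
    and \<iota>: "inj_on \<iota> a" "\<iota> ` a \<subseteq> W"
    and cover: "\<And>r x. (r, p) \<in> le \<Longrightarrow> x \<in> names P \<Longrightarrow> r \<tturnstile> x \<^bold>\<in> A \<Longrightarrow>
        \<exists>t. (t, r) \<in> le \<and> (\<exists>b\<in>a. t \<tturnstile> x \<^bold>= chk b)"
  shows "p \<tturnstile> card_le_fm A (ON W)"
proof -
  define G where "G b = op (chk b) (chk (\<iota> b))" for b
  \<comment> \<open>Attaching the pair for b only to conditions that force \<open>chk b\<close> into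
    \<open>A\<close> cuts the graph of \<iota> down to \<open>A\<close>, so that the domain of
    \<open>F\<close> is \<open>A\<close> rather than a.\<close>
  define Z where "Z = {(b, r). b \<in> a \<and> (r, p) \<in> le \<and> (r \<tturnstile> chk b \<^bold>\<in> A)}"
  define F where "F = mkname ((\<lambda>(b, r). (G b, r)) ` Z)"
  have card: "|(\<lambda>(b, r). (G b, r)) ` Z| \<le>o |UNIV :: ('a \<times> 'p) set|"
    using ordLeq_transitive[OF card_of_image card_of_mono1[OF subset_UNIV]] .
  have eF: "elts F = (\<lambda>(b, r). (G b, r)) ` Z"
    unfolding F_def by (rule elts_mkname[OF card])
  have Gn: "G b \<in> names P" for b by (auto simp: G_def)
  have F [simp]: "F \<in> names P"
    unfolding F_def by (rule mkname_names[OF card]) (auto simp: Z_def Gn dest: le_P)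
  have ab: "b \<in> Field \<kappa>" "\<iota> b \<in> W" "\<iota> b \<in> Field \<kappa>" if "b \<in> a" for b
    using that a W \<iota> by auto
  have memF: "\<exists>t b. (t, r) \<in> le \<and> b \<in> a \<and> (t \<tturnstile> chk b \<^bold>\<in> A) \<and> (t \<tturnstile> e \<^bold>= G b)"
    if "r \<tturnstile> e \<^bold>\<in> F" "r \<in> P" for r e
    using that le_refl[OF that(2)] forces_mono unfolding mem_range_name[OF eF] Z_def by fast
  have opF: "\<exists>t b. (t, r) \<in> le \<and> b \<in> a \<and> (t \<tturnstile> x \<^bold>= chk b) \<and> (t \<tturnstile> y \<^bold>= chk (\<iota> b))"
    if "r \<tturnstile> op x y \<^bold>\<in> F" "r \<in> P" for r x y
    using memF[OF that] op_inject unfolding G_def by meson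
  have FI: "r \<tturnstile> op x (chk (\<iota> b)) \<^bold>\<in> F"
    if "b \<in> a" "(r, p) \<in> le" "r \<tturnstile> x \<^bold>\<in> A" "r \<tturnstile> x \<^bold>= chk b" "x \<in> names P" for r x b
  proof -
    have "r \<tturnstile> chk b \<^bold>\<in> A" using that mem_cong_left by blast
    then have "(G b, r) \<in> elts F" using that by (auto simp: eF Z_def)
    then have "r \<tturnstile> G b \<^bold>\<in> F" using elts_mem le_refl that le_P by blast
    moreover have "r \<tturnstile> op x (chk (\<iota> b)) \<^bold>= G b"
      unfolding G_def by (rule op_cong[OF that(4) eq_refl]) (use that in auto)
    ultimately show ?thesis using mem_cong_left eq_sym by blast
  qed
  have "p \<tturnstile> injection_fm F A (ON W)"
    unfolding injection_fm_def function_fm_def forces_conj[of p]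
  proof (intro conjI)
    show "p \<tturnstile> \<^bold>\<forall>e\<^bold>\<in>F. \<^bold>\<exists>x\<^bold>\<in>A. \<^bold>\<exists>y\<^bold>\<in>ON W. opair_fm e x y"
      unfolding forces_ball[of p]
    proof (intro ballI allI impI)
      fix e q assume e: "e \<in> names P" "(q, p) \<in> le" "q \<tturnstile> e \<^bold>\<in> F"
      show "q \<tturnstile> \<^bold>\<exists>x\<^bold>\<in>A. \<^bold>\<exists>y\<^bold>\<in>ON W. opair_fm e x y"
      proof (rule forces_dense)
        fix r assume r: "(r, q) \<in> le"
        then obtain t b where t: "(t, r) \<in> le" "b \<in> a" "t \<tturnstile> chk b \<^bold>\<in> A" "t \<tturnstile> e \<^bold>= G b"
          using memF[of r e] e forces_mono le_P by blast
        have "t \<tturnstile> \<^bold>\<exists>x\<^bold>\<in>A. \<^bold>\<exists>y\<^bold>\<in>ON W. opair_fm e x y"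
          using t e ab by (intro forces_bexI[of "chk b"] forces_bexI[of "chk (\<iota> b)"] mem_chk_I)
            (auto simp: forces_opair G_def)
        then show "\<exists>t. (t, r) \<in> le \<and> (t \<tturnstile> \<^bold>\<exists>x\<^bold>\<in>A. \<^bold>\<exists>y\<^bold>\<in>ON W. opair_fm e x y)"
          using t by blast
      qed
    qed
    show "p \<tturnstile> \<^bold>\<forall>x\<^bold>\<in>A. \<^bold>\<exists>y. app_fm F x y \<^bold>\<and> (\<^bold>\<forall>y'. app_fm F x y' \<^bold>\<longrightarrow> y' \<^bold>= y)"
      unfolding forces_ball[of p]
    proof (intro ballI allI impI)
      fix x q assume x: "x \<in> names P" "(q, p) \<in> le" "q \<tturnstile> x \<^bold>\<in> A"
      show "q \<tturnstile> \<^bold>\<exists>y. app_fm F x y \<^bold>\<and> (\<^bold>\<forall>y'. app_fm F x y' \<^bold>\<longrightarrow> y' \<^bold>= y)"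
      proof (rule forces_dense)
        fix r assume r: "(r, q) \<in> le"
        have rp: "(r, p) \<in> le" using r x le_trans by blast
        have rA: "r \<tturnstile> x \<^bold>\<in> A" using x r forces_mono by blast
        obtain t b where t: "(t, r) \<in> le" "b \<in> a" "t \<tturnstile> x \<^bold>= chk b"
          using cover[OF rp x(1) rA] by blast
        have "s \<tturnstile> app_fm F x (chk (\<iota> b)) \<^bold>\<and> (\<^bold>\<forall>y'. app_fm F x y' \<^bold>\<longrightarrow> y' \<^bold>= chk (\<iota> b))"
          if s: "(s, t) \<in> le" for s
          unfolding forces_conj forces_all forces_imp
        proof (intro conjI ballI allI impI)
          have "(s, r) \<in> le" "(s, p) \<in> le" using s t rp le_trans by blast+
          then have "s \<tturnstile> x \<^bold>\<in> A" using rA forces_mono by blast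
          then show "s \<tturnstile> app_fm F x (chk (\<iota> b))"
            using FI[OF t(2) \<open>(s, p) \<in> le\<close> _ forces_mono[OF t(3) s]] x by (simp add: forces_app)
        next
          fix y' q' assume y': "y' \<in> names P" "(q', s) \<in> le" "q' \<tturnstile> app_fm F x y'"
          then have op: "q' \<tturnstile> op x y' \<^bold>\<in> F" using x by (simp add: forces_app)
          show "q' \<tturnstile> y' \<^bold>= chk (\<iota> b)"
          proof (rule forces_dense)
            fix r' assume r': "(r', q') \<in> le"
            obtain t' b' where t': "(t', r') \<in> le" "b' \<in> a" "t' \<tturnstile> x \<^bold>= chk b'" "t' \<tturnstile> y' \<^bold>= chk (\<iota> b')"
              using opF[OF forces_mono[OF op r'] le_P(1)[OF r']] by blast
            have "(t', t) \<in> le" using t' r' y' s le_trans by blast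
            then have "t' \<tturnstile> chk b \<^bold>= chk b'"
              using t(3) t'(3) forces_mono eq_sym eq_trans by blast
            then have "b = b'" using chk_eqD le_P(1)[OF t'(1)] ab t t' by blast
            then show "\<exists>t. (t, r') \<in> le \<and> (t \<tturnstile> y' \<^bold>= chk (\<iota> b))" using t' by blast
          qed
        qed
        then have "t \<tturnstile> \<^bold>\<exists>y. app_fm F x y \<^bold>\<and> (\<^bold>\<forall>y'. app_fm F x y' \<^bold>\<longrightarrow> y' \<^bold>= y)"
          by (intro forces_exI[of "chk (\<iota> b)"]) auto
        then show "\<exists>t. (t, r) \<in> le \<and> (t \<tturnstile> \<^bold>\<exists>y. app_fm F x y \<^bold>\<and> (\<^bold>\<forall>y'. app_fm F x y' \<^bold>\<longrightarrow> y' \<^bold>= y))"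
          using t by blast
      qed
    qed
    show "p \<tturnstile> \<^bold>\<forall>x x' y. app_fm F x y \<^bold>\<and> app_fm F x' y \<^bold>\<longrightarrow> x \<^bold>= x'"
      unfolding forces_all forces_imp forces_conj
    proof (intro ballI allI impI, elim conjE)
      fix x x' y q assume n: "x \<in> names P" "x' \<in> names P" "y \<in> names P" and "(q, p) \<in> le"
        and "q \<tturnstile> app_fm F x y" "q \<tturnstile> app_fm F x' y"
      then have op: "q \<tturnstile> op x y \<^bold>\<in> F" "q \<tturnstile> op x' y \<^bold>\<in> F" by (simp_all add: forces_app)
      show "q \<tturnstile> x \<^bold>= x'"
      proof (rule forces_dense)
        fix r assume r: "(r, q) \<in> le"
        obtain t b where t: "(t, r) \<in> le" "b \<in> a" "t \<tturnstile> x \<^bold>= chk b" "t \<tturnstile> y \<^bold>= chk (\<iota> b)"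
          using opF[OF forces_mono[OF op(1) r] le_P(1)[OF r]] by blast
        have "(t, q) \<in> le" using r t le_trans by blast
        obtain t' b' where t': "(t', t) \<in> le" "b' \<in> a" "t' \<tturnstile> x' \<^bold>= chk b'" "t' \<tturnstile> y \<^bold>= chk (\<iota> b')"
          using opF[OF forces_mono[OF op(2) \<open>(t, q) \<in> le\<close>] le_P(1)[OF t(1)]] by blast
        have "t' \<tturnstile> chk (\<iota> b) \<^bold>= chk (\<iota> b')"
          using eq_trans[OF eq_sym[OF forces_mono[OF t(4) t'(1)]] t'(4)] .
        then have "\<iota> b = \<iota> b'" using chk_eqD le_P(1)[OF t'(1)] ab t t' by blast
        then have "b = b'" using \<iota> t t' by (auto dest: inj_onD)
        then have "t' \<tturnstile> x \<^bold>= x'"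
          using eq_trans[OF forces_mono[OF t(3) t'(1)]] eq_sym[OF t'(3)] by simp
        then show "\<exists>t. (t, r) \<in> le \<and> (t \<tturnstile> x \<^bold>= x')" using t t' le_trans by blast
      qed
    qed
  qed
  then show ?thesis
    unfolding card_le_fm_def using forces_mono by (intro forces_exI[OF F]) blast
qed

section \<open>Cardinals as initial segments of \<kappa>\<close>

lemma initial_least:
  assumes "initial D" "D \<noteq> Field \<kappa>"
  shows "\<exists>x\<in>Field \<kappa> - D. underS \<kappa> x = D"
proof -
  have "Field \<kappa> - D \<noteq> {}" using assms by (auto simp: initial_def)
  then obtain x where x: "x \<in> Field \<kappa> - D" and min: "\<And>y. (y, x) \<in> \<kappa> - Id \<Longrightarrow> y \<notin> Field \<kappa> - D"
    using wf_less unfolding wf_eq_minimal by (metis all_not_in_conv)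
  have "underS \<kappa> x = D"
  proof (intro equalityI subsetI)
    fix y assume "y \<in> underS \<kappa> x"
    then show "y \<in> D" using min[of y] underS_sub by (auto simp: underS_def Field_def)
  next
    fix y assume "y \<in> D"
    then show "y \<in> underS \<kappa> x"
      using underS_cases[of x y] x assms(1) unfolding initial_def by auto
  qed
  then show ?thesis using x by blast
qed

lemma initial_card_bound:
  "initial {x \<in> Field \<kappa>. |underS \<kappa> x| \<le>o r}"
proof -
  have "|underS \<kappa> y| \<le>o |underS \<kappa> x|" if "y \<in> underS \<kappa> x" for x y
    using that underS_trans by (intro card_of_mono1) blast
  then show ?thesis
    unfolding initial_def using underS_sub ordLeq_transitive by blast
qed

text \<open>If the segment had size at most r, its least missing point would have exactly this
  segment as its set of predecessors and would thus belong to it. So the segment reaches the next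
  cardinal after r.\<close>

lemma not_card_bound:
  assumes "\<not> |Field \<kappa>| \<le>o r"
  shows "\<not> |{x \<in> Field \<kappa>. |underS \<kappa> x| \<le>o r}| \<le>o r" (is "\<not> |?W| \<le>o r")
proof
  assume le: "|?W| \<le>o r"
  with assms have "?W \<noteq> Field \<kappa>" by metis
  with initial_least[OF initial_card_bound[of r]] obtain x where
    "x \<in> Field \<kappa> - ?W" "underS \<kappa> x = ?W" by blast
  with le show False by auto
qed

text \<open>The copy of \<omega> inside \<kappa>.\<close>

definition W0 :: "'a set" where
  "W0 = {x \<in> Field \<kappa>. finite (underS \<kappa> x)}"

lemma initial_W0: "initial W0"
  unfolding initial_def W0_def using underS_trans underS_sub by (blast intro: finite_subset)

lemma W0_succ: "x \<in> W0 \<Longrightarrow> \<exists>y\<in>W0. x \<in> underS \<kappa> y"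
proof -
  assume x: "x \<in> W0"
  have "initial (insert x (underS \<kappa> x))"
    using x underS_trans underS_sub unfolding initial_def W0_def by blast
  moreover have f: "finite (insert x (underS \<kappa> x))" using x by (simp add: W0_def)
  ultimately obtain y where "y \<in> Field \<kappa>" "underS \<kappa> y = insert x (underS \<kappa> x)"
    using initial_least infinite_Field by (metis DiffD1)
  then show ?thesis using f by (intro bexI[of _ y]) (auto simp: W0_def)
qed

lemma W0_nonempty: "W0 \<noteq> {}"
proof -
  have "initial {}" by (simp add: initial_def)
  then obtain y where "y \<in> Field \<kappa>" "underS \<kappa> y = {}"
    using initial_least infinite_Field by (metis DiffD1 finite.emptyI)
  then show ?thesis by (auto simp: W0_def)
qed

lemma infinite_W0: "infinite W0"
proof
  assume "finite W0"
  then have "W0 \<noteq> Field \<kappa>" using infinite_Field by auto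
  with initial_least[OF initial_W0] obtain x where "x \<in> Field \<kappa> - W0" "underS \<kappa> x = W0" by blast
  with \<open>finite W0\<close> show False by (simp add: W0_def)
qed

text \<open>A point of the finite segment with the most predecessors is its maximum. This is why no
  element of \<open>W0\<close> is a limit.\<close>

lemma underS_maximal:
  assumes "x \<in> W0" "underS \<kappa> x \<noteq> {}"
  shows "\<exists>m\<in>underS \<kappa> x. \<forall>v\<in>underS \<kappa> x. m \<notin> underS \<kappa> v"
proof -
  let ?A = "underS \<kappa> x"
  have fin: "finite ?A" using assms by (simp add: W0_def)
  then have "Max ((\<lambda>v. card (underS \<kappa> v)) ` ?A) \<in> (\<lambda>v. card (underS \<kappa> v)) ` ?A"
    using assms(2) by (intro Max_in) auto
  then obtain m where m: "m \<in> ?A" "card (underS \<kappa> m) = Max ((\<lambda>v. card (underS \<kappa> v)) ` ?A)"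
    by auto
  have max: "card (underS \<kappa> v) \<le> card (underS \<kappa> m)" if "v \<in> ?A" for v
    unfolding m(2) using fin that by (intro Max_ge) auto
  have "m \<notin> underS \<kappa> v" if "v \<in> ?A" for v
  proof
    assume mv: "m \<in> underS \<kappa> v"
    have "m \<notin> underS \<kappa> m" by (simp add: underS_def)
    then have "underS \<kappa> m \<subset> underS \<kappa> v"
      using underS_trans[OF _ mv] mv by blast
    moreover have "finite (underS \<kappa> v)"
      using underS_trans[OF _ that] by (intro finite_subset[OF _ fin]) blast
    ultimately show False using max[OF that] psubset_card_mono[of "underS \<kappa> v" "underS \<kappa> m"] by simp
  qed
  then show ?thesis using m by blast
qed

text \<open>The delicate clause is that no element y is a limit. Densely y is the name of some
  \<open>underS \<kappa> x\<close>; if this is nonempty it has a maximum m, and being a limit would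
  put m below another element of the segment.\<close>

lemma omega_W0: "p \<tturnstile> omega_fm (ON W0)"
  unfolding omega_fm_def limit_fm_def forces_conj forces_ball[of p]
proof (intro conjI ballI allI impI)
  show "p \<tturnstile> ordinal_fm (ON W0)" by (rule ordinal_ON[OF initial_W0])
  obtain x where x: "x \<in> W0" using W0_nonempty by blast
  show "p \<tturnstile> \<^bold>\<exists>y. y \<^bold>\<in> ON W0"
    using x by (intro forces_exI[of "chk x"] mem_chk_I) auto
next
  fix y q assume y: "y \<in> names P" "(q, p) \<in> le" "q \<tturnstile> y \<^bold>\<in> ON W0"
  show "q \<tturnstile> \<^bold>\<exists>z\<^bold>\<in>ON W0. y \<^bold>\<in> z"
  proof (rule forces_dense)
    fix r assume "(r, q) \<in> le"
    then obtain t x where t: "(t, r) \<in> le" "x \<in> W0" "t \<tturnstile> y \<^bold>= chk x"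
      using y unfolding mem_ON by blast
    then obtain z where "z \<in> W0" "x \<in> underS \<kappa> z" using W0_succ by blast
    then have "t \<tturnstile> \<^bold>\<exists>z\<^bold>\<in>ON W0. y \<^bold>\<in> z"
      using t chk_ON[of z] by (intro forces_bexI[of "chk z"] mem_chk_I) (auto intro: mem_ON_I)
    then show "\<exists>t. (t, r) \<in> le \<and> (t \<tturnstile> \<^bold>\<exists>z\<^bold>\<in>ON W0. y \<^bold>\<in> z)" using t by blast
  qed
next
  fix y q assume y: "y \<in> names P" "(q, p) \<in> le" "q \<tturnstile> y \<^bold>\<in> ON W0"
  show "q \<tturnstile> \<^bold>\<not> (ordinal_fm y \<^bold>\<and> (\<^bold>\<exists>x. x \<^bold>\<in> y) \<^bold>\<and> (\<^bold>\<forall>z\<^bold>\<in>y. \<^bold>\<exists>u\<^bold>\<in>y. z \<^bold>\<in> u))"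
    unfolding forces_not[of q] forces_conj
  proof (intro allI impI notI, elim conjE)
    fix r assume r: "(r, q) \<in> le" and ex: "r \<tturnstile> \<^bold>\<exists>x. x \<^bold>\<in> y"
      and un: "r \<tturnstile> \<^bold>\<forall>z\<^bold>\<in>y. \<^bold>\<exists>u\<^bold>\<in>y. z \<^bold>\<in> u"
    obtain t x where t: "(t, r) \<in> le" "x \<in> W0" "t \<tturnstile> y \<^bold>= ON (underS \<kappa> x)"
      using y r unfolding mem_ON chk_ON[symmetric] by blast
    obtain s z where "(s, t) \<in> le" "s \<tturnstile> z \<^bold>\<in> y"
      using ex t unfolding forces_ex by blast
    then have "s \<tturnstile> z \<^bold>\<in> ON (underS \<kappa> x)" "s \<in> P"
      using t forces_mono mem_cong_right le_P by blast+
    then have "underS \<kappa> x \<noteq> {}" using mem_ON_D by blast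
    then obtain m where m: "m \<in> underS \<kappa> x" "\<And>v. v \<in> underS \<kappa> x \<Longrightarrow> m \<notin> underS \<kappa> v"
      using underS_maximal t by blast
    have "t \<tturnstile> chk m \<^bold>\<in> y"
      using mem_chk_I[OF m(1)] t(3) mem_cong_right eq_sym by blast
    then have "t \<tturnstile> \<^bold>\<exists>u\<^bold>\<in>y. chk m \<^bold>\<in> u"
      using un t unfolding forces_ball by blast
    then obtain s u where s: "(s, t) \<in> le" "s \<tturnstile> u \<^bold>\<in> y" "s \<tturnstile> chk m \<^bold>\<in> u"
      using le_refl le_P t unfolding forces_bex by blast
    then have "s \<tturnstile> u \<^bold>\<in> ON (underS \<kappa> x)" using t forces_mono mem_cong_right by blast
    then obtain s' v where s': "(s', s) \<in> le" "v \<in> underS \<kappa> x" "s' \<tturnstile> u \<^bold>= ON (underS \<kappa> v)"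
      using mem_ON_D[of s u] le_P s chk_ON by metis
    then have "s' \<tturnstile> chk m \<^bold>\<in> ON (underS \<kappa> v)" using s forces_mono mem_cong_right by blast
    then have "m \<in> underS \<kappa> v"
      using chk_memD le_P s' m(1) underS_sub by blast
    with m(2) s' show False by blast
  qed
qed

text \<open>Only \<open>large\<close> depends on preservation by the forcing: existing injections
  are carried over by \<open>card_le_ON\<close>, whereas new ones have to be excluded.\<close>

lemma card_suc_ON:
  assumes "initial W" "initial V"
    and small: "\<And>x. x \<in> W \<Longrightarrow> |underS \<kappa> x| \<le>o |V|"
    and large: "\<And>q. (q, p) \<in> le \<Longrightarrow> \<not> (q \<tturnstile> card_le_fm (ON W) (ON V))"
  shows "p \<tturnstile> card_suc_fm (ON W) (ON V)"
  unfolding card_suc_fm_def forces_conj forces_not forces_ball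
proof (intro conjI ballI allI impI)
  show "p \<tturnstile> ordinal_fm (ON W)" by (rule ordinal_ON) fact
next
  fix q assume "(q, p) \<in> le"
  then show "\<not> (q \<tturnstile> card_le_fm (ON W) (ON V))" by (rule large)
next
  fix y q assume y: "y \<in> names P" "(q, p) \<in> le" "q \<tturnstile> y \<^bold>\<in> ON W"
  show "q \<tturnstile> card_le_fm y (ON V)"
  proof (rule forces_dense)
    fix r assume "(r, q) \<in> le"
    then obtain t x where t: "(t, r) \<in> le" "x \<in> W" "t \<tturnstile> y \<^bold>= ON (underS \<kappa> x)"
      using y unfolding mem_ON chk_ON[symmetric] by blast
    obtain \<iota> where "inj_on \<iota> (underS \<kappa> x)" "\<iota> ` underS \<kappa> x \<subseteq> V"
      using small[OF t(2)] unfolding card_of_ordLeq[symmetric] by auto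
    have "t \<tturnstile> card_le_fm y (ON V)"
    proof (rule card_le_ON[OF y(1) underS_sub])
      show "inj_on \<iota> (underS \<kappa> x)" "\<iota> ` underS \<kappa> x \<subseteq> V" by fact+
      show "V \<subseteq> Field \<kappa>" using assms(2) by (simp add: initial_def)
      fix s x' assume "(s, t) \<in> le" "s \<tturnstile> x' \<^bold>\<in> y"
      then have "s \<tturnstile> x' \<^bold>\<in> ON (underS \<kappa> x)" using t(3) mem_cong_right forces_mono by blast
      then show "\<exists>t. (t, s) \<in> le \<and> (\<exists>b\<in>underS \<kappa> x. t \<tturnstile> x' \<^bold>= chk b)"
        using mem_ON_D le_P \<open>(s, t) \<in> le\<close> by blast
    qed
    then show "\<exists>t. (t, r) \<in> le \<and> (t \<tturnstile> card_le_fm y (ON V))" using t by blast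
  qed
qed

end

section \<open>Cardinal arithmetic under CH\<close>

abbreviation small :: "'b set \<Rightarrow> bool" where
  "small A \<equiv> |A| \<le>o card_omega1"

lemma Card_order_omega1: "Card_order card_omega1"
  by (rule cardSuc_Card_order[OF natLeq_Card_order])

lemma infinite_omega1: "infinite (Field card_omega1)"
  using cardSuc_finite[OF natLeq_Card_order] by (simp add: Field_natLeq)

lemma natLeq_le_omega1: "natLeq \<le>o card_omega1"
  by (rule cardSuc_ordLeq[OF natLeq_Card_order])

lemma small_subset: "small B \<Longrightarrow> A \<subseteq> B \<Longrightarrow> small A"
  using card_of_mono1 ordLeq_transitive by blast

lemma small_inj: "inj_on f A \<Longrightarrow> small (f ` A) \<Longrightarrow> small A"
  using card_of_ordLeq[of A "f ` A"] ordLeq_transitive by blast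

lemma small_image: "small A \<Longrightarrow> small (f ` A)"
  using card_of_image ordLeq_transitive by blast

lemma countable_small: "countable A \<Longrightarrow> small A"
  using countable_card_le_natLeq natLeq_le_omega1 ordLeq_transitive by blast

lemma small_Un: "small A \<Longrightarrow> small B \<Longrightarrow> small (A \<union> B)"
  by (rule card_of_Un_ordLeq_infinite_Field[OF infinite_omega1 _ _ Card_order_omega1])

lemma small_UN: "small I \<Longrightarrow> (\<And>i. i \<in> I \<Longrightarrow> small (A i)) \<Longrightarrow> small (\<Union>i\<in>I. A i)"
  by (rule card_of_UNION_ordLeq_infinite_Field[OF infinite_omega1 Card_order_omega1]) auto

text \<open>By CH the points of \<open>S\<close> can be taken as sets of naturals, and pairing codes
  a sequence of such sets by a single one: (2^\<omega>)^\<omega> = 2^\<omega> = \<omega>1.\<close>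

lemma small_sequences:
  fixes S :: "'b set"
  assumes CH and S: "small S"
  shows "small {s :: 'n :: countable \<Rightarrow> 'b. range s \<subseteq> S}"
proof -
  have CH': "|UNIV :: nat set set| \<le>o card_omega1" "card_omega1 \<le>o |UNIV :: nat set set|"
    using \<open>CH\<close> unfolding CH_def by (simp_all add: ordIso_imp_ordLeq ordIso_symmetric)
  have "|S| \<le>o |UNIV :: nat set set|" using ordLeq_transitive[OF S CH'(2)] .
  then obtain f :: "'b \<Rightarrow> nat set" where f: "inj_on f S"
    using card_of_ordLeq[of S "UNIV :: nat set set"] by auto
  define F where "F s = {prod_encode (to_nat n, m) | n m. m \<in> f (s n)}" for s :: "'n \<Rightarrow> 'b"
  have *: "m \<in> f (s n) \<longleftrightarrow> prod_encode (to_nat n, m) \<in> F s" for s n m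
    by (auto simp: F_def)
  have "inj_on F {s. range s \<subseteq> S}"
  proof (rule inj_onI, rule ext)
    fix s t n assume st: "s \<in> {s. range s \<subseteq> S}" "t \<in> {s. range s \<subseteq> S}" and "F s = F t"
    then have "f (s n) = f (t n)" using *[of _ s n] *[of _ t n] by auto
    moreover have "s n \<in> S" "t n \<in> S" using st by auto
    ultimately show "s n = t n" using f by (simp add: inj_on_eq_iff)
  qed
  then show ?thesis
    by (rule small_inj) (rule small_subset[OF CH'(1) subset_UNIV])
qed

lemma small_partial_maps:
  fixes S :: "'b set"
  assumes CH "small S"
  shows "small {s :: 'n :: countable \<rightharpoonup> 'b. ran s \<subseteq> S}"
proof -
  have "small (insert None (Some ` S))"
    using small_Un[OF countable_small[of "{None}"] small_image[OF assms(2), of Some]] by simp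
  from small_sequences[OF assms(1) this]
  have "small {s :: 'n \<rightharpoonup> 'b. range s \<subseteq> insert None (Some ` S)}" .
  then show ?thesis
  proof (rule small_subset, intro subsetI CollectI)
    fix s :: "'n \<rightharpoonup> 'b" and v assume "s \<in> {s. ran s \<subseteq> S}" "v \<in> range s"
    then obtain n where "v = s n" and S: "\<And>a. s n = Some a \<Longrightarrow> a \<in> S" by (auto simp: ran_def)
    then show "v \<in> insert None (Some ` S)" by (cases "s n") auto
  qed
qed

text \<open>Closing off along \<omega>1. Each stage stays small because by CH it has only \<omega>1
  countable partial sequences. Regularity of \<omega>1 places the range of s inside one stage, and a
  later stage contains \<open>Z s\<close>. Sequences are partial so that any set of indices can
  serve as their domain.\<close>

lemma countably_closed_hull:
  fixes Z :: "('n :: countable \<rightharpoonup> 'b) \<Rightarrow> 'b set"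
  assumes CH and W: "small W" and Z: "\<And>s. small (Z s)"
  shows "\<exists>S. W \<subseteq> S \<and> small S \<and> (\<forall>s. ran s \<subseteq> S \<longrightarrow> Z s \<subseteq> S)"
proof -
  let ?r = card_omega1
  note co = Card_order_omega1
  have wo: "Well_order ?r" using co card_order_on_well_order_on by blast
  have wf: "wf (?r - Id)" using wo by (simp add: well_order_on_def)
  define S where "S = wfrec (?r - Id) (\<lambda>S i. W \<union> (\<Union>j\<in>underS ?r i. \<Union> (Z ` {s. ran s \<subseteq> S j})))"
  have S: "S i = W \<union> (\<Union>j\<in>underS ?r i. \<Union> (Z ` {s. ran s \<subseteq> S j}))" for i
    unfolding S_def by (subst wfrec[OF wf]) (auto simp: cut_def underS_def)
  have underS_small: "small (underS ?r i)" for i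
  proof -
    have "|underS ?r i| \<le>o |Field ?r|" by (intro card_of_mono1) (auto simp: underS_def Field_def)
    then show ?thesis using ordLeq_ordIso_trans card_of_Field_ordIso[OF co] by blast
  qed
  have small_S: "small (S i)" for i
    using wf
  proof (induction i rule: wf_induct_rule)
    case (less i)
    then show ?case
      using small_partial_maps[OF \<open>CH\<close>] Z
      by (subst S) (intro small_Un W small_UN underS_small; auto simp: underS_def)
  qed
  have mono: "S i \<subseteq> S j" if "(i, j) \<in> ?r" for i j
  proof -
    have "underS ?r i \<subseteq> underS ?r j"
      using wo that underS_incr[of ?r i j]
      by (auto simp: well_order_on_def linear_order_on_def partial_order_on_def preorder_on_def)
    then show ?thesis by (subst (1 2) S) blast
  qed
  let ?U = "\<Union>i\<in>Field ?r. S i"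
  have "small (Field ?r)"
    using card_of_Field_ordIso[OF co] by (rule ordIso_imp_ordLeq)
  then have "small ?U" using small_S by (rule small_UN)
  moreover have "W \<subseteq> ?U"
    using infinite_omega1 S by (metis (no_types, lifting) UN_upper Un_subset_iff equals0I finite.emptyI order_refl subset_trans)
  moreover have "Z s \<subseteq> ?U" if s: "ran s \<subseteq> ?U" for s
  proof -
    have "countable (ran s)"
    proof (rule countable_subset)
      show "ran s \<subseteq> range (\<lambda>n. the (s n))" by (auto simp: ran_def) (metis option.sel rangeI)
    qed simp
    then have "|ran s| \<le>o natLeq" by (simp add: countable_card_le_natLeq)
    moreover have "relChain ?r S" using mono by (auto simp: relChain_def)
    ultimately obtain i where i: "i \<in> Field ?r" "ran s \<subseteq> S i"
      using cardSuc_UNION[OF natLeq_Card_order _ _ s] by (auto simp: Field_natLeq)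
    obtain j where j: "j \<in> Field ?r" "i \<noteq> j" "(i, j) \<in> ?r"
      using infinite_Card_order_limit[OF co infinite_omega1 i(1)] by blast
    then have "Z s \<subseteq> S j" using i by (subst S) (auto simp: underS_def)
    then show ?thesis using j by blast
  qed
  ultimately show ?thesis by blast
qed

text \<open>
  \<open>N\<close> indexes the root of a \<open>\<Delta>\<close>-system. In place of the system itself, the lemma provides a
  member whose part outside the root avoids any given set of size \<open>\<omega>\<^sub>1\<close>.
\<close>

lemma delta_system:
  fixes e :: "'i \<Rightarrow> 'n :: countable \<Rightarrow> 'b"
  assumes CH and W: "small W" and esc: "\<And>S. small S \<Longrightarrow> \<exists>i\<in>I. e i n0 \<notin> S"
  shows "\<exists>i\<in>I. \<exists>N. n0 \<notin> N \<and> (\<forall>n. e i n \<in> W \<longrightarrow> n \<in> N) \<and>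
    (\<forall>Z. small Z \<longrightarrow> (\<exists>j\<in>I. (\<forall>n\<in>N. e j n = e i n) \<and> (\<forall>n. n \<notin> N \<longrightarrow> e j n \<notin> Z)))"
proof (rule ccontr)
  assume contra: "\<not> ?thesis"
  \<comment> \<open>\<open>Q s Z\<close> says that the small set \<open>Z\<close> meets, outside the
    domain of s, every member of the system that extends s. Closing \<open>S\<close> under a choice
    of such \<open>Z\<close> replaces the thinning out of a \<Delta>-system.\<close>
  define Q where "Q s Z \<longleftrightarrow> small Z \<and> (\<forall>j\<in>I. (\<forall>n\<in>dom s. s n = Some (e j n)) \<longrightarrow> (\<exists>n. n \<notin> dom s \<and> e j n \<in> Z))"
    for s :: "'n \<rightharpoonup> 'b" and Z
  define Zf where "Zf s = (if \<exists>Z. Q s Z then SOME Z. Q s Z else {})" for s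
  have "small (Zf s)" for s
    using someI_ex[of "Q s"] countable_small[of "{}"] by (auto simp: Zf_def Q_def)
  then obtain S where S: "W \<subseteq> S" "small S" "\<And>s. ran s \<subseteq> S \<Longrightarrow> Zf s \<subseteq> S"
    using countably_closed_hull[OF \<open>CH\<close> W, of Zf] by blast
  obtain i where i: "i \<in> I" "e i n0 \<notin> S" using esc[OF S(2)] by blast
  \<comment> \<open>The root is the trace of \<open>e i\<close> on \<open>S\<close>. If it had a
    small hitting set, the chosen one would lie inside \<open>S\<close>, and \<open>e i\<close>
    itself would meet it at an index outside \<open>N\<close>, that is, would take a value in
    \<open>S\<close> there; this contradicts the definition of \<open>N\<close>.\<close>
  define N where "N = {n. e i n \<in> S}"
  define s where "s = (\<lambda>n. Some (e i n)) |` N"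
  have N: "n0 \<notin> N" "\<forall>n. e i n \<in> W \<longrightarrow> n \<in> N" using i S(1) by (auto simp: N_def)
  have "\<not> (\<forall>Z. small Z \<longrightarrow> (\<exists>j\<in>I. (\<forall>n\<in>N. e j n = e i n) \<and> (\<forall>n. n \<notin> N \<longrightarrow> e j n \<notin> Z)))"
  proof
    assume "\<forall>Z. small Z \<longrightarrow> (\<exists>j\<in>I. (\<forall>n\<in>N. e j n = e i n) \<and> (\<forall>n. n \<notin> N \<longrightarrow> e j n \<notin> Z))"
    with contra show False by (elim notE) (intro bexI[OF _ i(1)] exI[of _ N] conjI N)
  qed
  then obtain Z where Z: "small Z"
    "\<And>j. j \<in> I \<Longrightarrow> (\<forall>n\<in>N. e j n = e i n) \<Longrightarrow> \<exists>n. n \<notin> N \<and> e j n \<in> Z" by metis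
  have dom: "dom s = N" "\<And>n. n \<in> N \<Longrightarrow> s n = Some (e i n)" by (auto simp: s_def)
  have "Q s Z" unfolding Q_def dom(1)
  proof (intro conjI ballI impI)
    fix j assume "j \<in> I" "\<forall>n\<in>N. s n = Some (e j n)"
    then show "\<exists>n. n \<notin> N \<and> e j n \<in> Z" using Z(2)[of j] dom(2) by simp
  qed (rule Z(1))
  then have "Q s (Zf s)" using someI_ex[of "Q s"] by (auto simp: Zf_def)
  then obtain n where "n \<notin> N" "e i n \<in> Zf s" unfolding Q_def dom(1) using i(1) dom(2) by blast
  moreover have "ran s \<subseteq> S" by (auto simp: ran_def s_def N_def restrict_map_def)
  ultimately show False using S(3)[of s] by (auto simp: N_def)
qed

section \<open>Preservation of cardinals\<close>

context forcing begin

text \<open>A descending chain enters the countably many open dense sets one after another, and a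
  lower bound of the chain lies in all of them. Every later use of \<sigma>-completeness goes
  through this lemma.\<close>

lemma sigma_dense:
  assumes sc: "sigma_complete P le" and p: "p \<in> P" and C: "countable C"
    and dense: "\<And>c q. c \<in> C \<Longrightarrow> (q, p) \<in> le \<Longrightarrow> \<exists>r. (r, q) \<in> le \<and> D c r"
    and mono: "\<And>c q r. D c q \<Longrightarrow> (r, q) \<in> le \<Longrightarrow> D c r"
  shows "\<exists>q. (q, p) \<in> le \<and> (\<forall>c\<in>C. D c q)"
proof (cases "C = {}")
  case True
  then show ?thesis using le_refl[OF p] by blast
next
  case False
  define d where "d = from_nat_into C"
  have d: "d n \<in> C" for n using False by (simp add: d_def from_nat_into)
  have "\<exists>f. \<forall>n. (f n, p) \<in> le \<and> ((f (Suc n), f n) \<in> le \<and> D (d n) (f (Suc n)))"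
  proof (rule dependent_nat_choice)
    show "\<exists>x. (x, p) \<in> le" using le_refl[OF p] by blast
  next
    fix x n assume "(x, p) \<in> le"
    then show "\<exists>y. (y, p) \<in> le \<and> (y, x) \<in> le \<and> D (d n) y"
      using dense[OF d] le_trans by blast
  qed
  then obtain f where f: "\<And>n. (f n, p) \<in> le" "\<And>n. (f (Suc n), f n) \<in> le" "\<And>n. D (d n) (f (Suc n))"
    by blast
  then obtain q where q: "\<And>n. (q, f n) \<in> le"
    using sc le_P(1) unfolding sigma_complete_def by (metis image_subset_iff)
  have "D c q" if "c \<in> C" for c
    using mono[OF f(3) q] from_nat_into_surj[OF C that] unfolding d_def by metis
  then show ?thesis using le_trans[OF q f(1)] by blast
qed

text \<open>Read \<open>\<Phi> x y q\<close> as: \<open>q\<close> forces that \<open>y\<close> is the value of some function at \<open>x\<close>.\<close>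

lemma no_countable_cover:
  assumes sc: "sigma_complete P le" and p: "p \<in> P" and C: "countable C" and Y: "\<not> countable Y"
    and mono: "\<And>x y q r. \<Phi> x y q \<Longrightarrow> (r, q) \<in> le \<Longrightarrow> \<Phi> x y r"
    and fn: "\<And>x y y' q. \<Phi> x y q \<Longrightarrow> \<Phi> x y' q \<Longrightarrow> q \<in> P \<Longrightarrow> (q, p) \<in> le \<Longrightarrow> y = y'"
  shows "\<exists>y\<in>Y. \<exists>q. (q, p) \<in> le \<and> (\<forall>t x. (t, q) \<in> le \<longrightarrow> x \<in> C \<longrightarrow> \<not> \<Phi> x y t)"
proof -
  \<comment> \<open>Either r decides the value at x, or no extension of r ever does. Once q has
    settled this for all x in \<open>C\<close>, only countably many values remain possible below
    q.\<close>
  define D where "D x r \<longleftrightarrow> (\<exists>y. \<Phi> x y r) \<or> (\<forall>t y. (t, r) \<in> le \<longrightarrow> \<not> \<Phi> x y t)" for x r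
  have "\<exists>q. (q, p) \<in> le \<and> (\<forall>c\<in>C. D c q)"
  proof (rule sigma_dense[OF sc p C])
    show "\<exists>r. (r, q) \<in> le \<and> D c r" if "(q, p) \<in> le" for c q
      unfolding D_def using le_refl[OF le_P(1)[OF that]] by blast
    show "D c r" if "D c q" "(r, q) \<in> le" for c q r
      using that mono le_trans unfolding D_def by blast
  qed
  then obtain q where q: "(q, p) \<in> le" "\<And>c. c \<in> C \<Longrightarrow> D c q" by blast
  have "{y. \<exists>x\<in>C. \<Phi> x y q} \<subseteq> (\<lambda>x. THE y. \<Phi> x y q) ` C"
  proof
    fix y assume "y \<in> {y. \<exists>x\<in>C. \<Phi> x y q}"
    then obtain x where x: "x \<in> C" "\<Phi> x y q" by blast
    then have "(THE y. \<Phi> x y q) = y"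
      using fn[OF _ x(2)] q(1) le_P(1)[OF q(1)] by (intro the_equality)
    then show "y \<in> (\<lambda>x. THE y. \<Phi> x y q) ` C" using x by blast
  qed
  then have "countable {y. \<exists>x\<in>C. \<Phi> x y q}"
    by (rule countable_subset) (use C in simp)
  with Y have "\<not> Y \<subseteq> {y. \<exists>x\<in>C. \<Phi> x y q}" by (metis countable_subset)
  then obtain y where y: "y \<in> Y" "\<And>x. x \<in> C \<Longrightarrow> \<not> \<Phi> x y q" by auto
  have "\<not> \<Phi> x y t" if t: "(t, q) \<in> le" "x \<in> C" for t x
  proof
    assume xt: "\<Phi> x y t"
    then obtain y' where "\<Phi> x y' q" using q(2)[OF t(2)] t unfolding D_def by blast
    then have "y' = y" using fn[OF mono[OF _ t(1)] xt] le_P(1) t le_trans q by blast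
    with y t \<open>\<Phi> x y' q\<close> show False by blast
  qed
  then show ?thesis using y q by blast
qed

text \<open>Conditions that give one x different values are incompatible, so by the chain condition
  each x has at most \<omega>1 possible values, and \<omega>1 many x do not exhaust
  \<open>Y\<close>. The value y is missed by all conditions below p, whereas the countable version
  first has to strengthen p.\<close>

lemma no_small_cover:
  assumes cc: "omega2_cc P le" and C: "small C" and Y: "\<not> small Y"
    and mono: "\<And>x y q r. \<Phi> x y q \<Longrightarrow> (r, q) \<in> le \<Longrightarrow> \<Phi> x y r"
    and fn: "\<And>x y y' q. \<Phi> x y q \<Longrightarrow> \<Phi> x y' q \<Longrightarrow> q \<in> P \<Longrightarrow> (q, p) \<in> le \<Longrightarrow> y = y'"
  shows "\<exists>y\<in>Y. \<forall>t x. (t, p) \<in> le \<longrightarrow> x \<in> C \<longrightarrow> \<not> \<Phi> x y t"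
proof (rule ccontr)
  assume "\<not> ?thesis"
  then obtain t x where tx: "\<And>y. y \<in> Y \<Longrightarrow> (t y, p) \<in> le \<and> x y \<in> C \<and> \<Phi> (x y) y (t y)"
    by metis
  define Yx where "Yx c = {y \<in> Y. x y = c}" for c
  have small: "small (Yx c)" if "c \<in> C" for c
  proof -
    have eq: "y = y'" if "y \<in> Yx c" "y' \<in> Yx c" "(s, t y) \<in> le" "(s, t y') \<in> le" for y y' s
    proof (rule fn[of c _ s])
      have "(t y, p) \<in> le" "\<Phi> c y (t y)" "\<Phi> c y' (t y')"
        using that(1,2) tx[of y] tx[of y'] unfolding Yx_def by auto
      then show "\<Phi> c y s" "\<Phi> c y' s" "s \<in> P" "(s, p) \<in> le"
        using that(3,4) mono le_trans[OF that(3)] le_P(1) by simp_all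
    qed
    have P: "t y \<in> P" if "y \<in> Yx c" for y using tx[of y] that le_P(1) unfolding Yx_def by blast
    have "inj_on t (Yx c)"
      using eq le_refl P by (metis inj_onI)
    moreover have "antichain_in P le (t ` Yx c)"
      unfolding antichain_in_def pairwise_def compatible_in_def using P eq by blast
    ultimately show ?thesis
      using cc small_inj unfolding omega2_cc_def by blast
  qed
  have "Y \<subseteq> (\<Union>c\<in>C. Yx c)" using tx by (auto simp: Yx_def)
  moreover have "small (\<Union>c\<in>C. Yx c)" using C small by (rule small_UN)
  ultimately show False using Y small_subset by blast
qed

end

section \<open>The poset of countable colourings\<close>

text \<open>The diagonal value lets equality of points be read off the colour table. The domain is
  nonempty because the order asks for an old point to match every new one.\<close>

definition is_colouring :: "'a set \<Rightarrow> 'a set \<Rightarrow> 'a \<Rightarrow> 'a set \<Rightarrow> ('a \<Rightarrow> 'a \<Rightarrow> 'a) \<Rightarrow> bool" where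
  "is_colouring K C x1 a g \<longleftrightarrow> a \<subseteq> K \<and> countable a \<and> a \<noteq> {} \<and> (\<forall>\<alpha>\<in>a. g \<alpha> \<alpha> = x1) \<and>
    (\<forall>\<alpha>\<in>a. \<forall>\<beta>\<in>a. \<alpha> \<noteq> \<beta> \<longrightarrow> g \<alpha> \<beta> \<in> C \<and> g \<alpha> \<beta> = g \<beta> \<alpha>)"

text \<open>
  Conditions are countable partial colourings \<open>cl p\<close> of the pairs from \<open>dm p\<close>; off the diagonal the
  colours are in \<open>C\<close>, and \<open>x1 \<notin> C\<close> marks the diagonal.
\<close>

locale colouring_poset =
  fixes K C :: "'a set" and x1 :: 'a and P :: "'p set"
    and dm :: "'p \<Rightarrow> 'a set" and cl :: "'p \<Rightarrow> 'a \<Rightarrow> 'a \<Rightarrow> 'a"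
  assumes x1: "x1 \<notin> C" and C_nonempty: "C \<noteq> {}" and K_nonempty: "K \<noteq> {}"
    and cond: "p \<in> P \<Longrightarrow> is_colouring K C x1 (dm p) (cl p)"
    and ex_cond: "is_colouring K C x1 a g \<Longrightarrow> \<exists>p\<in>P. dm p = a \<and> (\<forall>\<alpha>\<in>a. \<forall>\<beta>\<in>a. cl p \<alpha> \<beta> = g \<alpha> \<beta>)"
    and cond_eqI: "p \<in> P \<Longrightarrow> q \<in> P \<Longrightarrow> dm p = dm q \<Longrightarrow>
      (\<forall>\<alpha>\<in>dm p. \<forall>\<beta>\<in>dm p. cl p \<alpha> \<beta> = cl q \<alpha> \<beta>) \<Longrightarrow> p = q"
begin

text \<open>
  The last clause leaves a new point only the countably many types over \<open>dm p\<close>, modulo finite sets,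
  that are realised in \<open>p\<close>. This is what rules out rainbow sets.
\<close>

definition le :: "'p rel" where
  "le = {(q, p). p \<in> P \<and> q \<in> P \<and> dm p \<subseteq> dm q \<and> (\<forall>\<alpha>\<in>dm p. \<forall>\<beta>\<in>dm p. cl q \<alpha> \<beta> = cl p \<alpha> \<beta>) \<and>
    (\<forall>\<beta>\<in>dm q. \<exists>b\<in>dm p. finite {\<alpha> \<in> dm p. cl q \<alpha> \<beta> \<noteq> cl p \<alpha> b})}"

lemma leD:
  assumes "(q, p) \<in> le"
  shows "p \<in> P" "q \<in> P" "dm p \<subseteq> dm q" "\<And>\<alpha> \<beta>. \<alpha> \<in> dm p \<Longrightarrow> \<beta> \<in> dm p \<Longrightarrow> cl q \<alpha> \<beta> = cl p \<alpha> \<beta>"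
    "\<And>\<beta>. \<beta> \<in> dm q \<Longrightarrow> \<exists>b\<in>dm p. finite {\<alpha> \<in> dm p. cl q \<alpha> \<beta> \<noteq> cl p \<alpha> b}"
  using assms by (auto simp: le_def)

text \<open>An old point witnesses its own type without exceptions, so only new points need a
  partner.\<close>

lemma leI:
  assumes "p \<in> P" "q \<in> P" "dm p \<subseteq> dm q" "\<And>\<alpha> \<beta>. \<alpha> \<in> dm p \<Longrightarrow> \<beta> \<in> dm p \<Longrightarrow> cl q \<alpha> \<beta> = cl p \<alpha> \<beta>"
    and "\<And>\<beta>. \<beta> \<in> dm q \<Longrightarrow> \<beta> \<notin> dm p \<Longrightarrow> \<exists>b\<in>dm p. finite {\<alpha> \<in> dm p. cl q \<alpha> \<beta> \<noteq> cl p \<alpha> b}"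
  shows "(q, p) \<in> le"
proof -
  have "\<exists>b\<in>dm p. finite {\<alpha> \<in> dm p. cl q \<alpha> \<beta> \<noteq> cl p \<alpha> b}" if "\<beta> \<in> dm q" for \<beta>
  proof (cases "\<beta> \<in> dm p")
    case True
    then have "{\<alpha> \<in> dm p. cl q \<alpha> \<beta> \<noteq> cl p \<alpha> \<beta>} = {}" using assms(4) by auto
    then show ?thesis using True by (metis finite.emptyI)
  qed (use assms(5) that in blast)
  then show ?thesis using assms by (auto simp: le_def)
qed

lemma condD:
  assumes "p \<in> P"
  shows "dm p \<subseteq> K" "countable (dm p)" "dm p \<noteq> {}" "\<And>\<alpha>. \<alpha> \<in> dm p \<Longrightarrow> cl p \<alpha> \<alpha> = x1"
    "\<And>\<alpha> \<beta>. \<alpha> \<in> dm p \<Longrightarrow> \<beta> \<in> dm p \<Longrightarrow> \<alpha> \<noteq> \<beta> \<Longrightarrow> cl p \<alpha> \<beta> \<in> C"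
    "\<And>\<alpha> \<beta>. \<alpha> \<in> dm p \<Longrightarrow> \<beta> \<in> dm p \<Longrightarrow> cl p \<alpha> \<beta> = cl p \<beta> \<alpha>"
  using cond[OF assms] unfolding is_colouring_def by (simp_all, metis)

text \<open>This makes a map that preserves colours automatically injective, and a map defined
  through enumerations with repetitions well defined.\<close>

lemma cl_eq_x1: "p \<in> P \<Longrightarrow> \<alpha> \<in> dm p \<Longrightarrow> \<beta> \<in> dm p \<Longrightarrow> cl p \<alpha> \<beta> = x1 \<longleftrightarrow> \<alpha> = \<beta>"
  using condD(4,5) x1 by metis

text \<open>For transitivity the old point is traced back through both steps; the exceptional sets
  of the two steps have a finite union.\<close>

lemma partial_order: "partial_order_on P le"
  unfolding partial_order_on_def preorder_on_def
proof (intro conjI)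
  show "le \<subseteq> P \<times> P" by (auto simp: le_def)
  show "refl_on P le" by (auto intro!: refl_onI leI)
  show "antisym le"
  proof (rule antisymI)
    fix p q assume pq: "(p, q) \<in> le" and qp: "(q, p) \<in> le"
    show "p = q"
      by (rule cond_eqI) (use leD(1-4)[OF pq] leD(1-4)[OF qp] in auto)
  qed
  show "trans le"
  proof (rule transI)
    fix r q p assume rq: "(r, q) \<in> le" and qp: "(q, p) \<in> le"
    show "(r, p) \<in> le"
    proof (rule leI)
      show "dm p \<subseteq> dm r" using leD(3) rq qp by blast
      show "cl r \<alpha> \<beta> = cl p \<alpha> \<beta>" if "\<alpha> \<in> dm p" "\<beta> \<in> dm p" for \<alpha> \<beta>
        using that leD(3)[OF qp] leD(4)[OF rq, of \<alpha> \<beta>] leD(4)[OF qp, of \<alpha> \<beta>] by auto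
      fix \<beta> assume "\<beta> \<in> dm r"
      then obtain b where b: "b \<in> dm q" "finite {\<alpha> \<in> dm q. cl r \<alpha> \<beta> \<noteq> cl q \<alpha> b}"
        using leD(5)[OF rq] by blast
      obtain b' where b': "b' \<in> dm p" "finite {\<alpha> \<in> dm p. cl q \<alpha> b \<noteq> cl p \<alpha> b'}"
        using leD(5)[OF qp b(1)] by blast
      have "{\<alpha> \<in> dm p. cl r \<alpha> \<beta> \<noteq> cl p \<alpha> b'} \<subseteq>
          {\<alpha> \<in> dm q. cl r \<alpha> \<beta> \<noteq> cl q \<alpha> b} \<union> {\<alpha> \<in> dm p. cl q \<alpha> b \<noteq> cl p \<alpha> b'}"
        using leD(3)[OF qp] by auto
      then show "\<exists>b\<in>dm p. finite {\<alpha> \<in> dm p. cl r \<alpha> \<beta> \<noteq> cl p \<alpha> b}"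
        using b b' finite_subset by blast
    qed (use leD rq qp in blast)+
  qed
qed

sublocale forcing P le
  by unfold_locales (rule partial_order)

lemma P_nonempty: "P \<noteq> {}"
proof -
  obtain k where "k \<in> K" using K_nonempty by blast
  then have "is_colouring K C x1 {k} (\<lambda>_ _. x1)" by (simp add: is_colouring_def)
  then show ?thesis using ex_cond by blast
qed

text \<open>The union of the chain works because the type condition concerns one point at a time:
  each point of the union appears at some stage, and comparing a late enough stage with
  \<open>f n\<close> supplies the old point required.\<close>

lemma sigma: "sigma_complete P le"
  unfolding sigma_complete_def
proof (intro allI impI, elim conjE)
  fix f :: "nat \<Rightarrow> 'p" assume fP: "range f \<subseteq> P" and dec: "\<forall>n. (f (Suc n), f n) \<in> le"
  have fP': "f n \<in> P" for n using fP by auto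
  have mono: "(f m, f n) \<in> le" if "n \<le> m" for m n
    using that
  proof (induction m rule: dec_induct)
    case base
    show ?case using le_refl fP' by blast
  next
    case (step m)
    then show ?case using dec le_trans by blast
  qed
  define a where "a = (\<Union>n. dm (f n))"
  define g where "g \<alpha> \<beta> = cl (f (LEAST n. \<alpha> \<in> dm (f n) \<and> \<beta> \<in> dm (f n))) \<alpha> \<beta>" for \<alpha> \<beta>
  have g: "g \<alpha> \<beta> = cl (f n) \<alpha> \<beta>" if "\<alpha> \<in> dm (f n)" "\<beta> \<in> dm (f n)" for \<alpha> \<beta> n
  proof -
    let ?m = "LEAST n. \<alpha> \<in> dm (f n) \<and> \<beta> \<in> dm (f n)"
    have m: "\<alpha> \<in> dm (f ?m)" "\<beta> \<in> dm (f ?m)" "?m \<le> n"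
      using LeastI[of "\<lambda>n. \<alpha> \<in> dm (f n) \<and> \<beta> \<in> dm (f n)" n]
        Least_le[of "\<lambda>n. \<alpha> \<in> dm (f n) \<and> \<beta> \<in> dm (f n)" n] that by auto
    then show ?thesis using leD(4)[OF mono[OF m(3)]] unfolding g_def by auto
  qed
  have two: "\<exists>n. \<alpha> \<in> dm (f n) \<and> \<beta> \<in> dm (f n)" if ab: "\<alpha> \<in> a" "\<beta> \<in> a" for \<alpha> \<beta>
  proof -
    obtain m n where "\<alpha> \<in> dm (f m)" "\<beta> \<in> dm (f n)" using ab unfolding a_def by blast
    then have "\<alpha> \<in> dm (f (max m n))" "\<beta> \<in> dm (f (max m n))"
      using leD(3)[OF mono[of m "max m n"]] leD(3)[OF mono[of n "max m n"]] by auto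
    then show ?thesis by blast
  qed
  have "is_colouring K C x1 a g"
    unfolding is_colouring_def
  proof (intro conjI ballI impI)
    show "a \<subseteq> K" "countable a" "a \<noteq> {}" using condD(1-3)[OF fP'] unfolding a_def by auto
  next
    fix \<alpha> assume "\<alpha> \<in> a"
    then obtain n where "\<alpha> \<in> dm (f n)" unfolding a_def by blast
    then show "g \<alpha> \<alpha> = x1" using g condD(4)[OF fP'] by auto
  next
    fix \<alpha> \<beta> assume "\<alpha> \<in> a" "\<beta> \<in> a" and ne: "\<alpha> \<noteq> \<beta>"
    then obtain n where n: "\<alpha> \<in> dm (f n)" "\<beta> \<in> dm (f n)" using two by blast
    then show "g \<alpha> \<beta> \<in> C" using g condD(5)[OF fP' n ne] by simp
    show "g \<alpha> \<beta> = g \<beta> \<alpha>" using g n condD(6)[OF fP' n] by simp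
  qed
  from ex_cond[OF this] obtain q where q: "q \<in> P" "dm q = a" "\<And>\<alpha> \<beta>. \<alpha> \<in> a \<Longrightarrow> \<beta> \<in> a \<Longrightarrow> cl q \<alpha> \<beta> = g \<alpha> \<beta>"
    by blast
  have "(q, f n) \<in> le" for n
  proof (rule leI[OF fP' q(1)])
    show sub: "dm (f n) \<subseteq> dm q" unfolding q(2) a_def by blast
    show "cl q \<alpha> \<beta> = cl (f n) \<alpha> \<beta>" if "\<alpha> \<in> dm (f n)" "\<beta> \<in> dm (f n)" for \<alpha> \<beta>
      using q(3)[of \<alpha> \<beta>] g[OF that] that sub q(2) by auto
    fix \<beta> assume "\<beta> \<in> dm q"
    then obtain k where k: "\<beta> \<in> dm (f k)" using q(2) unfolding a_def by blast
    let ?m = "max k n"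
    have m: "\<beta> \<in> dm (f ?m)" "dm (f n) \<subseteq> dm (f ?m)" "dm (f ?m) \<subseteq> a"
      using k leD(3)[OF mono[of k ?m]] leD(3)[OF mono[of n ?m]] unfolding a_def by auto
    obtain b where b: "b \<in> dm (f n)" "finite {\<alpha> \<in> dm (f n). cl (f ?m) \<alpha> \<beta> \<noteq> cl (f n) \<alpha> b}"
      using leD(5)[OF mono[of n ?m] m(1)] by auto
    have "cl q \<alpha> \<beta> = cl (f ?m) \<alpha> \<beta>" if "\<alpha> \<in> dm (f n)" for \<alpha>
    proof -
      have "\<alpha> \<in> dm (f ?m)" using m(2) that by blast
      moreover from this have "\<alpha> \<in> a" "\<beta> \<in> a" using m by auto
      ultimately show ?thesis using q(3)[of \<alpha> \<beta>] g[of \<alpha> ?m \<beta>] m(1) by simp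
    qed
    then have "{\<alpha> \<in> dm (f n). cl q \<alpha> \<beta> \<noteq> cl (f n) \<alpha> b} = {\<alpha> \<in> dm (f n). cl (f ?m) \<alpha> \<beta> \<noteq> cl (f n) \<alpha> b}"
      by auto
    then show "\<exists>b\<in>dm (f n). finite {\<alpha> \<in> dm (f n). cl q \<alpha> \<beta> \<noteq> cl (f n) \<alpha> b}"
      using b by (intro bexI[of _ b]) simp_all
  qed
  then show "\<exists>q\<in>P. \<forall>n. (q, f n) \<in> le" using q(1) by blast
qed

text \<open>
  A pair \<open>\<gamma> \<in> dm q0\<close>, \<open>\<delta> \<in> dm q2\<close> gets the colour of \<open>\<pi> \<gamma>\<close> and \<open>\<delta>\<close> in \<open>q2\<close>, with the exception
  of \<open>\<alpha>0, \<beta>0\<close>. Then \<open>\<gamma>\<close> has the type of \<open>\<pi> \<gamma>\<close> over \<open>dm q2\<close>, and \<open>\<delta>\<close> over \<open>dm q0\<close> has the type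
  of a point whose copy in \<open>q1\<close> has the type of \<open>\<delta>\<close> over \<open>dm q1\<close>.
\<close>

lemma amalgamation:
  assumes q0: "q0 \<in> P" and q21: "(q2, q1) \<in> le" and c: "c \<in> C"
    and \<pi>: "\<pi> ` dm q0 = dm q1" "\<And>\<alpha> \<beta>. \<alpha> \<in> dm q0 \<Longrightarrow> \<beta> \<in> dm q0 \<Longrightarrow> cl q1 (\<pi> \<alpha>) (\<pi> \<beta>) = cl q0 \<alpha> \<beta>"
    and fix\<pi>: "\<And>\<alpha>. \<alpha> \<in> dm q0 \<Longrightarrow> \<alpha> \<in> dm q2 \<Longrightarrow> \<pi> \<alpha> = \<alpha>"
  shows "\<exists>r. (r, q0) \<in> le \<and> (r, q2) \<in> le \<and>
    (\<alpha>0 \<in> dm q2 - dm q0 \<longrightarrow> \<beta>0 \<in> dm q0 - dm q2 \<longrightarrow> cl r \<alpha>0 \<beta>0 = c)"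
proof -
  note q1 = leD(1)[OF q21] and q2 = leD(2)[OF q21]
  have \<pi>1: "\<pi> \<gamma> \<in> dm q1" "\<pi> \<gamma> \<in> dm q2" if "\<gamma> \<in> dm q0" for \<gamma>
    using that \<pi>(1) leD(3)[OF q21] by auto
  \<comment> \<open>A diagonal colour can only come from equal points, so \<pi> is injective. This
    is needed to pull a finite exceptional set back along \<pi>.\<close>
  have inj: "inj_on \<pi> (dm q0)"
  proof (rule inj_onI)
    fix \<gamma> \<delta> assume gd: "\<gamma> \<in> dm q0" "\<delta> \<in> dm q0" and "\<pi> \<gamma> = \<pi> \<delta>"
    then have "cl q0 \<gamma> \<delta> = x1" using \<pi>(2)[OF gd] condD(4)[OF q1] \<pi>1 by auto
    then show "\<gamma> = \<delta>" using cl_eq_x1[OF q0 gd] by blast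
  qed
  have agree: "cl q0 \<gamma> \<delta> = cl q2 (\<pi> \<gamma>) (\<pi> \<delta>)" if "\<gamma> \<in> dm q0" "\<delta> \<in> dm q0" for \<gamma> \<delta>
    using \<pi>(2)[OF that] leD(4)[OF q21] \<pi>1 that by auto
  \<comment> \<open>Copying would give the pair \<gamma>, \<delta> with \<pi> \<gamma> = \<delta>
    the diagonal value, which is not a colour; c takes its place. For fixed \<gamma> or fixed
    \<delta> this happens at most once, so it is a finite error.\<close>
  define h where "h \<gamma> \<delta> = (if \<gamma> = \<beta>0 \<and> \<delta> = \<alpha>0 \<or> \<pi> \<gamma> = \<delta> then c else cl q2 (\<pi> \<gamma>) \<delta>)" for \<gamma> \<delta>
  define g where "g \<gamma> \<delta> = (if \<gamma> \<in> dm q2 \<and> \<delta> \<in> dm q2 then cl q2 \<gamma> \<delta>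
      else if \<gamma> \<in> dm q0 \<and> \<delta> \<in> dm q0 then cl q0 \<gamma> \<delta>
      else if \<gamma> \<in> dm q0 then h \<gamma> \<delta> else h \<delta> \<gamma>)" for \<gamma> \<delta>
  let ?a = "dm q0 \<union> dm q2"
  have hC: "h \<gamma> \<delta> \<in> C" if "\<gamma> \<in> dm q0" "\<delta> \<in> dm q2" for \<gamma> \<delta>
    using c condD(5)[OF q2] \<pi>1 that by (auto simp: h_def)
  have g0: "g \<gamma> \<delta> = cl q0 \<gamma> \<delta>" if "\<gamma> \<in> dm q0" "\<delta> \<in> dm q0" for \<gamma> \<delta>
    using agree that fix\<pi> by (auto simp: g_def)
  have g2: "g \<gamma> \<delta> = cl q2 \<gamma> \<delta>" if "\<gamma> \<in> dm q2" "\<delta> \<in> dm q2" for \<gamma> \<delta>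
    using that by (auto simp: g_def)
  have g02: "g \<gamma> \<delta> = h \<gamma> \<delta>" "g \<delta> \<gamma> = h \<gamma> \<delta>" if "\<gamma> \<in> dm q0 - dm q2" "\<delta> \<in> dm q2 - dm q0" for \<gamma> \<delta>
    using that by (auto simp: g_def)
  have cases: "P \<gamma> \<delta>"
    if "\<gamma> \<in> ?a" "\<delta> \<in> ?a" "\<And>\<gamma> \<delta>. \<gamma> \<in> dm q0 \<Longrightarrow> \<delta> \<in> dm q0 \<Longrightarrow> P \<gamma> \<delta>" "\<And>\<gamma> \<delta>. \<gamma> \<in> dm q2 \<Longrightarrow> \<delta> \<in> dm q2 \<Longrightarrow> P \<gamma> \<delta>"
      "\<And>\<gamma> \<delta>. \<gamma> \<in> dm q0 - dm q2 \<Longrightarrow> \<delta> \<in> dm q2 - dm q0 \<Longrightarrow> P \<gamma> \<delta> \<and> P \<delta> \<gamma>" for P \<gamma> \<delta>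
    using that by blast
  have "is_colouring K C x1 ?a g"
    unfolding is_colouring_def
  proof (intro conjI ballI impI)
    show "?a \<subseteq> K" "countable ?a" "?a \<noteq> {}" using condD(1-3)[OF q0] condD(1-3)[OF q2] by auto
    show "g \<alpha> \<alpha> = x1" if "\<alpha> \<in> ?a" for \<alpha>
      using that g0 g2 condD(4)[OF q0] condD(4)[OF q2] by auto
  next
    fix \<alpha> \<beta> assume ab: "\<alpha> \<in> ?a" "\<beta> \<in> ?a" and ne: "\<alpha> \<noteq> \<beta>"
    have "\<alpha> \<noteq> \<beta> \<longrightarrow> g \<alpha> \<beta> \<in> C \<and> g \<alpha> \<beta> = g \<beta> \<alpha>"
      using ab
    proof (rule cases)
      show "\<gamma> \<noteq> \<delta> \<longrightarrow> g \<gamma> \<delta> \<in> C \<and> g \<gamma> \<delta> = g \<delta> \<gamma>" if "\<gamma> \<in> dm q0" "\<delta> \<in> dm q0" for \<gamma> \<delta>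
        using that g0 condD(5,6)[OF q0] by auto
      show "\<gamma> \<noteq> \<delta> \<longrightarrow> g \<gamma> \<delta> \<in> C \<and> g \<gamma> \<delta> = g \<delta> \<gamma>" if "\<gamma> \<in> dm q2" "\<delta> \<in> dm q2" for \<gamma> \<delta>
        using that g2 condD(5,6)[OF q2] by auto
      show "(\<gamma> \<noteq> \<delta> \<longrightarrow> g \<gamma> \<delta> \<in> C \<and> g \<gamma> \<delta> = g \<delta> \<gamma>) \<and> (\<delta> \<noteq> \<gamma> \<longrightarrow> g \<delta> \<gamma> \<in> C \<and> g \<delta> \<gamma> = g \<gamma> \<delta>)"
        if "\<gamma> \<in> dm q0 - dm q2" "\<delta> \<in> dm q2 - dm q0" for \<gamma> \<delta>
        using g02[OF that] hC[of \<gamma> \<delta>] that by auto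
    qed
    then show "g \<alpha> \<beta> \<in> C" "g \<alpha> \<beta> = g \<beta> \<alpha>" using ne by auto
  qed
  from ex_cond[OF this] obtain r where r: "r \<in> P" "dm r = ?a"
    "\<And>\<alpha> \<beta>. \<alpha> \<in> ?a \<Longrightarrow> \<beta> \<in> ?a \<Longrightarrow> cl r \<alpha> \<beta> = g \<alpha> \<beta>"
    by blast
  have "(r, q2) \<in> le"
  proof (rule leI[OF q2 r(1)])
    fix \<beta> assume "\<beta> \<in> dm r" "\<beta> \<notin> dm q2"
    then have \<beta>: "\<beta> \<in> dm q0 - dm q2" using r(2) by blast
    have "{\<alpha> \<in> dm q2. cl r \<alpha> \<beta> \<noteq> cl q2 \<alpha> (\<pi> \<beta>)} \<subseteq> {\<alpha>0, \<pi> \<beta>}"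
    proof
      fix \<alpha> assume "\<alpha> \<in> {\<alpha> \<in> dm q2. cl r \<alpha> \<beta> \<noteq> cl q2 \<alpha> (\<pi> \<beta>)}"
      then have \<alpha>: "\<alpha> \<in> dm q2" "g \<alpha> \<beta> \<noteq> cl q2 \<alpha> (\<pi> \<beta>)" using r \<beta> by auto
      have "\<alpha> \<notin> dm q0" using \<alpha> \<beta> g0[of \<alpha> \<beta>] agree[of \<alpha> \<beta>] fix\<pi> by auto
      then have "h \<beta> \<alpha> \<noteq> cl q2 \<alpha> (\<pi> \<beta>)" using g02[OF \<beta>, of \<alpha>] \<alpha> by auto
      then show "\<alpha> \<in> {\<alpha>0, \<pi> \<beta>}"
        using condD(6)[OF q2, of \<alpha> "\<pi> \<beta>"] \<alpha> \<beta> \<pi>1 by (auto simp: h_def split: if_splits)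
    qed
    then show "\<exists>b\<in>dm q2. finite {\<alpha> \<in> dm q2. cl r \<alpha> \<beta> \<noteq> cl q2 \<alpha> b}"
      using \<beta> \<pi>1 finite_subset by blast
  qed (use r g2 in auto)
  moreover have "(r, q0) \<in> le"
  proof (rule leI[OF q0 r(1)])
    fix \<beta> assume "\<beta> \<in> dm r" "\<beta> \<notin> dm q0"
    then have \<beta>: "\<beta> \<in> dm q2 - dm q0" using r(2) by blast
    obtain b1 where b1: "b1 \<in> dm q1" "finite {\<alpha> \<in> dm q1. cl q2 \<alpha> \<beta> \<noteq> cl q1 \<alpha> b1}" (is "finite ?E")
      using leD(5)[OF q21] \<beta> by blast
    obtain b where b: "b \<in> dm q0" "\<pi> b = b1" using b1(1)[folded \<pi>(1)] by auto
    \<comment> \<open>There are three sources of disagreement with b: the exceptions that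
      \<open>q2\<close> already makes over \<open>q1\<close>, moved along \<pi>; the point whose
      copy is \<beta>; and the altered pair.\<close>
    have "{\<alpha> \<in> dm q0. cl r \<alpha> \<beta> \<noteq> cl q0 \<alpha> b} \<subseteq> {\<alpha> \<in> dm q0. \<pi> \<alpha> \<in> insert \<beta> ?E} \<union> {\<beta>0}"
    proof
      fix \<alpha> assume "\<alpha> \<in> {\<alpha> \<in> dm q0. cl r \<alpha> \<beta> \<noteq> cl q0 \<alpha> b}"
      then have \<alpha>: "\<alpha> \<in> dm q0" "g \<alpha> \<beta> \<noteq> cl q1 (\<pi> \<alpha>) b1" using r \<beta> \<pi>(2) b by auto
      show "\<alpha> \<in> {\<alpha> \<in> dm q0. \<pi> \<alpha> \<in> insert \<beta> ?E} \<union> {\<beta>0}"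
      proof (cases "\<alpha> \<in> dm q2")
        case True
        then show ?thesis using \<alpha> \<beta> g2[of \<alpha> \<beta>] fix\<pi> \<pi>1[of \<alpha>] by auto
      next
        case False
        then have "h \<alpha> \<beta> \<noteq> cl q1 (\<pi> \<alpha>) b1" using g02[of \<alpha> \<beta>] \<alpha> \<beta> by auto
        then show ?thesis using \<alpha> \<pi>1[of \<alpha>] by (auto simp: h_def split: if_splits)
      qed
    qed
    moreover have "finite {\<alpha> \<in> dm q0. \<pi> \<alpha> \<in> insert \<beta> ?E}"
      using finite_vimage_IntI[OF _ inj, of "insert \<beta> ?E"] b1(2)
      by (auto simp: vimage_def Int_def conj_commute)
    ultimately show "\<exists>b\<in>dm q0. finite {\<alpha> \<in> dm q0. cl r \<alpha> \<beta> \<noteq> cl q0 \<alpha> b}"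
      using b finite_subset by (metis (no_types, lifting) finite.emptyI finite.insertI finite_UnI)
  qed (use r g0 in auto)
  moreover have "cl r \<alpha>0 \<beta>0 = c" if "\<alpha>0 \<in> dm q2 - dm q0" "\<beta>0 \<in> dm q0 - dm q2"
    using that r g02[of \<beta>0 \<alpha>0] by (auto simp: h_def)
  ultimately show ?thesis by blast
qed

text \<open>The new point copies the type of some old b. Only at b itself must the diagonal value be
  replaced by a colour, which costs one exception.\<close>

lemma extend:
  assumes p: "p \<in> P" and k: "k \<in> K"
  shows "\<exists>q. (q, p) \<in> le \<and> k \<in> dm q"
proof (cases "k \<in> dm p")
  case True
  then show ?thesis using le_refl p by blast
next
  case False
  obtain c where c: "c \<in> C" using C_nonempty by blast
  obtain b where b: "b \<in> dm p" using condD(3)[OF p] by blast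
  define h where "h \<alpha> = (if \<alpha> = b then c else cl p \<alpha> b)" for \<alpha>
  define g where "g \<alpha> \<beta> = (if \<alpha> = k then if \<beta> = k then x1 else h \<beta> else if \<beta> = k then h \<alpha> else cl p \<alpha> \<beta>)" for \<alpha> \<beta>
  have h: "h \<alpha> \<in> C" if "\<alpha> \<in> dm p" for \<alpha> using that b c condD(5)[OF p] by (auto simp: h_def)
  have "is_colouring K C x1 (insert k (dm p)) g"
    using k condD[OF p] h by (auto simp: is_colouring_def g_def)
  from ex_cond[OF this] obtain q where q: "q \<in> P" "dm q = insert k (dm p)"
    "\<And>\<alpha> \<beta>. \<alpha> \<in> insert k (dm p) \<Longrightarrow> \<beta> \<in> insert k (dm p) \<Longrightarrow> cl q \<alpha> \<beta> = g \<alpha> \<beta>"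
    by blast
  have "(q, p) \<in> le"
  proof (rule leI[OF p q(1)])
    show "cl q \<alpha> \<beta> = cl p \<alpha> \<beta>" if "\<alpha> \<in> dm p" "\<beta> \<in> dm p" for \<alpha> \<beta>
      using that q(3)[of \<alpha> \<beta>] False by (auto simp: g_def)
    fix \<beta> assume "\<beta> \<in> dm q" "\<beta> \<notin> dm p"
    then have [simp]: "\<beta> = k" using q(2) by simp
    have "cl q \<alpha> \<beta> = h \<alpha>" if "\<alpha> \<in> dm p" for \<alpha>
      using q(3)[of \<alpha> k] that False by (auto simp: g_def)
    then have "{\<alpha> \<in> dm p. cl q \<alpha> \<beta> \<noteq> cl p \<alpha> b} \<subseteq> {b}"
      by (auto simp: h_def split: if_splits)
    then show "\<exists>b\<in>dm p. finite {\<alpha> \<in> dm p. cl q \<alpha> \<beta> \<noteq> cl p \<alpha> b}"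
      using b finite_subset by blast
  qed (use q in auto)
  then show ?thesis using q by blast
qed

text \<open>Points and colour table form one countable sequence, so a single \<Delta>-system
  argument controls both the common points and the isomorphism type. Enumerations of finite domains
  repeat points.\<close>

definition code :: "'p \<Rightarrow> nat + nat \<times> nat \<Rightarrow> 'a" where
  "code p = case_sum (from_nat_into (dm p)) (\<lambda>(m, n). cl p (from_nat_into (dm p) m) (from_nat_into (dm p) n))"

lemma code_simps [simp]:
  "code p (Inl n) = from_nat_into (dm p) n"
  "code p (Inr (m, n)) = cl p (code p (Inl m)) (code p (Inl n))"
  by (simp_all add: code_def)

lemma code_dm: "p \<in> P \<Longrightarrow> code p (Inl n) \<in> dm p"
  using condD(3) by (simp add: from_nat_into)

lemma code_onto: "p \<in> P \<Longrightarrow> \<alpha> \<in> dm p \<Longrightarrow> \<exists>n. code p (Inl n) = \<alpha>"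
  using from_nat_into_surj[OF condD(2)] by simp

lemma code_colour: "p \<in> P \<Longrightarrow> code p (Inr mn) \<in> insert x1 C"
  using condD(4,5) code_dm by (cases mn) (metis code_simps(2) insert_iff)

lemma inj_code: "inj_on code P"
proof (rule inj_onI)
  fix p q assume p: "p \<in> P" and q: "q \<in> P" and eq: "code p = code q"
  have dm: "dm r = range (\<lambda>n. code r (Inl n))" if "r \<in> P" for r
    using code_dm[OF that] code_onto[OF that] by blast
  show "p = q"
  proof (rule cond_eqI[OF p q])
    show "dm p = dm q" by (simp only: dm[OF p] dm[OF q] eq)
    show "\<forall>\<alpha>\<in>dm p. \<forall>\<beta>\<in>dm p. cl p \<alpha> \<beta> = cl q \<alpha> \<beta>"
      using code_onto[OF p] code_simps(2) eq by metis
  qed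
qed

text \<open>A \<Delta>-system argument on codes. All colours lie in the small set
  \<open>insert x1 C\<close>, which puts every colour coordinate into the root: the members found
  are then isomorphic to \<open>t0\<close> along their enumerations and agree with it on the root
  points. The remaining points, \<beta> among them, avoid \<open>dm q\<close>. Since q ranges over
  all extensions of \<open>t0\<close>, information can be decided in q before the copy t is
  chosen.\<close>

lemma twins:
  assumes CH "small C" and I: "\<And>t \<beta>. (t, \<beta>) \<in> I \<Longrightarrow> t \<in> P \<and> \<beta> \<in> dm t"
    and esc: "\<And>S. small S \<Longrightarrow> \<exists>(t, \<beta>)\<in>I. \<beta> \<notin> S"
  shows "\<exists>t0\<in>fst ` I. \<forall>q c. (q, t0) \<in> le \<longrightarrow> c \<in> C \<longrightarrow>
    (\<exists>(t, \<beta>)\<in>I. \<beta> \<notin> dm q \<and> dm t \<inter> dm q \<subseteq> dm t0 \<and> (\<forall>\<alpha>. \<exists>r. (r, t) \<in> le \<and> (r, q) \<in> le \<and>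
      (\<alpha> \<in> dm q - dm t \<longrightarrow> cl r \<alpha> \<beta> = c)))"
proof -
  \<comment> \<open>The distinguished point \<beta> becomes the coordinate \<open>None\<close>,
    which the \<Delta>-system lemma is asked to keep outside the root.\<close>
  define e where "e = (\<lambda>(t, \<beta>). case_option \<beta> (code t))"
  let ?W = "insert x1 C"
  have W: "small ?W" using small_Un[OF countable_small[of "{x1}"] \<open>small C\<close>] by simp
  have "\<exists>i\<in>I. e i None \<notin> S" if "small S" for S
    using esc[OF that] unfolding e_def by force
  from delta_system[where e = e, OF \<open>CH\<close> W this] obtain i N where i: "i \<in> I" and N: "None \<notin> N"
    and NW: "\<And>n. e i n \<in> ?W \<Longrightarrow> n \<in> N"
    and move: "\<And>Z. small Z \<Longrightarrow> \<exists>j\<in>I. (\<forall>n\<in>N. e j n = e i n) \<and> (\<forall>n. n \<notin> N \<longrightarrow> e j n \<notin> Z)"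
    by metis
  obtain t0 \<beta>0 where t0: "i = (t0, \<beta>0)" by (cases i)
  have t0P: "t0 \<in> P" using I i t0 by blast
  have "\<exists>(t, \<beta>)\<in>I. \<beta> \<notin> dm q \<and> dm t \<inter> dm q \<subseteq> dm t0 \<and> (\<forall>\<alpha>. \<exists>r. (r, t) \<in> le \<and> (r, q) \<in> le \<and>
      (\<alpha> \<in> dm q - dm t \<longrightarrow> cl r \<alpha> \<beta> = c))" if q: "(q, t0) \<in> le" and c: "c \<in> C" for q c
  proof -
    have "small (dm q)" using condD(2) leD(2)[OF q] countable_small by blast
    from move[OF this] obtain j where j: "j \<in> I" "\<And>n. n \<in> N \<Longrightarrow> e j n = e i n"
      "\<And>n. n \<notin> N \<Longrightarrow> e j n \<notin> dm q" by blast
    obtain t \<beta> where t: "j = (t, \<beta>)" by (cases j)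
    have tP: "t \<in> P" "\<beta> \<in> dm t" using I j t by blast+
    have \<beta>: "\<beta> \<notin> dm q" using j(3)[OF N] t by (simp add: e_def)
    define u v where "u n = code t (Inl n)" and "v n = code t0 (Inl n)" for n
    have u: "u n \<in> dm t" "v n \<in> dm t0" for n
      unfolding u_def v_def using code_dm tP t0P by blast+
    have iso: "cl t (u m) (u n) = cl t0 (v m) (v n)" for m n
    proof -
      have "Some (Inr (m, n)) \<in> N"
        using NW code_colour[OF t0P, of "(m, n)"] by (auto simp: e_def t0)
      from j(2)[OF this] show ?thesis by (simp add: e_def t t0 u_def v_def)
    qed
    have uv: "u m = u n \<longleftrightarrow> v m = v n" for m n
      using iso[of m n] cl_eq_x1[OF tP(1) u(1) u(1)] cl_eq_x1[OF t0P u(2) u(2)] by metis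
    \<comment> \<open>Any index of \<alpha> may be chosen: by \<open>uv\<close> the two enumerations
      repeat points at the same places.\<close>
    define \<pi> where "\<pi> \<alpha> = v (SOME n. u n = \<alpha>)" for \<alpha>
    have \<pi>: "\<pi> (u n) = v n" for n
      unfolding \<pi>_def using uv by (metis (mono_tags, lifting) someI)
    have ut: "dm t = range u" and v0: "dm t0 = range v"
      using u code_onto[OF tP(1)] code_onto[OF t0P] unfolding u_def v_def by blast+
    have fix\<pi>: "\<pi> \<alpha> = \<alpha>" if \<alpha>: "\<alpha> \<in> dm t" "\<alpha> \<in> dm q" for \<alpha>
    proof -
      obtain n where n: "\<alpha> = u n" using \<alpha>(1) ut by auto
      then have "e j (Some (Inl n)) \<in> dm q" using \<alpha> by (simp add: e_def t u_def)
      then have "Some (Inl n) \<in> N" using j(3) by blast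
      from j(2)[OF this] have "u n = v n" by (simp add: e_def t t0 u_def v_def)
      then show ?thesis using \<pi>[of n] n by simp
    qed
    have im: "\<pi> ` dm t = dm t0" by (simp add: ut v0 image_image \<pi>)
    have "\<exists>r. (r, t) \<in> le \<and> (r, q) \<in> le \<and> (\<alpha> \<in> dm q - dm t \<longrightarrow> cl r \<alpha> \<beta> = c)" for \<alpha>
    proof -
      have "\<exists>r. (r, t) \<in> le \<and> (r, q) \<in> le \<and>
          (\<alpha> \<in> dm q - dm t \<longrightarrow> \<beta> \<in> dm t - dm q \<longrightarrow> cl r \<alpha> \<beta> = c)"
      proof (rule amalgamation[OF tP(1) q c im _ fix\<pi>])
        fix \<gamma> \<delta> assume "\<gamma> \<in> dm t" "\<delta> \<in> dm t"
        then obtain m n where "\<gamma> = u m" "\<delta> = u n" using ut by auto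
        then show "cl t0 (\<pi> \<gamma>) (\<pi> \<delta>) = cl t \<gamma> \<delta>" by (simp only: iso \<pi>)
      qed
      then show ?thesis using tP \<beta> by blast
    qed
    moreover have "dm t \<inter> dm q \<subseteq> dm t0"
    proof
      fix \<alpha> assume "\<alpha> \<in> dm t \<inter> dm q"
      then have "\<pi> \<alpha> = \<alpha>" "\<pi> \<alpha> \<in> dm t0" using fix\<pi>[of \<alpha>] imageI[of \<alpha> "dm t" \<pi>] im by auto
      then show "\<alpha> \<in> dm t0" by simp
    qed
    ultimately show ?thesis
      using j(1) t \<beta> by (intro bexI[of _ "(t, \<beta>)"]) simp_all
  qed
  moreover have "t0 \<in> fst ` I" using i t0 by force
  ultimately show ?thesis by blast
qed

text \<open>Since CH allows only \<omega>1 codes over a small set, the domains of a large antichain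
  cannot all lie in one. Then \<open>twins\<close> with q = \<open>t0\<close> amalgamates two
  members, distinct because \<beta> lies in only one of the domains.\<close>

lemma omega2_cc:
  assumes CH "small C"
  shows "omega2_cc P le"
  unfolding omega2_cc_def
proof (intro allI impI)
  fix A assume A: "antichain_in P le A"
  show "small A"
  proof (rule ccontr)
    assume large: "\<not> small A"
    have AP: "A \<subseteq> P" using A by (simp add: antichain_in_def)
    define I where "I = {(t, \<beta>). t \<in> A \<and> \<beta> \<in> dm t}"
    have "\<exists>(t, \<beta>)\<in>I. \<beta> \<notin> S" if S: "small S" for S
    proof (rule ccontr)
      assume "\<not> ?thesis"
      then have sub: "dm t \<subseteq> S" if "t \<in> A" for t using that by (auto simp: I_def)
      have "code t x \<in> S \<union> ({x1} \<union> C)" if "t \<in> A" for t x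
      proof (cases x)
        case (Inl n)
        then show ?thesis using code_dm[of t n] sub[OF that] AP that by auto
      next
        case (Inr mn)
        then show ?thesis using code_colour[of t mn] AP that by auto
      qed
      then have "code ` A \<subseteq> {s. range s \<subseteq> S \<union> ({x1} \<union> C)}" by blast
      moreover have "small {s :: nat + nat \<times> nat \<Rightarrow> 'a. range s \<subseteq> S \<union> ({x1} \<union> C)}"
        by (intro small_sequences small_Un S countable_small[of "{x1}"] assms) auto
      ultimately have "small (code ` A)" using small_subset by blast
      then show False using small_inj[OF inj_on_subset[OF inj_code AP]] large by blast
    qed
    note esc = this
    have I: "t \<in> P \<and> \<beta> \<in> dm t" if "(t, \<beta>) \<in> I" for t \<beta>
      using that AP by (auto simp: I_def)
    obtain t0 where t0: "t0 \<in> fst ` I" and tw: "\<forall>q c. (q, t0) \<in> le \<longrightarrow> c \<in> C \<longrightarrow>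
        (\<exists>(t, \<beta>)\<in>I. \<beta> \<notin> dm q \<and> dm t \<inter> dm q \<subseteq> dm t0 \<and> (\<forall>\<alpha>. \<exists>r. (r, t) \<in> le \<and> (r, q) \<in> le \<and>
          (\<alpha> \<in> dm q - dm t \<longrightarrow> cl r \<alpha> \<beta> = c)))"
      using twins[OF assms I esc] by blast
    have "t0 \<in> A" using t0 by (auto simp: I_def)
    then have "(t0, t0) \<in> le" using le_refl AP by blast
    moreover obtain c where "c \<in> C" using C_nonempty by blast
    ultimately obtain t \<beta> r where t: "t \<in> A" "\<beta> \<in> dm t" "\<beta> \<notin> dm t0"
      and r: "(r, t) \<in> le" "(r, t0) \<in> le" using tw unfolding I_def by fast
    then have "t \<noteq> t0" by blast
    then show False
      using A t(1) \<open>t0 \<in> A\<close> r leD(2)[OF r(1)]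
      unfolding antichain_in_def pairwise_def compatible_in_def by blast
  qed
qed

end

section \<open>The generic colouring\<close>

text \<open>For \<open>natLeq\<close> and \<open>card_omega1\<close> these are \<omega>1 and
  \<omega>2 as initial segments of \<kappa>.\<close>

definition seg :: "'a rel \<Rightarrow> 'b rel \<Rightarrow> 'a set" where
  "seg \<kappa> r = {x \<in> Field \<kappa>. |underS \<kappa> x| \<le>o r}"

text \<open>The downward closure of \<omega>1 many points of the segment is small. A large segment
  would thus contain a point above all of them, with uncountably many predecessors.\<close>

lemma small_seg:
  assumes wo: "Well_order \<kappa>"
  shows "small (seg \<kappa> natLeq)" (is "small ?W")
proof (rule ccontr)
  assume large: "\<not> small ?W"
  have "card_omega1 \<le>o |?W|"
    using large card_order_on_well_order_on[OF Card_order_omega1] card_of_Well_order ordLeq_total by blast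
  then have "|Field card_omega1| \<le>o |?W|"
    using card_of_Field_ordIso[OF Card_order_omega1] ordIso_ordLeq_trans by blast
  then obtain f where f: "inj_on f (Field card_omega1)" "f ` Field card_omega1 \<subseteq> ?W"
    unfolding card_of_ordLeq[symmetric] by auto
  let ?A = "f ` Field card_omega1"
  have countable: "countable (underS \<kappa> x)" if "x \<in> ?W" for x
    using that by (simp add: seg_def countable_card_le_natLeq)
  have "small ?A"
    by (intro small_image ordIso_imp_ordLeq card_of_Field_ordIso[OF Card_order_omega1])
  moreover have "small (insert x (underS \<kappa> x))" if "x \<in> ?A" for x
    using countable f(2) that by (intro countable_small) auto
  ultimately have "small (\<Union>x\<in>?A. insert x (underS \<kappa> x))" by (rule small_UN)
  then obtain y where y: "y \<in> ?W" "y \<notin> (\<Union>x\<in>?A. insert x (underS \<kappa> x))"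
    using large small_subset by blast
  have "?A \<subseteq> underS \<kappa> y"
  proof
    fix x assume x: "x \<in> ?A"
    then have "x \<in> Field \<kappa>" "y \<in> Field \<kappa>" "x \<noteq> y" "y \<notin> underS \<kappa> x"
      using f(2) y by (auto simp: seg_def)
    then show "x \<in> underS \<kappa> y"
      using wo by (auto simp: well_order_on_def linear_order_on_def total_on_def underS_def)
  qed
  then have "countable ?A" using countable[OF y(1)] countable_subset by blast
  then have "countable (Field card_omega1)" using f(1) countable_image_inj_on by blast
  then have "|Field card_omega1| \<le>o natLeq" by (simp add: countable_card_le_natLeq)
  then have "card_omega1 \<le>o natLeq"
    using card_of_Field_ordIso[OF Card_order_omega1] ordIso_symmetric ordIso_ordLeq_trans by blast
  then show False using cardSuc_greater[OF natLeq_Card_order] not_ordLess_ordLeq by blast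
qed

lemma large_Field:
  assumes "Card_order \<kappa>" "card_omega2 \<le>o \<kappa>"
  shows "\<not> small (Field \<kappa>)"
proof
  assume "small (Field \<kappa>)"
  then have "\<kappa> \<le>o card_omega1"
    using card_of_Field_ordIso[OF assms(1)] ordIso_symmetric ordIso_ordLeq_trans by blast
  then have "card_omega2 \<le>o card_omega1" using assms(2) ordLeq_transitive by blast
  then show False using cardSuc_greater[OF Card_order_omega1] not_ordLess_ordLeq by blast
qed

lemma ex_inj_triple:
  assumes "infinite (UNIV :: 'a set)"
  shows "\<exists>h :: 'a \<times> 'a \<times> 'a \<Rightarrow> 'a. inj h"
proof -
  have "|UNIV :: ('a \<times> 'a) set| \<le>o |UNIV :: 'a set|"
    using card_of_Times_same_infinite[OF assms] by (simp add: ordIso_imp_ordLeq)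
  then obtain h :: "'a \<times> 'a \<Rightarrow> 'a" where "inj h"
    using card_of_ordLeq[of "UNIV :: ('a \<times> 'a) set" "UNIV :: 'a set"] by auto
  then have "h x = h y \<longleftrightarrow> x = y" for x y by (rule inj_eq)
  then have "inj (\<lambda>(a, b, c). h (a, h (b, c)))"
    by (intro injI) (simp split: prod.splits)
  then show ?thesis by blast
qed

section \<open>Deciding elements, pairs and function values in the ground model\<close>

context forcing_ordinal begin

lemma initial_seg: "initial (seg \<kappa> r)"
  unfolding seg_def by (rule initial_card_bound)

lemma seg_large: "\<not> |Field \<kappa>| \<le>o r \<Longrightarrow> \<not> |seg \<kappa> r| \<le>o r"
  unfolding seg_def by (rule not_card_bound)

lemma forces_subset:
  "(p \<tturnstile> subset_fm A B) \<longleftrightarrow> (\<forall>x\<in>names P. \<forall>q. (q, p) \<in> le \<longrightarrow> (q \<tturnstile> x \<^bold>\<in> A) \<longrightarrow> (q \<tturnstile> x \<^bold>\<in> B))"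
  unfolding subset_fm_def forces_ball ..

lemma in_pairsI:
  assumes "\<alpha> \<noteq> \<beta>" "\<alpha> \<in> Field \<kappa>" "\<beta> \<in> Field \<kappa>" "e \<in> names P"
    and "p \<tturnstile> chk \<alpha> \<^bold>\<in> A" "p \<tturnstile> chk \<beta> \<^bold>\<in> B" "p \<tturnstile> e \<^bold>= up (chk \<alpha>) (chk \<beta>)"
  shows "p \<tturnstile> in_pairs_fm e A B"
  unfolding in_pairs_fm_def
proof (rule forces_bexI[OF chk_names assms(5)], rule forces_bexI[OF chk_names assms(6)])
  have "\<not> (q \<tturnstile> chk \<alpha> \<^bold>= chk \<beta>)" if "(q, p) \<in> le" for q
    using chk_eqD[OF _ le_P(1)[OF that]] assms by blast
  then show "p \<tturnstile> \<^bold>\<not> chk \<alpha> \<^bold>= chk \<beta> \<^bold>\<and> upair_fm e (chk \<alpha>) (chk \<beta>)"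
    using assms by (simp add: forces_conj forces_not forces_upair)
qed

text \<open>An element of a set of ordinals is given by an arbitrary name; strengthening replaces it
  by a canonical one, to which the combinatorics of conditions applies.\<close>

lemma mem_sub_ON:
  assumes "p \<tturnstile> subset_fm A (ON W)" "p \<tturnstile> x \<^bold>\<in> A" "x \<in> names P" "p \<in> P"
  shows "\<exists>t. (t, p) \<in> le \<and> (\<exists>\<alpha>\<in>W. (t \<tturnstile> chk \<alpha> \<^bold>\<in> A) \<and> (t \<tturnstile> x \<^bold>= chk \<alpha>))"
proof -
  have "p \<tturnstile> x \<^bold>\<in> ON W" using assms le_refl unfolding forces_subset by blast
  then obtain t \<alpha> where t: "(t, p) \<in> le" "\<alpha> \<in> W" "t \<tturnstile> x \<^bold>= chk \<alpha>"
    using mem_ON_D assms(4) by blast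
  moreover have "t \<tturnstile> chk \<alpha> \<^bold>\<in> A"
    using mem_cong_left[OF forces_mono[OF assms(2) t(1)] t(3)] .
  ultimately show ?thesis by blast
qed

lemma in_pairsD:
  assumes "p \<tturnstile> in_pairs_fm e A B" "p \<tturnstile> subset_fm A (ON (Field \<kappa>))" "p \<tturnstile> subset_fm B (ON (Field \<kappa>))"
    and "e \<in> names P" "p \<in> P"
  shows "\<exists>t \<alpha> \<beta>. (t, p) \<in> le \<and> \<alpha> \<noteq> \<beta> \<and> \<alpha> \<in> Field \<kappa> \<and> \<beta> \<in> Field \<kappa> \<and>
    (t \<tturnstile> chk \<alpha> \<^bold>\<in> A) \<and> (t \<tturnstile> chk \<beta> \<^bold>\<in> B) \<and> (t \<tturnstile> e \<^bold>= up (chk \<alpha>) (chk \<beta>))"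
proof -
  obtain t1 x where t1: "(t1, p) \<in> le" and x: "x \<in> names P" "t1 \<tturnstile> x \<^bold>\<in> A"
    and 1: "t1 \<tturnstile> \<^bold>\<exists>\<beta>\<^bold>\<in>B. \<^bold>\<not> x \<^bold>= \<beta> \<^bold>\<and> upair_fm e x \<beta>"
    using assms(1) le_refl[OF assms(5)] unfolding in_pairs_fm_def forces_bex[of p] by blast
  note t1P = le_P(1)[OF t1]
  obtain t2 y where t2: "(t2, t1) \<in> le" and y: "y \<in> names P" "t2 \<tturnstile> y \<^bold>\<in> B"
    and 2: "t2 \<tturnstile> \<^bold>\<not> x \<^bold>= y" "t2 \<tturnstile> upair_fm e x y"
    using 1 le_refl[OF t1P] unfolding forces_bex forces_conj by blast
  have t2p: "(t2, p) \<in> le" using t1 t2 le_trans by blast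
  note t2P = le_P(1)[OF t2]
  obtain t3 \<alpha> where t3: "(t3, t2) \<in> le" and a: "\<alpha> \<in> Field \<kappa>" "t3 \<tturnstile> chk \<alpha> \<^bold>\<in> A" "t3 \<tturnstile> x \<^bold>= chk \<alpha>"
    using mem_sub_ON[OF forces_mono[OF assms(2) t2p] forces_mono[OF x(2) t2] x(1) t2P] by blast
  have t3p: "(t3, p) \<in> le" using t3 t2p le_trans by blast
  note t3P = le_P(1)[OF t3]
  obtain t4 \<beta> where t4: "(t4, t3) \<in> le" and b: "\<beta> \<in> Field \<kappa>" "t4 \<tturnstile> chk \<beta> \<^bold>\<in> B" "t4 \<tturnstile> y \<^bold>= chk \<beta>"
    using mem_sub_ON[OF forces_mono[OF assms(3) t3p] forces_mono[OF y(2) t3] y(1) t3P] by blast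
  have t4p: "(t4, p) \<in> le" and t42: "(t4, t2) \<in> le" using t3 t4 t3p le_trans by blast+
  have a4: "t4 \<tturnstile> chk \<alpha> \<^bold>\<in> A" "t4 \<tturnstile> x \<^bold>= chk \<alpha>" using a forces_mono[OF _ t4] by blast+
  have "t4 \<tturnstile> upair_fm e x y" using 2(2) t42 by (rule forces_mono)
  then have "t4 \<tturnstile> e \<^bold>= up x y" using x y assms(4) by (simp add: forces_upair)
  moreover have "t4 \<tturnstile> up x y \<^bold>= up (chk \<alpha>) (chk \<beta>)"
    using a4 b x y by (intro up_cong) auto
  ultimately have "t4 \<tturnstile> e \<^bold>= up (chk \<alpha>) (chk \<beta>)" by (rule eq_trans)
  moreover have "\<alpha> \<noteq> \<beta>"
  proof
    assume "\<alpha> = \<beta>"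
    then have "t4 \<tturnstile> x \<^bold>= y" using a4(2) b(3) eq_sym eq_trans by blast
    then show False using 2(1) t42 unfolding forces_not by blast
  qed
  ultimately show ?thesis using t4p a4 a b by blast
qed

lemma bijection_decide:
  assumes "p \<tturnstile> bijection_fm f A (ON W)" "p \<tturnstile> subset_fm A (ON (Field \<kappa>))"
    and "y \<in> W" "f \<in> names P" "p \<in> P"
  shows "\<exists>t. (t, p) \<in> le \<and> (\<exists>\<alpha>\<in>Field \<kappa>. (t \<tturnstile> chk \<alpha> \<^bold>\<in> A) \<and> (t \<tturnstile> op (chk \<alpha>) (chk y) \<^bold>\<in> f))"
proof -
  obtain t x where t: "(t, p) \<in> le" and x: "x \<in> names P" "t \<tturnstile> x \<^bold>\<in> A" "t \<tturnstile> op x (chk y) \<^bold>\<in> f"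
    using bijection_onto[OF assms(1) mem_chk_I[OF assms(3)] assms(5,4) chk_names] by blast
  obtain s \<alpha> where s: "(s, t) \<in> le" and a: "\<alpha> \<in> Field \<kappa>" "s \<tturnstile> chk \<alpha> \<^bold>\<in> A" "s \<tturnstile> x \<^bold>= chk \<alpha>"
    using mem_sub_ON[OF forces_mono[OF assms(2) t] x(2,1) le_P(1)[OF t]] by blast
  have "s \<tturnstile> op (chk \<alpha>) (chk y) \<^bold>\<in> f"
    using mem_cong_left[OF forces_mono[OF x(3) s] op_cong[OF a(3) eq_refl]] x(1) by simp
  then show ?thesis using s t a le_trans by blast
qed

lemma function_decide:
  assumes "p \<tturnstile> function_fm f (ON W) (ON V)" "y \<in> W" "f \<in> names P" "p \<in> P"
  shows "\<exists>t. (t, p) \<in> le \<and> (\<exists>x\<in>V. t \<tturnstile> op (chk y) (chk x) \<^bold>\<in> f)"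
proof -
  obtain t z where t: "(t, p) \<in> le" and z: "z \<in> names P" "t \<tturnstile> op (chk y) z \<^bold>\<in> f"
    using function_total[OF assms(1) mem_chk_I[OF assms(2)] assms(4,3) chk_names] by blast
  have "t \<tturnstile> z \<^bold>\<in> ON V"
    using function_range(2)[OF forces_mono[OF assms(1) t] z(2) assms(3) chk_names z(1)] .
  then obtain s x where s: "(s, t) \<in> le" "x \<in> V" "s \<tturnstile> z \<^bold>= chk x"
    using mem_ON_D le_P(1)[OF t] by blast
  have "s \<tturnstile> op (chk y) (chk x) \<^bold>\<in> f"
    using mem_cong_left[OF forces_mono[OF z(2) s(1)] op_cong[OF eq_refl s(3)]] z(1) by simp
  then show ?thesis using s t le_trans by blast
qed

lemma injection_chk:
  assumes "p \<tturnstile> injection_fm f A B" "p \<tturnstile> op (chk y) (chk x) \<^bold>\<in> f" "p \<tturnstile> op (chk y') (chk x) \<^bold>\<in> f"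
    and "f \<in> names P" "p \<in> P" "y \<in> Field \<kappa>" "y' \<in> Field \<kappa>"
  shows "y = y'"
  using injection_inject[OF assms(1-4) chk_names chk_names chk_names assms(5)] chk_eqD assms(5-7) by blast

lemma function_chk:
  assumes "p \<tturnstile> function_fm f A B" "p \<tturnstile> op (chk x) (chk y) \<^bold>\<in> f" "p \<tturnstile> op (chk x) (chk y') \<^bold>\<in> f"
    and "f \<in> names P" "p \<in> P" "y \<in> Field \<kappa>" "y' \<in> Field \<kappa>"
  shows "y = y'"
  using function_unique[OF assms(1-4) chk_names chk_names chk_names] chk_eqD assms(5-7) by blast

lemma countable_W0: "countable W0"
proof (rule countableI[of "\<lambda>x. card (underS \<kappa> x)"], rule inj_onI)
  have less: "card (underS \<kappa> x) < card (underS \<kappa> y)" if "x \<in> underS \<kappa> y" "y \<in> W0" for x y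
  proof (rule psubset_card_mono)
    show "finite (underS \<kappa> y)" using that by (simp add: W0_def)
    have "x \<notin> underS \<kappa> x" by (simp add: underS_def)
    then show "underS \<kappa> x \<subset> underS \<kappa> y" using underS_trans[OF _ that(1)] that(1) by blast
  qed
  fix x y assume "x \<in> W0" "y \<in> W0" "card (underS \<kappa> x) = card (underS \<kappa> y)"
  moreover from this have "x \<in> underS \<kappa> y \<or> x = y \<or> y \<in> underS \<kappa> x"
    by (intro underS_cases) (simp_all add: W0_def)
  ultimately show "x = y" using less[of x y] less[of y x] by linarith
qed

text \<open>The names \<open>generic\<close> and \<open>pairs\<close> are indexed by three elements
  of 'a and a condition, while a name has room for one element and a condition.\<close>

lemma card_triple: "|UNIV :: (('a \<times> 'a \<times> 'a) \<times> 'p) set| \<le>o |UNIV :: ('a \<times> 'p) set|"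
proof -
  obtain h :: "'a \<times> 'a \<times> 'a \<Rightarrow> 'a" where "inj h"
    using ex_inj_triple[OF infinite_super[OF subset_UNIV infinite_Field]] by blast
  then have "inj (map_prod h (id :: 'p \<Rightarrow> 'p))" by (rule prod.inj_map[OF _ inj_on_id])
  then show ?thesis by (rule card_of_ordLeqI) simp
qed

end

text \<open>The colours are the points of \<omega>1 taken inside \<kappa>, so that vertices and
  colours share one type and one notion of canonical name.\<close>

locale colouring_forcing =
  colouring_poset "Field \<kappa>" "seg \<kappa> natLeq" x1 P dm cl
  for \<kappa> :: "'a rel" and x1 and P :: "'p set" and dm cl +
  assumes CH: CH and card: "Card_order \<kappa>" and omega2_le: "card_omega2 \<le>o \<kappa>"
begin

lemma Field_large: "\<not> small (Field \<kappa>)"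
  by (rule large_Field[OF card omega2_le])

lemma Field_uncountable: "\<not> |Field \<kappa>| \<le>o natLeq"
  using Field_large natLeq_le_omega1 ordLeq_transitive by blast

sublocale forcing_ordinal P le \<kappa>
proof
  show "Well_order \<kappa>" using card card_order_on_well_order_on by blast
  show "infinite (Field \<kappa>)"
    using Field_uncountable countable_finite countable_card_le_natLeq by blast
qed

notation frc ("(_ \<tturnstile> _)" [51, 10] 10)

abbreviation "W1 \<equiv> seg \<kappa> natLeq"
abbreviation "W2 \<equiv> seg \<kappa> card_omega1"

section \<open>The cardinals \<omega>1 and \<omega>2 of the extension\<close>

lemma W1_sub: "W1 \<subseteq> Field \<kappa>" and W2_sub: "W2 \<subseteq> Field \<kappa>" and W0_sub: "W0 \<subseteq> Field \<kappa>"
  by (auto simp: seg_def W0_def)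

lemma W1_uncountable: "\<not> countable W1"
  using seg_large[OF Field_uncountable] by (simp add: countable_card_le_natLeq)

lemma W1_large: "card_omega1 \<le>o |W1|"
proof -
  have "natLeq <o |W1|"
    using seg_large[OF Field_uncountable] not_ordLeq_iff_ordLess natLeq_Well_order card_of_Well_order by blast
  then show ?thesis by (rule cardSuc_least[OF natLeq_Card_order card_of_Card_order])
qed

lemma W1_small: "small W1"
  by (rule small_seg[OF wo])

lemma W2_large: "\<not> small W2"
  by (rule seg_large[OF Field_large])

lemma omega2_cc: "omega2_cc P le"
  by (rule omega2_cc[OF CH W1_small])

text \<open>Read backwards, an injection of \<open>W1\<close> into \<open>W0\<close> is a partial
  function on a countable set with uncountably many values, which \<sigma>-completeness rules
  out.\<close>

lemma card_suc_W1: "p \<tturnstile> card_suc_fm (ON W1) (ON W0)"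
proof (rule card_suc_ON[OF initial_seg initial_W0])
  fix x assume "x \<in> W1"
  moreover have "natLeq \<le>o |W0|" using infinite_W0 infinite_iff_natLeq_ordLeq by blast
  ultimately show "|underS \<kappa> x| \<le>o |W0|" using ordLeq_transitive by (auto simp: seg_def)
next
  fix q assume q: "(q, p) \<in> le"
  show "\<not> (q \<tturnstile> card_le_fm (ON W1) (ON W0))"
  proof
    assume "q \<tturnstile> card_le_fm (ON W1) (ON W0)"
    then obtain r f where r: "(r, q) \<in> le" and f: "f \<in> names P" and inj: "r \<tturnstile> injection_fm f (ON W1) (ON W0)"
      using le_refl[OF le_P(1)[OF q]] unfolding card_le_fm_def forces_ex by blast
    note rP = le_P(1)[OF r]
    have fn: "r \<tturnstile> function_fm f (ON W1) (ON W0)" using inj by (simp add: injection_fm_def forces_conj)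
    have "\<exists>y\<in>W1. \<exists>s. (s, r) \<in> le \<and> (\<forall>t x. (t, s) \<in> le \<longrightarrow> x \<in> W0 \<longrightarrow>
        \<not> (y \<in> W1 \<and> (t \<tturnstile> op (chk y) (chk x) \<^bold>\<in> f)))"
    proof (rule no_countable_cover[OF sigma rP countable_W0 W1_uncountable])
      fix x y q s assume "y \<in> W1 \<and> (q \<tturnstile> op (chk y) (chk x) \<^bold>\<in> f)" "(s, q) \<in> le"
      then show "y \<in> W1 \<and> (s \<tturnstile> op (chk y) (chk x) \<^bold>\<in> f)" using forces_mono by blast
    next
      fix x y y' s assume s: "y \<in> W1 \<and> (s \<tturnstile> op (chk y) (chk x) \<^bold>\<in> f)"
        "y' \<in> W1 \<and> (s \<tturnstile> op (chk y') (chk x) \<^bold>\<in> f)" "s \<in> P" "(s, r) \<in> le"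
      show "y = y'"
        by (rule injection_chk[OF forces_mono[OF inj s(4)] _ _ f s(3)]) (use s W1_sub in auto)
    qed
    then obtain y s where y: "y \<in> W1" and s: "(s, r) \<in> le"
      and no: "\<And>t x. (t, s) \<in> le \<Longrightarrow> x \<in> W0 \<Longrightarrow> \<not> (t \<tturnstile> op (chk y) (chk x) \<^bold>\<in> f)" by blast
    from function_decide[OF forces_mono[OF fn s] y f le_P(1)[OF s]] no show False by blast
  qed
qed

text \<open>One cardinal higher the inverse of the injection has \<omega>1 arguments and more than
  \<omega>1 values; here the chain condition is what excludes it.\<close>

lemma card_suc_W2: "p \<tturnstile> card_suc_fm (ON W2) (ON W1)"
proof (rule card_suc_ON[OF initial_seg initial_seg])
  fix x assume "x \<in> W2"
  then show "|underS \<kappa> x| \<le>o |W1|" using W1_large ordLeq_transitive by (auto simp: seg_def)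
next
  fix q assume q: "(q, p) \<in> le"
  show "\<not> (q \<tturnstile> card_le_fm (ON W2) (ON W1))"
  proof
    assume "q \<tturnstile> card_le_fm (ON W2) (ON W1)"
    then obtain r f where r: "(r, q) \<in> le" and f: "f \<in> names P" and inj: "r \<tturnstile> injection_fm f (ON W2) (ON W1)"
      using le_refl[OF le_P(1)[OF q]] unfolding card_le_fm_def forces_ex by blast
    note rP = le_P(1)[OF r]
    have fn: "r \<tturnstile> function_fm f (ON W2) (ON W1)" using inj by (simp add: injection_fm_def forces_conj)
    have "\<exists>y\<in>W2. \<forall>t x. (t, r) \<in> le \<longrightarrow> x \<in> W1 \<longrightarrow>
        \<not> (y \<in> W2 \<and> (t \<tturnstile> op (chk y) (chk x) \<^bold>\<in> f))"
    proof (rule no_small_cover[OF omega2_cc W1_small W2_large])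
      fix x y q s assume "y \<in> W2 \<and> (q \<tturnstile> op (chk y) (chk x) \<^bold>\<in> f)" "(s, q) \<in> le"
      then show "y \<in> W2 \<and> (s \<tturnstile> op (chk y) (chk x) \<^bold>\<in> f)" using forces_mono by blast
    next
      fix x y y' s assume s: "y \<in> W2 \<and> (s \<tturnstile> op (chk y) (chk x) \<^bold>\<in> f)"
        "y' \<in> W2 \<and> (s \<tturnstile> op (chk y') (chk x) \<^bold>\<in> f)" "s \<in> P" "(s, r) \<in> le"
      show "y = y'"
        by (rule injection_chk[OF forces_mono[OF inj s(4)] _ _ f s(3)]) (use s W2_sub in auto)
    qed
    then obtain y where y: "y \<in> W2"
      and no: "\<And>t x. (t, r) \<in> le \<Longrightarrow> x \<in> W1 \<Longrightarrow> \<not> (t \<tturnstile> op (chk y) (chk x) \<^bold>\<in> f)" by blast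
    from function_decide[OF fn y f rP] no show False by blast
  qed
qed

section \<open>The name of the generic colouring and the partition relation\<close>

abbreviation pr :: "'a \<Rightarrow> 'a \<Rightarrow> ('a \<times> 'p, 'p) name" where
  "pr \<alpha> \<beta> \<equiv> up (chk \<alpha>) (chk \<beta>)"

definition generic :: "('a \<times> 'p, 'p) name" where
  "generic = mkname ((\<lambda>(i, r). ((\<lambda>(\<alpha>, \<beta>, \<xi>). op (pr \<alpha> \<beta>) (chk \<xi>)) i, r)) `
     {((\<alpha>, \<beta>, \<xi>), r). r \<in> P \<and> \<alpha> \<in> dm r \<and> \<beta> \<in> dm r \<and> \<alpha> \<noteq> \<beta> \<and> cl r \<alpha> \<beta> = \<xi>})"

lemma card_triple_image: "|f ` (Z :: (('a \<times> 'a \<times> 'a) \<times> 'p) set)| \<le>o |UNIV :: ('a \<times> 'p) set|"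
  using ordLeq_transitive[OF card_of_image ordLeq_transitive[OF card_of_mono1[OF subset_UNIV] card_triple]] .

lemma generic_names [simp]: "generic \<in> names P"
  unfolding generic_def by (rule mkname_names[OF card_triple_image]) auto

lemma elts_generic: "elts generic = (\<lambda>(i, r). ((\<lambda>(\<alpha>, \<beta>, \<xi>). op (pr \<alpha> \<beta>) (chk \<xi>)) i, r)) `
     {((\<alpha>, \<beta>, \<xi>), r). r \<in> P \<and> \<alpha> \<in> dm r \<and> \<beta> \<in> dm r \<and> \<alpha> \<noteq> \<beta> \<and> cl r \<alpha> \<beta> = \<xi>}"
  unfolding generic_def by (rule elts_mkname[OF card_triple_image])

lemma mem_genericD:
  assumes "p \<tturnstile> e \<^bold>\<in> generic" "p \<in> P"
  shows "\<exists>t \<alpha> \<beta>. (t, p) \<in> le \<and> \<alpha> \<in> dm t \<and> \<beta> \<in> dm t \<and> \<alpha> \<noteq> \<beta> \<and> (t \<tturnstile> e \<^bold>= op (pr \<alpha> \<beta>) (chk (cl t \<alpha> \<beta>)))"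
proof -
  obtain t \<alpha> \<beta> r where t: "(t, p) \<in> le" "(t, r) \<in> le" and r: "\<alpha> \<in> dm r" "\<beta> \<in> dm r" "\<alpha> \<noteq> \<beta>"
    and e: "t \<tturnstile> e \<^bold>= op (pr \<alpha> \<beta>) (chk (cl r \<alpha> \<beta>))"
    using assms(1) le_refl[OF assms(2)] unfolding mem_range_name[OF elts_generic] by fastforce
  have "cl t \<alpha> \<beta> = cl r \<alpha> \<beta>" "\<alpha> \<in> dm t" "\<beta> \<in> dm t" using leD(3,4)[OF t(2)] r by auto
  then show ?thesis using t r e by (intro exI[of _ t] exI[of _ \<alpha>] exI[of _ \<beta>]) simp
qed

lemma op_genericD:
  assumes "p \<tturnstile> op e x \<^bold>\<in> generic" "p \<in> P"
  shows "\<exists>t \<alpha> \<beta>. (t, p) \<in> le \<and> \<alpha> \<in> dm t \<and> \<beta> \<in> dm t \<and> \<alpha> \<noteq> \<beta> \<and> (t \<tturnstile> e \<^bold>= pr \<alpha> \<beta>) \<and> (t \<tturnstile> x \<^bold>= chk (cl t \<alpha> \<beta>))"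
proof -
  obtain t \<alpha> \<beta> where t: "(t, p) \<in> le" "\<alpha> \<in> dm t" "\<beta> \<in> dm t" "\<alpha> \<noteq> \<beta>"
    "t \<tturnstile> op e x \<^bold>= op (pr \<alpha> \<beta>) (chk (cl t \<alpha> \<beta>))"
    using mem_genericD[OF assms] by blast
  then show ?thesis using op_inject[OF t(5)] by blast
qed

lemma genericI:
  assumes "t \<in> P" "\<alpha> \<in> dm t" "\<beta> \<in> dm t" "\<alpha> \<noteq> \<beta>"
  shows "t \<tturnstile> op (pr \<alpha> \<beta>) (chk (cl t \<alpha> \<beta>)) \<^bold>\<in> generic"
proof (rule elts_mem[OF _ le_refl[OF assms(1)]])
  show "(op (pr \<alpha> \<beta>) (chk (cl t \<alpha> \<beta>)), t) \<in> elts generic"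
    unfolding elts_generic using assms by (intro image_eqI[of _ _ "((\<alpha>, \<beta>, cl t \<alpha> \<beta>), t)"]) auto
qed

lemma dm_Field: "p \<in> P \<Longrightarrow> \<alpha> \<in> dm p \<Longrightarrow> \<alpha> \<in> Field \<kappa>"
  using condD(1) by blast

lemma cl_W1: "p \<in> P \<Longrightarrow> \<alpha> \<in> dm p \<Longrightarrow> \<beta> \<in> dm p \<Longrightarrow> \<alpha> \<noteq> \<beta> \<Longrightarrow> cl p \<alpha> \<beta> \<in> W1"
  using condD(5) by blast

lemma extend2:
  assumes "p \<in> P" "\<alpha> \<in> Field \<kappa>" "\<beta> \<in> Field \<kappa>"
  shows "\<exists>q. (q, p) \<in> le \<and> \<alpha> \<in> dm q \<and> \<beta> \<in> dm q"
proof -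
  obtain q where q: "(q, p) \<in> le" "\<alpha> \<in> dm q" using extend assms by blast
  obtain r where r: "(r, q) \<in> le" "\<beta> \<in> dm r" using extend le_P(1)[OF q(1)] assms by blast
  then show ?thesis using q leD(3)[OF r(1)] le_trans by blast
qed

text \<open>The idle coordinate \<xi> gives the index set the same type as for
  \<open>generic\<close>, so that \<open>card_triple_image\<close> bounds this name too.\<close>

definition pairs :: "('a \<times> 'p, 'p) name" where
  "pairs = mkname ((\<lambda>(i, r). ((\<lambda>(\<alpha>, \<beta>, \<xi> :: 'a). pr \<alpha> \<beta>) i, r)) `
     {((\<alpha>, \<beta>, \<xi>), r). r \<in> P \<and> \<alpha> \<in> Field \<kappa> \<and> \<beta> \<in> Field \<kappa> \<and> \<alpha> \<noteq> \<beta>})"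

lemma pairs_names [simp]: "pairs \<in> names P"
  unfolding pairs_def by (rule mkname_names[OF card_triple_image]) auto

lemma elts_pairs: "elts pairs = (\<lambda>(i, r). ((\<lambda>(\<alpha>, \<beta>, \<xi> :: 'a). pr \<alpha> \<beta>) i, r)) `
     {((\<alpha>, \<beta>, \<xi>), r). r \<in> P \<and> \<alpha> \<in> Field \<kappa> \<and> \<beta> \<in> Field \<kappa> \<and> \<alpha> \<noteq> \<beta>}"
  unfolding pairs_def by (rule elts_mkname[OF card_triple_image])

lemma mem_pairsD:
  assumes "p \<tturnstile> e \<^bold>\<in> pairs" "p \<in> P"
  shows "\<exists>t \<alpha> \<beta>. (t, p) \<in> le \<and> \<alpha> \<in> Field \<kappa> \<and> \<beta> \<in> Field \<kappa> \<and> \<alpha> \<noteq> \<beta> \<and> (t \<tturnstile> e \<^bold>= pr \<alpha> \<beta>)"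
  using assms(1) le_refl[OF assms(2)] unfolding mem_range_name[OF elts_pairs] by fastforce

lemma pairsI:
  assumes "\<alpha> \<in> Field \<kappa>" "\<beta> \<in> Field \<kappa>" "\<alpha> \<noteq> \<beta>" "p \<tturnstile> e \<^bold>= pr \<alpha> \<beta>" "p \<in> P"
  shows "p \<tturnstile> e \<^bold>\<in> pairs"
proof -
  have "(pr \<alpha> \<beta>, p) \<in> elts pairs"
    unfolding elts_pairs using assms by (intro image_eqI[of _ _ "((\<alpha>, \<beta>, undefined), p)"]) auto
  then have "p \<tturnstile> pr \<alpha> \<beta> \<^bold>\<in> pairs" using le_refl[OF assms(5)] by (rule elts_mem)
  then show ?thesis using eq_sym[OF assms(4)] by (rule mem_cong_left)
qed

abbreviation "K \<equiv> ON (Field \<kappa>)"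

lemma subset_refl_fm: "p \<tturnstile> subset_fm A A"
  by (simp add: forces_subset)

text \<open>Totality is density: by \<open>extend2\<close> any two points enter the domain of some
  extension, which then decides their colour to be an element of \<open>W1\<close>.\<close>

lemma pair_colouring: "p \<tturnstile> pair_colouring_fm generic K (ON W1)"
  unfolding pair_colouring_fm_def
proof (rule forces_exI[OF pairs_names])
  fix q assume "(q, p) \<in> le"
  have "(s \<tturnstile> e \<^bold>\<in> pairs) = (s \<tturnstile> in_pairs_fm e K K)" if s: "(s, q) \<in> le" and e: "e \<in> names P" for s e
  proof
    assume mem: "s \<tturnstile> e \<^bold>\<in> pairs"
    show "s \<tturnstile> in_pairs_fm e K K"
    proof (rule forces_dense)
      fix r assume r: "(r, s) \<in> le"
      obtain t \<alpha> \<beta> where t: "(t, r) \<in> le" "\<alpha> \<in> Field \<kappa>" "\<beta> \<in> Field \<kappa>" "\<alpha> \<noteq> \<beta>" "t \<tturnstile> e \<^bold>= pr \<alpha> \<beta>"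
        using mem_pairsD[OF forces_mono[OF mem r] le_P(1)[OF r]] by blast
      have "t \<tturnstile> in_pairs_fm e K K"
        using in_pairsI[OF t(4,2,3) e mem_chk_I[OF t(2)] mem_chk_I[OF t(3)] t(5)] .
      then show "\<exists>t. (t, r) \<in> le \<and> (t \<tturnstile> in_pairs_fm e K K)" using t by blast
    qed
  next
    assume inp: "s \<tturnstile> in_pairs_fm e K K"
    show "s \<tturnstile> e \<^bold>\<in> pairs"
    proof (rule forces_dense)
      fix r assume r: "(r, s) \<in> le"
      obtain t \<alpha> \<beta> where t: "(t, r) \<in> le" "\<alpha> \<noteq> \<beta>" "\<alpha> \<in> Field \<kappa>" "\<beta> \<in> Field \<kappa>" "t \<tturnstile> e \<^bold>= pr \<alpha> \<beta>"
        using in_pairsD[OF forces_mono[OF inp r] subset_refl_fm subset_refl_fm e le_P(1)[OF r]] by blast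
      then have "t \<tturnstile> e \<^bold>\<in> pairs" using pairsI le_P(1) by blast
      then show "\<exists>t. (t, r) \<in> le \<and> (t \<tturnstile> e \<^bold>\<in> pairs)" using t by blast
    qed
  qed
  then have 1: "q \<tturnstile> \<^bold>\<forall>e. e \<^bold>\<in> pairs \<^bold>\<longleftrightarrow> in_pairs_fm e K K"
    unfolding forces_all forces_iff by blast
  have 2: "q \<tturnstile> \<^bold>\<forall>e\<^bold>\<in>generic. \<^bold>\<exists>x\<^bold>\<in>pairs. \<^bold>\<exists>y\<^bold>\<in>ON W1. opair_fm e x y"
    unfolding forces_ball[of q]
  proof (intro ballI allI impI)
    fix e s assume e: "e \<in> names P" "(s, q) \<in> le" "s \<tturnstile> e \<^bold>\<in> generic"
    show "s \<tturnstile> \<^bold>\<exists>x\<^bold>\<in>pairs. \<^bold>\<exists>y\<^bold>\<in>ON W1. opair_fm e x y"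
    proof (rule forces_dense)
      fix r assume r: "(r, s) \<in> le"
      obtain t \<alpha> \<beta> where t: "(t, r) \<in> le" "\<alpha> \<in> dm t" "\<beta> \<in> dm t" "\<alpha> \<noteq> \<beta>"
        "t \<tturnstile> e \<^bold>= op (pr \<alpha> \<beta>) (chk (cl t \<alpha> \<beta>))"
        using mem_genericD[OF forces_mono[OF e(3) r] le_P(1)[OF r]] by blast
      note tP = le_P(1)[OF t(1)]
      have "t \<tturnstile> \<^bold>\<exists>x\<^bold>\<in>pairs. \<^bold>\<exists>y\<^bold>\<in>ON W1. opair_fm e x y"
      proof (rule forces_bexI[of "pr \<alpha> \<beta>"], simp_all, rule pairsI, goal_cases)
        case 6
        show ?case using t(5) e(1) cl_W1[OF tP t(2-4)]
          by (intro forces_bexI[of "chk (cl t \<alpha> \<beta>)"] mem_chk_I) (auto simp: forces_opair)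
      qed (use t tP dm_Field eq_refl in auto)
      then show "\<exists>t. (t, r) \<in> le \<and> (t \<tturnstile> \<^bold>\<exists>x\<^bold>\<in>pairs. \<^bold>\<exists>y\<^bold>\<in>ON W1. opair_fm e x y)" using t by blast
    qed
  qed
  have 3: "q \<tturnstile> \<^bold>\<forall>x\<^bold>\<in>pairs. \<^bold>\<exists>y. app_fm generic x y \<^bold>\<and> (\<^bold>\<forall>y'. app_fm generic x y' \<^bold>\<longrightarrow> y' \<^bold>= y)"
    unfolding forces_ball[of q]
  proof (intro ballI allI impI)
    fix x s assume x: "x \<in> names P" "(s, q) \<in> le" "s \<tturnstile> x \<^bold>\<in> pairs"
    show "s \<tturnstile> \<^bold>\<exists>y. app_fm generic x y \<^bold>\<and> (\<^bold>\<forall>y'. app_fm generic x y' \<^bold>\<longrightarrow> y' \<^bold>= y)"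
    proof (rule forces_dense)
      fix r assume r: "(r, s) \<in> le"
      obtain t0 \<alpha> \<beta> where t0: "(t0, r) \<in> le" "\<alpha> \<in> Field \<kappa>" "\<beta> \<in> Field \<kappa>" and ne: "\<alpha> \<noteq> \<beta>" and x0: "t0 \<tturnstile> x \<^bold>= pr \<alpha> \<beta>"
        using mem_pairsD[OF forces_mono[OF x(3) r] le_P(1)[OF r]] by blast
      obtain t where t: "(t, t0) \<in> le" "\<alpha> \<in> dm t" "\<beta> \<in> dm t"
        using extend2[OF le_P(1)[OF t0(1)] t0(2,3)] by blast
      note tP = le_P(1)[OF t(1)]
      have xt: "t \<tturnstile> x \<^bold>= pr \<alpha> \<beta>" using x0 t(1) by (rule forces_mono)
      let ?y = "chk (cl t \<alpha> \<beta>)"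
      have "t \<tturnstile> op (pr \<alpha> \<beta>) ?y \<^bold>= op x ?y"
        by (rule op_cong[OF eq_sym[OF xt] eq_refl]) (use x in auto)
      with genericI[OF tP t(2,3) ne] have app: "t \<tturnstile> op x ?y \<^bold>\<in> generic" by (rule mem_cong_left)
      \<comment> \<open>Another value stems from a condition below t that colours the same unordered
        pair. Symmetry takes care of the order of its two points, and coherence along the order
        makes the colour that of t.\<close>
      have uniq: "u \<tturnstile> y' \<^bold>= ?y" if y': "(u, t) \<in> le" "u \<tturnstile> op x y' \<^bold>\<in> generic" for u y'
      proof (rule forces_dense)
        fix v assume v: "(v, u) \<in> le"
        obtain w \<gamma> \<delta> where w: "(w, v) \<in> le" "\<gamma> \<in> dm w" "\<delta> \<in> dm w" "w \<tturnstile> x \<^bold>= pr \<gamma> \<delta>" "w \<tturnstile> y' \<^bold>= chk (cl w \<gamma> \<delta>)"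
          using op_genericD[OF forces_mono[OF y'(2) v] le_P(1)[OF v]] by blast
        note wP = le_P(1)[OF w(1)]
        have wt: "(w, t) \<in> le" using w v y' le_trans by blast
        have ab: "\<alpha> \<in> dm w" "\<beta> \<in> dm w" using leD(3)[OF wt] t by blast+
        have "w \<tturnstile> pr \<alpha> \<beta> \<^bold>= pr \<gamma> \<delta>" using eq_trans[OF eq_sym[OF forces_mono[OF xt wt]] w(4)] .
        then have "\<alpha> = \<gamma> \<and> \<beta> = \<delta> \<or> \<alpha> = \<delta> \<and> \<beta> = \<gamma>"
          using up_chk_inject wP dm_Field[OF wP] ab w(2,3) by blast
        then have "cl w \<gamma> \<delta> = cl w \<alpha> \<beta>" using condD(6)[OF wP w(2,3)] by auto
        also have "\<dots> = cl t \<alpha> \<beta>" by (rule leD(4)[OF wt t(2,3)])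
        finally show "\<exists>w. (w, v) \<in> le \<and> (w \<tturnstile> y' \<^bold>= ?y)" using w by auto
      qed
      have "t \<tturnstile> \<^bold>\<exists>y. app_fm generic x y \<^bold>\<and> (\<^bold>\<forall>y'. app_fm generic x y' \<^bold>\<longrightarrow> y' \<^bold>= y)"
      proof (rule forces_exI[OF chk_names])
        fix u assume u: "(u, t) \<in> le"
        show "u \<tturnstile> app_fm generic x ?y \<^bold>\<and> (\<^bold>\<forall>y'. app_fm generic x y' \<^bold>\<longrightarrow> y' \<^bold>= ?y)"
          unfolding forces_conj forces_all forces_imp
        proof (intro conjI ballI allI impI)
          show "u \<tturnstile> app_fm generic x ?y" using forces_mono[OF app u] x by (simp add: forces_app)
          fix y' v assume "y' \<in> names P" "(v, u) \<in> le" "v \<tturnstile> app_fm generic x y'"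
          then show "v \<tturnstile> y' \<^bold>= ?y" using uniq[of v y'] le_trans[OF _ u] x by (simp add: forces_app)
        qed
      qed
      then show "\<exists>t. (t, r) \<in> le \<and> (t \<tturnstile> \<^bold>\<exists>y. app_fm generic x y \<^bold>\<and> (\<^bold>\<forall>y'. app_fm generic x y' \<^bold>\<longrightarrow> y' \<^bold>= y))"
        using t t0 le_trans by blast
    qed
  qed
  show "q \<tturnstile> (\<^bold>\<forall>e. e \<^bold>\<in> pairs \<^bold>\<longleftrightarrow> in_pairs_fm e K K) \<^bold>\<and> function_fm generic pairs (ON W1)"
    unfolding function_fm_def forces_conj using 1 2 3 by blast
qed

text \<open>
  A copy \<open>(t, \<beta>)\<close> of \<open>t0\<close> can be found off the domain of any extension of \<open>t0\<close> that decides a new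
  element \<open>\<alpha>\<close> of \<open>A\<close>, and then the colour of \<open>\<alpha>, \<beta>\<close> is still free.
\<close>

lemma force_colour:
  assumes A: "p \<tturnstile> bijection_fm f A (ON W1)" "p \<tturnstile> subset_fm A K" "f \<in> names P"
    and B: "p \<tturnstile> bijection_fm h B (ON W2)" "p \<tturnstile> subset_fm B K" "h \<in> names P"
    and p: "p \<in> P" and c: "c \<in> W1"
  shows "\<exists>r \<alpha> \<beta>. (r, p) \<in> le \<and> \<alpha> \<in> dm r \<and> \<beta> \<in> dm r \<and> \<alpha> \<noteq> \<beta> \<and> cl r \<alpha> \<beta> = c \<and>
    (r \<tturnstile> chk \<alpha> \<^bold>\<in> A) \<and> (r \<tturnstile> chk \<beta> \<^bold>\<in> B)"
proof -
  have fnA: "p \<tturnstile> function_fm f A (ON W1)" and fnB: "p \<tturnstile> function_fm h B (ON W2)"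
    using A(1) B(1) by (simp_all add: bijection_fm_def injection_fm_def forces_conj)
  \<comment> \<open>No countable ground-model set captures \<open>A\<close>: otherwise f would map a
    countable set of arguments onto \<open>W1\<close>.\<close>
  have newA: "\<exists>r \<alpha>. (r, q) \<in> le \<and> \<alpha> \<in> dm r \<and> \<alpha> \<notin> d \<and> (r \<tturnstile> chk \<alpha> \<^bold>\<in> A)"
    if q: "(q, p) \<in> le" and d: "countable d" for q d
  proof -
    have "\<exists>y\<in>W1. \<exists>s. (s, q) \<in> le \<and> (\<forall>t x. (t, s) \<in> le \<longrightarrow> x \<in> d \<longrightarrow>
        \<not> (y \<in> W1 \<and> (t \<tturnstile> op (chk x) (chk y) \<^bold>\<in> f)))"
    proof (rule no_countable_cover[OF sigma le_P(1)[OF q] d W1_uncountable])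
      fix x y q s assume "y \<in> W1 \<and> (q \<tturnstile> op (chk x) (chk y) \<^bold>\<in> f)" "(s, q) \<in> le"
      then show "y \<in> W1 \<and> (s \<tturnstile> op (chk x) (chk y) \<^bold>\<in> f)" using forces_mono by blast
    next
      fix x y y' s assume s: "y \<in> W1 \<and> (s \<tturnstile> op (chk x) (chk y) \<^bold>\<in> f)"
        "y' \<in> W1 \<and> (s \<tturnstile> op (chk x) (chk y') \<^bold>\<in> f)" "s \<in> P" "(s, q) \<in> le"
      show "y = y'"
        by (rule function_chk[OF forces_mono[OF fnA le_trans[OF s(4) q]] _ _ A(3) s(3)])
          (use s W1_sub in auto)
    qed
    then obtain y s where y: "y \<in> W1" and s: "(s, q) \<in> le"
      and no: "\<And>t x. (t, s) \<in> le \<Longrightarrow> x \<in> d \<Longrightarrow> \<not> (t \<tturnstile> op (chk x) (chk y) \<^bold>\<in> f)" by blast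
    have sp: "(s, p) \<in> le" using s q le_trans by blast
    obtain t \<alpha> where t: "(t, s) \<in> le" "\<alpha> \<in> Field \<kappa>" "t \<tturnstile> chk \<alpha> \<^bold>\<in> A" "t \<tturnstile> op (chk \<alpha>) (chk y) \<^bold>\<in> f"
      using bijection_decide[OF forces_mono[OF A(1) sp] forces_mono[OF A(2) sp] y A(3) le_P(1)[OF s]] by blast
    then have "\<alpha> \<notin> d" using no by blast
    obtain r where r: "(r, t) \<in> le" "\<alpha> \<in> dm r" using extend[OF le_P(1)[OF t(1)] t(2)] by blast
    have "r \<tturnstile> chk \<alpha> \<^bold>\<in> A" using t(3) r(1) by (rule forces_mono)
    moreover have "(r, q) \<in> le" using r t s le_trans by blast
    ultimately show ?thesis using r \<open>\<alpha> \<notin> d\<close> by blast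
  qed
  \<comment> \<open>The pairs of a condition and a point of its domain which it forces into
    \<open>B\<close>. Their points escape every small set, by the chain condition applied to h; this
    is the hypothesis of \<open>twins\<close>.\<close>
  define I where "I = {(t, \<beta>). (t, p) \<in> le \<and> (t \<tturnstile> chk \<beta> \<^bold>\<in> B) \<and> \<beta> \<in> dm t}"
  have I: "t \<in> P \<and> \<beta> \<in> dm t" if "(t, \<beta>) \<in> I" for t \<beta>
    using that le_P(1) by (auto simp: I_def)
  have esc: "\<exists>(t, \<beta>)\<in>I. \<beta> \<notin> S" if S: "small S" for S
  proof -
    have "\<exists>y\<in>W2. \<forall>t x. (t, p) \<in> le \<longrightarrow> x \<in> S \<longrightarrow> \<not> (y \<in> W2 \<and> (t \<tturnstile> op (chk x) (chk y) \<^bold>\<in> h))"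
    proof (rule no_small_cover[OF omega2_cc S W2_large])
      fix x y q s assume "y \<in> W2 \<and> (q \<tturnstile> op (chk x) (chk y) \<^bold>\<in> h)" "(s, q) \<in> le"
      then show "y \<in> W2 \<and> (s \<tturnstile> op (chk x) (chk y) \<^bold>\<in> h)" using forces_mono by blast
    next
      fix x y y' s assume s: "y \<in> W2 \<and> (s \<tturnstile> op (chk x) (chk y) \<^bold>\<in> h)"
        "y' \<in> W2 \<and> (s \<tturnstile> op (chk x) (chk y') \<^bold>\<in> h)" "s \<in> P" "(s, p) \<in> le"
      show "y = y'"
        by (rule function_chk[OF forces_mono[OF fnB s(4)] _ _ B(3) s(3)]) (use s W2_sub in auto)
    qed
    then obtain y where y: "y \<in> W2"
      and no: "\<And>t x. (t, p) \<in> le \<Longrightarrow> x \<in> S \<Longrightarrow> \<not> (t \<tturnstile> op (chk x) (chk y) \<^bold>\<in> h)" by blast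
    obtain t \<beta> where t: "(t, p) \<in> le" "\<beta> \<in> Field \<kappa>" "t \<tturnstile> chk \<beta> \<^bold>\<in> B" "t \<tturnstile> op (chk \<beta>) (chk y) \<^bold>\<in> h"
      using bijection_decide[OF B(1,2) y B(3) p] by blast
    then have "\<beta> \<notin> S" using no by blast
    obtain r where r: "(r, t) \<in> le" "\<beta> \<in> dm r" using extend[OF le_P(1)[OF t(1)] t(2)] by blast
    have "(r, \<beta>) \<in> I"
      using forces_mono[OF t(3) r(1)] le_trans[OF r(1) t(1)] r(2) by (simp add: I_def)
    then show ?thesis using \<open>\<beta> \<notin> S\<close> by blast
  qed
  obtain t0 where t0: "t0 \<in> fst ` I" and tw: "\<forall>q c. (q, t0) \<in> le \<longrightarrow> c \<in> W1 \<longrightarrow>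
      (\<exists>(t, \<beta>)\<in>I. \<beta> \<notin> dm q \<and> dm t \<inter> dm q \<subseteq> dm t0 \<and> (\<forall>\<alpha>. \<exists>r. (r, t) \<in> le \<and> (r, q) \<in> le \<and>
        (\<alpha> \<in> dm q - dm t \<longrightarrow> cl r \<alpha> \<beta> = c)))"
    using twins[OF CH W1_small I esc] by blast
  have t0p: "(t0, p) \<in> le" using t0 by (auto simp: I_def)
  \<comment> \<open>The point \<alpha> is taken outside \<open>dm t0\<close> because a copy of
    \<open>t0\<close> may share points with q only inside \<open>dm t0\<close>. This keeps \<alpha>
    out of \<open>dm t\<close>, so the pair \<alpha>, \<beta> is still uncoloured in t; as \<beta>
    avoids \<open>dm q\<close>, it is uncoloured in q as well.\<close>
  obtain q \<alpha> where q: "(q, t0) \<in> le" and \<alpha>: "\<alpha> \<in> dm q" "\<alpha> \<notin> dm t0" "q \<tturnstile> chk \<alpha> \<^bold>\<in> A"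
    using newA[OF t0p condD(2)[OF le_P(1)[OF t0p]]] by blast
  from tw q c obtain t \<beta> r where t: "(t, \<beta>) \<in> I" "\<beta> \<notin> dm q" "dm t \<inter> dm q \<subseteq> dm t0"
    and r: "(r, t) \<in> le" "(r, q) \<in> le" "\<alpha> \<in> dm q - dm t \<longrightarrow> cl r \<alpha> \<beta> = c" by fast
  have "cl r \<alpha> \<beta> = c" using r(3) t(3) \<alpha> by blast
  moreover have "r \<tturnstile> chk \<alpha> \<^bold>\<in> A" using \<alpha>(3) r(2) by (rule forces_mono)
  moreover have "r \<tturnstile> chk \<beta> \<^bold>\<in> B" using t(1) r(1) forces_mono unfolding I_def by blast
  moreover have "(r, p) \<in> le" using r(1) t(1) le_trans unfolding I_def by blast
  moreover have "\<alpha> \<in> dm r" "\<beta> \<in> dm r" using \<alpha>(1) t(1) leD(3)[OF r(1)] leD(3)[OF r(2)] unfolding I_def by blast+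
  moreover have "\<alpha> \<noteq> \<beta>" using \<alpha>(1) t(2) by blast
  ultimately show ?thesis by blast
qed

text \<open>That every colour occurs is a density argument: the colour and names for both bijections
  are decided first, and \<open>force_colour\<close> then produces a suitable pair. Conversely, the
  values of the generic colouring are decided in \<open>W1\<close>.\<close>

lemma image_pairs:
  assumes names: "A \<in> names P" "B \<in> names P"
    and sub: "p \<tturnstile> subset_fm A K" "p \<tturnstile> subset_fm B K"
    and card: "p \<tturnstile> card_eq_fm A (ON W1)" "p \<tturnstile> card_eq_fm B (ON W2)"
  shows "p \<tturnstile> image_pairs_fm (ON W1) generic A B"
  unfolding image_pairs_fm_def forces_all forces_iff
proof (intro ballI allI impI iffI)
  fix \<xi> q assume x: "\<xi> \<in> names P" and q: "(q, p) \<in> le" and mem: "q \<tturnstile> \<xi> \<^bold>\<in> ON W1"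
  show "q \<tturnstile> \<^bold>\<exists>e. in_pairs_fm e A B \<^bold>\<and> app_fm generic e \<xi>"
  proof (rule forces_dense)
    fix r assume r: "(r, q) \<in> le"
    obtain t c where t: "(t, r) \<in> le" and c: "c \<in> W1" "t \<tturnstile> \<xi> \<^bold>= chk c"
      using mem_ON_D[OF forces_mono[OF mem r] le_P(1)[OF r]] by blast
    have tp: "(t, p) \<in> le" using t r q le_trans by blast
    obtain t1 f where t1: "(t1, t) \<in> le" and f: "f \<in> names P" "t1 \<tturnstile> bijection_fm f A (ON W1)"
      using forces_mono[OF card(1) tp] le_refl[OF le_P(1)[OF t]] unfolding card_eq_fm_def forces_ex by blast
    have t1p: "(t1, p) \<in> le" using t1 tp le_trans by blast
    obtain t2 h where t2: "(t2, t1) \<in> le" and h: "h \<in> names P" "t2 \<tturnstile> bijection_fm h B (ON W2)"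
      using forces_mono[OF card(2) t1p] le_refl[OF le_P(1)[OF t1]] unfolding card_eq_fm_def forces_ex by blast
    have t2p: "(t2, p) \<in> le" and t2t: "(t2, t) \<in> le" using t1 t2 t1p le_trans by blast+
    obtain s \<alpha> \<beta> where s: "(s, t2) \<in> le" and ab: "\<alpha> \<in> dm s" "\<beta> \<in> dm s" "\<alpha> \<noteq> \<beta>" "cl s \<alpha> \<beta> = c"
      "s \<tturnstile> chk \<alpha> \<^bold>\<in> A" "s \<tturnstile> chk \<beta> \<^bold>\<in> B"
      using force_colour[OF forces_mono[OF f(2) t2] forces_mono[OF sub(1) t2p] f(1) h(2)
          forces_mono[OF sub(2) t2p] h(1) le_P(1)[OF t2] c(1)] by blast
    note sP = le_P(1)[OF s]
    have st: "(s, t) \<in> le" using s t2t le_trans by blast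
    have ip: "s \<tturnstile> in_pairs_fm (pr \<alpha> \<beta>) A B"
      by (rule in_pairsI[OF ab(3) dm_Field[OF sP ab(1)] dm_Field[OF sP ab(2)] _ ab(5,6) eq_refl]) auto
    have "s \<tturnstile> op (pr \<alpha> \<beta>) (chk c) \<^bold>= op (pr \<alpha> \<beta>) \<xi>"
      by (rule op_cong[OF eq_refl eq_sym[OF forces_mono[OF c(2) st]]]) (use x in auto)
    with genericI[OF sP ab(1-3)] have "s \<tturnstile> op (pr \<alpha> \<beta>) \<xi> \<^bold>\<in> generic"
      unfolding ab(4) by (rule mem_cong_left)
    then have app: "s \<tturnstile> app_fm generic (pr \<alpha> \<beta>) \<xi>" using x by (simp add: forces_app)
    have "s \<tturnstile> \<^bold>\<exists>e. in_pairs_fm e A B \<^bold>\<and> app_fm generic e \<xi>"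
      by (rule forces_exI[of "pr \<alpha> \<beta>"]) (use forces_mono[OF ip] forces_mono[OF app] in \<open>auto simp: forces_conj\<close>)
    then show "\<exists>s. (s, r) \<in> le \<and> (s \<tturnstile> \<^bold>\<exists>e. in_pairs_fm e A B \<^bold>\<and> app_fm generic e \<xi>)"
      using st t le_trans by blast
  qed
next
  fix \<xi> q assume x: "\<xi> \<in> names P" and q: "(q, p) \<in> le"
    and ex: "q \<tturnstile> \<^bold>\<exists>e. in_pairs_fm e A B \<^bold>\<and> app_fm generic e \<xi>"
  show "q \<tturnstile> \<xi> \<^bold>\<in> ON W1"
  proof (rule forces_dense)
    fix r assume r: "(r, q) \<in> le"
    then obtain t e where t: "(t, r) \<in> le" and e: "e \<in> names P" "t \<tturnstile> app_fm generic e \<xi>"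
      using ex unfolding forces_ex forces_conj by blast
    then have "t \<tturnstile> op e \<xi> \<^bold>\<in> generic" using x by (simp add: forces_app)
    from op_genericD[OF this le_P(1)[OF t]] obtain s \<alpha> \<beta> where s: "(s, t) \<in> le" "\<alpha> \<in> dm s" "\<beta> \<in> dm s" "\<alpha> \<noteq> \<beta>"
      "s \<tturnstile> \<xi> \<^bold>= chk (cl s \<alpha> \<beta>)" by blast
    have "s \<tturnstile> \<xi> \<^bold>\<in> ON W1"
      by (rule mem_ON_I[OF cl_W1[OF le_P(1)[OF s(1)] s(2-4)] s(5)])
    then show "\<exists>s. (s, r) \<in> le \<and> (s \<tturnstile> \<xi> \<^bold>\<in> ON W1)" using s t le_trans by blast
  qed
qed

lemma establishes: "p \<tturnstile> establishes_fm generic K (ON W1) (ON W2)"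
  unfolding establishes_fm_def forces_all forces_imp forces_conj
  using image_pairs by blast

text \<open>Some q decides an infinite part \<open>A\<close> of \<open>R\<close> inside its own
  domain. An extension r then secures, for every type b over \<open>dm q\<close>, a new element of
  \<open>R\<close> of that type if any extension of r can have one. As \<open>R\<close> is
  uncountable, a further \<beta> outside \<open>dm r\<close> can be found; it has some type b, so r
  already contains a \<beta>' of that type. Both agree with b modulo finite, hence with each other
  at some \<alpha> in \<open>A\<close>, which gives two pairs of one colour.\<close>

lemma no_rainbow:
  assumes R: "R \<in> names P" "p \<tturnstile> subset_fm R K" "p \<tturnstile> \<^bold>\<not> card_le_fm R (ON W0)" "p \<tturnstile> rainbow_fm generic R"
    and p: "p \<in> P"
  shows False
proof -
  have memR: "r \<tturnstile> chk \<alpha> \<^bold>\<in> R" if "q \<tturnstile> chk \<alpha> \<^bold>\<in> R" "(r, q) \<in> le" for q r \<alpha>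
    using that by (rule forces_mono)
  have new: "\<exists>r \<beta>. (r, q) \<in> le \<and> \<beta> \<in> dm r \<and> \<beta> \<notin> d \<and> (r \<tturnstile> chk \<beta> \<^bold>\<in> R)"
    if q: "(q, p) \<in> le" and d: "countable d" for q d
  \<comment> \<open>If no new element could be found, all elements of \<open>R\<close> below q would
    lie in d, and \<open>card_le_ON\<close> would make \<open>R\<close> countable.\<close>
  proof (rule ccontr)
    assume none: "\<not> ?thesis"
    let ?d = "d \<inter> Field \<kappa>"
    have "|?d| \<le>o natLeq" using d countable_Int1 by (auto simp: countable_card_le_natLeq[symmetric])
    moreover have "natLeq \<le>o |W0|" using infinite_W0 infinite_iff_natLeq_ordLeq by blast
    ultimately have "|?d| \<le>o |W0|" using ordLeq_transitive by blast
    then obtain \<iota> where \<iota>: "inj_on \<iota> ?d" "\<iota> ` ?d \<subseteq> W0" unfolding card_of_ordLeq[symmetric] by auto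
    have "q \<tturnstile> card_le_fm R (ON W0)"
    proof (rule card_le_ON[OF R(1) _ W0_sub \<iota>])
      fix r x assume r: "(r, q) \<in> le" and x: "x \<in> names P" "r \<tturnstile> x \<^bold>\<in> R"
      have rp: "(r, p) \<in> le" using r q le_trans by blast
      obtain t \<beta> where t: "(t, r) \<in> le" "\<beta> \<in> Field \<kappa>" "t \<tturnstile> chk \<beta> \<^bold>\<in> R" "t \<tturnstile> x \<^bold>= chk \<beta>"
        using mem_sub_ON[OF forces_mono[OF R(2) rp] x(2,1) le_P(1)[OF r]] by blast
      obtain s where s: "(s, t) \<in> le" "\<beta> \<in> dm s" using extend[OF le_P(1)[OF t(1)] t(2)] by blast
      have "s \<tturnstile> chk \<beta> \<^bold>\<in> R" using t(3) s(1) by (rule forces_mono)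
      moreover have "(s, q) \<in> le" using s t r le_trans by blast
      ultimately have "\<beta> \<in> d" using none s(2) by blast
      then show "\<exists>t. (t, r) \<in> le \<and> (\<exists>b\<in>?d. t \<tturnstile> x \<^bold>= chk b)" using t by blast
    qed blast
    with R(3) q show False unfolding forces_not by blast
  qed
  \<comment> \<open>Each finite number of elements of \<open>R\<close> can be decided densely, and
    \<open>sigma_dense\<close> yields one condition that does so for all n at once; hence its set of
    decided elements is infinite.\<close>
  define D where "D n r \<longleftrightarrow> (\<exists>F\<subseteq>dm r. finite F \<and> card F = n \<and> (\<forall>\<alpha>\<in>F. r \<tturnstile> chk \<alpha> \<^bold>\<in> R))" for n :: nat and r
  have D_mono: "D n r" if Dq: "D n q" and rq: "(r, q) \<in> le" for n q r
  proof -
    obtain F where F: "F \<subseteq> dm q" "finite F" "card F = n" "\<forall>\<alpha>\<in>F. q \<tturnstile> chk \<alpha> \<^bold>\<in> R"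
      using Dq unfolding D_def by blast
    have "F \<subseteq> dm r" using F(1) leD(3)[OF rq] by blast
    moreover have "\<forall>\<alpha>\<in>F. r \<tturnstile> chk \<alpha> \<^bold>\<in> R" using F(4) memR[OF _ rq] by simp
    ultimately show ?thesis using F(2,3) unfolding D_def by blast
  qed
  have D_dense: "\<exists>r. (r, q) \<in> le \<and> D n r" if q: "(q, p) \<in> le" for n q
  proof (induction n)
    case 0
    have "D 0 q" unfolding D_def by (intro exI[of _ "{}"]) simp
    then show ?case using le_refl[OF le_P(1)[OF q]] by blast
  next
    case (Suc n)
    then obtain r F where r: "(r, q) \<in> le" and F: "F \<subseteq> dm r" "finite F" "card F = n" "\<forall>\<alpha>\<in>F. r \<tturnstile> chk \<alpha> \<^bold>\<in> R"
      unfolding D_def by blast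
    obtain s \<beta> where s: "(s, r) \<in> le" "\<beta> \<in> dm s" "\<beta> \<notin> F" "s \<tturnstile> chk \<beta> \<^bold>\<in> R"
      using new[OF le_trans[OF r q] countable_finite[OF F(2)]] by blast
    have "D (Suc n) s" unfolding D_def
      using F s leD(3)[OF s(1)] memR[OF _ s(1)] by (intro exI[of _ "insert \<beta> F"]) auto
    then show ?case using s r le_trans by blast
  qed
  have "\<exists>q. (q, p) \<in> le \<and> (\<forall>n\<in>UNIV. D n q)"
    by (rule sigma_dense[OF sigma p]) (use D_dense D_mono in auto)
  then obtain q where q: "(q, p) \<in> le" and Dq: "\<And>n. D n q" by blast
  note qP = le_P(1)[OF q]
  define A where "A = {\<alpha> \<in> dm q. q \<tturnstile> chk \<alpha> \<^bold>\<in> R}"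
  have infA: "infinite A"
  proof
    assume fin: "finite A"
    obtain F where "F \<subseteq> dm q" "card F = Suc (card A)" "\<forall>\<alpha>\<in>F. q \<tturnstile> chk \<alpha> \<^bold>\<in> R"
      using Dq[of "Suc (card A)"] unfolding D_def by blast
    then have "F \<subseteq> A" "card F = Suc (card A)" by (auto simp: A_def)
    then show False using card_mono[OF fin, of F] by simp
  qed
  \<comment> \<open>The point \<beta> has type b over \<open>dm q\<close>, modulo finite. It is
    required to lie outside \<open>dm q\<close> so that it differs from every element of
    \<open>A\<close>.\<close>
  define T where "T b \<beta> r \<longleftrightarrow> \<beta> \<in> dm r - dm q \<and> (r \<tturnstile> chk \<beta> \<^bold>\<in> R) \<and> finite {\<alpha> \<in> dm q. cl r \<alpha> \<beta> \<noteq> cl q \<alpha> b}"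
    for b \<beta> r
  have T_mono: "T b \<beta> s" if T: "T b \<beta> r" and sr: "(s, r) \<in> le" and rq: "(r, q) \<in> le" for b \<beta> r s
  proof -
    have "\<beta> \<in> dm s - dm q" "s \<tturnstile> chk \<beta> \<^bold>\<in> R"
      using T leD(3)[OF sr] memR[OF _ sr] unfolding T_def by auto
    moreover have "cl s \<alpha> \<beta> = cl r \<alpha> \<beta>" if "\<alpha> \<in> dm q" for \<alpha>
      using that leD(4)[OF sr, of \<alpha> \<beta>] leD(3)[OF rq] T unfolding T_def by blast
    then have "{\<alpha> \<in> dm q. cl s \<alpha> \<beta> \<noteq> cl q \<alpha> b} = {\<alpha> \<in> dm q. cl r \<alpha> \<beta> \<noteq> cl q \<alpha> b}" by auto
    ultimately show ?thesis using T unfolding T_def by simp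
  qed
  \<comment> \<open>Type b is either realised by an element of \<open>R\<close> in r or is never
    realised by one in an extension of r. There are only countably many b in \<open>dm q\<close>, so
    one r settles them all.\<close>
  define E where "E b r \<longleftrightarrow> (r, q) \<in> le \<and> ((\<exists>\<beta>. T b \<beta> r) \<or> (\<forall>s \<beta>. (s, r) \<in> le \<longrightarrow> \<not> T b \<beta> s))" for b r
  have "\<exists>r. (r, q) \<in> le \<and> (\<forall>b\<in>dm q. E b r)"
  proof (rule sigma_dense[OF sigma qP condD(2)[OF qP]])
    show "\<exists>s. (s, r) \<in> le \<and> E b s" if r: "(r, q) \<in> le" for b r
    proof (cases "\<exists>s \<beta>. (s, r) \<in> le \<and> T b \<beta> s")
      case True
      then show ?thesis using le_trans[OF _ r] unfolding E_def by blast
    next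
      case False
      then show ?thesis using le_refl[OF le_P(1)[OF r]] r unfolding E_def by blast
    qed
    show "E b s" if "E b r" "(s, r) \<in> le" for b r s
      using that T_mono le_trans unfolding E_def by blast
  qed
  then obtain r where r: "(r, q) \<in> le" and Er: "\<And>b. b \<in> dm q \<Longrightarrow> E b r" by blast
  note rP = le_P(1)[OF r]
  obtain s \<beta> where s: "(s, r) \<in> le" and \<beta>: "\<beta> \<in> dm s" "\<beta> \<notin> dm r" "s \<tturnstile> chk \<beta> \<^bold>\<in> R"
    using new[OF le_trans[OF r q] condD(2)[OF rP]] by blast
  note sP = le_P(1)[OF s]
  have sq: "(s, q) \<in> le" using s r le_trans by blast
  obtain b where b: "b \<in> dm q" "finite {\<alpha> \<in> dm q. cl s \<alpha> \<beta> \<noteq> cl q \<alpha> b}" using leD(5)[OF sq \<beta>(1)] by blast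
  have "\<beta> \<notin> dm q" using \<beta>(2) leD(3)[OF r] by blast
  then have "T b \<beta> s" using \<beta> b unfolding T_def by blast
  then obtain \<beta>' where \<beta>': "T b \<beta>' r" using Er[OF b(1)] s unfolding E_def by blast
  have Ts: "T b \<beta>' s" using T_mono[OF \<beta>' s r] .
  have ne: "\<beta>' \<noteq> \<beta>" using \<beta>' \<beta>(2) unfolding T_def by blast
  have "{\<alpha> \<in> dm q. cl s \<alpha> \<beta> \<noteq> cl s \<alpha> \<beta>'} \<subseteq>
      {\<alpha> \<in> dm q. cl s \<alpha> \<beta> \<noteq> cl q \<alpha> b} \<union> {\<alpha> \<in> dm q. cl s \<alpha> \<beta>' \<noteq> cl q \<alpha> b}" by auto
  then have "finite {\<alpha> \<in> dm q. cl s \<alpha> \<beta> \<noteq> cl s \<alpha> \<beta>'}"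
    by (rule finite_subset) (use b(2) Ts in \<open>simp add: T_def\<close>)
  \<comment> \<open>The two types differ only finitely often, while \<open>A\<close> is
    infinite.\<close>
  then have "\<not> A \<subseteq> {\<alpha> \<in> dm q. cl s \<alpha> \<beta> \<noteq> cl s \<alpha> \<beta>'}" using infA finite_subset[of A] by blast
  then obtain \<alpha> where \<alpha>: "\<alpha> \<in> A" "cl s \<alpha> \<beta> = cl s \<alpha> \<beta>'" unfolding A_def by blast
  have \<alpha>s: "\<alpha> \<in> dm s" "\<alpha> \<noteq> \<beta>" "\<alpha> \<noteq> \<beta>'" "s \<tturnstile> chk \<alpha> \<^bold>\<in> R"
    using \<alpha>(1) \<open>\<beta> \<notin> dm q\<close> Ts leD(3)[OF sq] memR[OF _ sq] unfolding A_def T_def by auto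
  have \<beta>s: "\<beta>' \<in> dm s" "s \<tturnstile> chk \<beta>' \<^bold>\<in> R" using Ts unfolding T_def by blast+
  note F = dm_Field[OF sP]
  have ip: "s \<tturnstile> in_pairs_fm (pr \<alpha> \<beta>) R R" "s \<tturnstile> in_pairs_fm (pr \<alpha> \<beta>') R R"
    using in_pairsI[OF \<alpha>s(2) F F _ \<alpha>s(4) \<beta>(3) eq_refl] in_pairsI[OF \<alpha>s(3) F F _ \<alpha>s(4) \<beta>s(2) eq_refl]
      \<alpha>s(1) \<beta>(1) \<beta>s(1) by auto
  have app: "s \<tturnstile> app_fm generic (pr \<alpha> \<beta>) (chk (cl s \<alpha> \<beta>))" "s \<tturnstile> app_fm generic (pr \<alpha> \<beta>') (chk (cl s \<alpha> \<beta>))"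
    using genericI[OF sP \<alpha>s(1) \<beta>(1) \<alpha>s(2)] genericI[OF sP \<alpha>s(1) \<beta>s(1) \<alpha>s(3)] \<alpha>(2)
    by (simp_all add: forces_app)
  have "s \<tturnstile> rainbow_fm generic R" using R(4) le_trans[OF sq q] by (rule forces_mono)
  then have "s \<tturnstile> pr \<alpha> \<beta> \<^bold>= pr \<alpha> \<beta>'"
    unfolding rainbow_fm_def forces_all forces_imp forces_conj
    using ip app le_refl[OF sP] up_names[OF chk_names chk_names] chk_names by blast
  then have "\<alpha> = \<alpha> \<and> \<beta> = \<beta>' \<or> \<alpha> = \<beta>' \<and> \<beta> = \<alpha>"
    using up_chk_inject[OF _ sP F F F F] \<alpha>s(1) \<beta>(1) \<beta>s(1) by blast
  then show False using ne \<alpha>s by blast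
qed

lemma no_rainbow_colouring: "holds_in_extension P le (no_rainbow_colouring_fm (check_ordinal P \<kappa>))"
  unfolding holds_in_extension_def check_ordinal_ON no_rainbow_colouring_fm_def
proof
  fix p
  have 1: "q \<tturnstile> \<^bold>\<not> (\<^bold>\<exists>R. subset_fm R K \<^bold>\<and> \<^bold>\<not> card_le_fm R (ON W0) \<^bold>\<and> rainbow_fm generic R)" for q
    unfolding forces_not[of q]
  proof (intro allI impI notI)
    fix r assume r: "(r, q) \<in> le"
      and "r \<tturnstile> \<^bold>\<exists>R. subset_fm R K \<^bold>\<and> \<^bold>\<not> card_le_fm R (ON W0) \<^bold>\<and> rainbow_fm generic R"
    then obtain s R where s: "(s, r) \<in> le" "R \<in> names P" "s \<tturnstile> subset_fm R K"
      "s \<tturnstile> \<^bold>\<not> card_le_fm R (ON W0)" "s \<tturnstile> rainbow_fm generic R"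
      unfolding forces_ex forces_conj using le_refl[OF le_P(1)[OF r]] by blast
    then show False using no_rainbow le_P(1) by blast
  qed
  show "p \<tturnstile> \<^bold>\<exists>w0 w1 w2. omega_fm w0 \<^bold>\<and> card_suc_fm w1 w0 \<^bold>\<and> card_suc_fm w2 w1 \<^bold>\<and>
      (\<^bold>\<exists>g. pair_colouring_fm g K w1 \<^bold>\<and> establishes_fm g K w1 w2 \<^bold>\<and>
        \<^bold>\<not> (\<^bold>\<exists>R. subset_fm R K \<^bold>\<and> \<^bold>\<not> card_le_fm R w0 \<^bold>\<and> rainbow_fm g R))"
    apply (rule forces_exI[OF ON_names[of W0]])
    apply (rule forces_exI[OF ON_names[of W1]])
    apply (rule forces_exI[OF ON_names[of W2]])
    apply (subst forces_conj, rule conjI, rule omega_W0)+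
    apply (subst forces_conj, rule conjI, rule card_suc_W1)
    apply (subst forces_conj, rule conjI, rule card_suc_W2)
    apply (rule forces_exI[OF generic_names])
    apply (subst forces_conj, rule conjI, rule pair_colouring)
    apply (subst forces_conj, rule conjI, rule establishes)
    apply (rule 1)
    done
qed

end

text \<open>The colour table is coded by a subset of 'a through an injection of triples; the outer
  singleton only lifts this to the type 'a set set of the conditions. Values of g outside a are
  forgotten, so equal colourings give one condition.\<close>

definition encode :: "('a \<times> 'a \<times> 'a \<Rightarrow> 'a) \<Rightarrow> 'a set \<Rightarrow> ('a \<Rightarrow> 'a \<Rightarrow> 'a) \<Rightarrow> 'a set set" where
  "encode h a g = {h ` {(\<alpha>, \<beta>, g \<alpha> \<beta>) | \<alpha> \<beta>. \<alpha> \<in> a \<and> \<beta> \<in> a}}"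

definition graph :: "('a \<times> 'a \<times> 'a \<Rightarrow> 'a) \<Rightarrow> 'a set set \<Rightarrow> ('a \<times> 'a \<times> 'a) set" where
  "graph h p = h -` \<Union> p"

lemma graph_encode: "inj h \<Longrightarrow> graph h (encode h a g) = {(\<alpha>, \<beta>, g \<alpha> \<beta>) | \<alpha> \<beta>. \<alpha> \<in> a \<and> \<beta> \<in> a}"
  by (simp add: graph_def encode_def inj_vimage_image_eq)

lemma encode_cong:
  assumes "\<And>\<alpha> \<beta>. \<alpha> \<in> a \<Longrightarrow> \<beta> \<in> a \<Longrightarrow> g \<alpha> \<beta> = g' \<alpha> \<beta>"
  shows "encode h a g = encode h a g'"
proof -
  have "{(\<alpha>, \<beta>, g \<alpha> \<beta>) | \<alpha> \<beta>. \<alpha> \<in> a \<and> \<beta> \<in> a} = {(\<alpha>, \<beta>, g' \<alpha> \<beta>) | \<alpha> \<beta>. \<alpha> \<in> a \<and> \<beta> \<in> a}"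
    using assms by auto
  then show ?thesis by (simp only: encode_def)
qed

text \<open>The domain can be recovered from a code through its diagonal entries, which carry the
  mark \<open>x1\<close>, and the colouring through uniqueness of the third coordinate.\<close>

lemma ex_colouring_forcing:
  fixes \<kappa> :: "'a rel"
  assumes CH "Card_order \<kappa>" "card_omega2 \<le>o \<kappa>"
  shows "\<exists>x1 (P :: 'a set set set) dm cl. colouring_forcing \<kappa> x1 P dm cl"
proof -
  let ?W = "seg \<kappa> natLeq"
  note large = large_Field[OF assms(2,3)]
  have wo: "Well_order \<kappa>" using assms(2) card_order_on_well_order_on by blast
  then have wf: "wf (\<kappa> - Id)" by (simp add: well_order_on_def)
  \<comment> \<open>The diagonal mark is any element outside the set of colours; there is one
    because the colours are only \<omega>1 many and \<kappa> is larger.\<close>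
  have "\<not> Field \<kappa> \<subseteq> ?W" using small_subset[OF small_seg[OF wo]] large by blast
  then obtain x1 where x1: "x1 \<notin> ?W" by blast
  have inf: "infinite (Field \<kappa>)" using large countable_small countable_finite by blast
  then obtain k where "k \<in> Field \<kappa>" by fastforce
  \<comment> \<open>The least element of \<kappa> has no predecessors and thus shows that there is
    at least one colour.\<close>
  then obtain z where z: "z \<in> Field \<kappa>" "\<And>y. (y, z) \<in> \<kappa> - Id \<Longrightarrow> y \<notin> Field \<kappa>"
    by (rule wfE_min[OF wf]) blast
  have "underS \<kappa> z = {}" using z(2) by (auto simp: underS_def Field_def)
  then have "z \<in> ?W" using z(1) by (auto simp: seg_def countable_card_le_natLeq[symmetric])
  obtain h :: "'a \<times> 'a \<times> 'a \<Rightarrow> 'a" where h: "inj h"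
    using ex_inj_triple[OF infinite_super[OF subset_UNIV inf]] by blast
  define P where "P = {encode h a g | a g. is_colouring (Field \<kappa>) ?W x1 a g}"
  define dm where "dm p = {\<alpha>. (\<alpha>, \<alpha>, x1) \<in> graph h p}" for p
  define cl where "cl p \<alpha> \<beta> = (THE \<xi>. (\<alpha>, \<beta>, \<xi>) \<in> graph h p)" for p \<alpha> \<beta>
  have dm: "dm (encode h a g) = a" if "is_colouring (Field \<kappa>) ?W x1 a g" for a g
    using that by (auto simp: dm_def graph_encode[OF h] is_colouring_def)
  have cl: "cl (encode h a g) \<alpha> \<beta> = g \<alpha> \<beta>" if "\<alpha> \<in> a" "\<beta> \<in> a" for a g \<alpha> \<beta>
    unfolding cl_def graph_encode[OF h] using that by auto
  have PD: "\<exists>g. is_colouring (Field \<kappa>) ?W x1 (dm p) g \<and> p = encode h (dm p) g \<and>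
      (\<forall>\<alpha>\<in>dm p. \<forall>\<beta>\<in>dm p. cl p \<alpha> \<beta> = g \<alpha> \<beta>)" if "p \<in> P" for p
  proof -
    obtain a g where ag: "p = encode h a g" "is_colouring (Field \<kappa>) ?W x1 a g"
      using \<open>p \<in> P\<close> unfolding P_def by blast
    then have "dm p = a" using dm by simp
    then show ?thesis using ag cl by (intro exI[of _ g]) simp
  qed
  have "colouring_forcing \<kappa> x1 P dm cl"
  proof
    show "x1 \<notin> ?W" by (rule x1)
    show "?W \<noteq> {}" using \<open>z \<in> ?W\<close> by blast
    show "Field \<kappa> \<noteq> {}" using z by blast
    show "is_colouring (Field \<kappa>) ?W x1 (dm p) (cl p)" if "p \<in> P" for p
      using PD[OF that] unfolding is_colouring_def by auto
    show "\<exists>p\<in>P. dm p = a \<and> (\<forall>\<alpha>\<in>a. \<forall>\<beta>\<in>a. cl p \<alpha> \<beta> = g \<alpha> \<beta>)"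
      if "is_colouring (Field \<kappa>) ?W x1 a g" for a g
    proof (rule bexI[of _ "encode h a g"])
      show "encode h a g \<in> P" using that unfolding P_def by blast
      show "dm (encode h a g) = a \<and> (\<forall>\<alpha>\<in>a. \<forall>\<beta>\<in>a. cl (encode h a g) \<alpha> \<beta> = g \<alpha> \<beta>)"
        using dm[OF that] cl by simp
    qed
    show "p = q" if pq: "p \<in> P" "q \<in> P" "dm p = dm q" "\<forall>\<alpha>\<in>dm p. \<forall>\<beta>\<in>dm p. cl p \<alpha> \<beta> = cl q \<alpha> \<beta>" for p q
    proof -
      obtain g where g: "p = encode h (dm p) g" "\<forall>\<alpha>\<in>dm p. \<forall>\<beta>\<in>dm p. cl p \<alpha> \<beta> = g \<alpha> \<beta>"
        using PD[OF pq(1)] by blast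
      obtain g' where g': "q = encode h (dm q) g'" "\<forall>\<alpha>\<in>dm q. \<forall>\<beta>\<in>dm q. cl q \<alpha> \<beta> = g' \<alpha> \<beta>"
        using PD[OF pq(2)] by blast
      have "encode h (dm p) g = encode h (dm p) g'"
        by (rule encode_cong) (use g(2) g'(2) pq(3,4) in simp)
      then show ?thesis using g(1) g'(1) pq(3) by metis
    qed
  qed (fact assms)+
  then show ?thesis by blast
qed

theorem theorem2p8:
  fixes \<kappa> :: "'a rel"
  assumes CH
    and "Card_order \<kappa>"
    and "card_omega2 \<le>o \<kappa>"
  shows "\<exists>(P :: 'a set set set) le.
    P \<noteq> {} \<and> partial_order_on P le \<and> sigma_complete P le \<and> omega2_cc P le \<and>
    holds_in_extension P le (no_rainbow_colouring_fm (check_ordinal P \<kappa>))"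
proof -
  obtain x1 dm cl and P :: "'a set set set" where "colouring_forcing \<kappa> x1 P dm cl"
    using ex_colouring_forcing[OF assms] by blast
  then interpret colouring_forcing \<kappa> x1 P dm cl .
  show ?thesis
    using P_nonempty partial_order sigma omega2_cc no_rainbow_colouring by blast
qed

end
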